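(* Let $X^*\in\mathcal{X}^*$ be an optimal solution of $\min_{X\in\mathcal{S}_n}f(X)$ with $\operatorname{rank}(X^* )=r$ which satisfies the eigen-gap assumption $\lambda_{n-r}(\nabla f(X^* ))-\lambda_n(\nabla f(X^* ))>0$. Let $\delta$ satisfy $0<\delta\le\lambda_{n-r}(\nabla f(X^* ))-\lambda_n(\nabla f(X^* ))$ and set $$R_0:=\frac18\Big(r\beta+\frac{\sqrt{2r}\,B}{\lambda_r(X^* )}\Big)^{-1}\delta .$$ There exist universal constants $C_1,C_2>0$ such that the following holds. Consider running projected SGD with mini-batches (as described in the context) for $T$ iterations with fixed step-size $\eta_t=\eta=\frac{R_0}{10G\sqrt{T}\log(8T)}$, from a first iterate $X_1\in\mathcal{S}_n$ with $\operatorname{rank}(X_1)\le r$ and $\|X_1-X^*\|_F\le R_0/2$, and with a constant (over iterations) mini-batch size $L$ satisfying $$L\ \ge\ C_1\max\Big\{\Big(\frac{\sigma}{GR_0}\Big)^2,\ \frac{B^2r^2}{\delta^2}\log(nT)\Big\}.$$ Then, for any $T$ sufficiently large, with probability at least $1/2$ both of the following hold: (1) $f(\bar X)-f^*\le C_2\,\dfrac{GR_0\log T}{\sqrt T}$ (where $\bar X$ is the returned solution, using either option I or option II); (2) for all $t\in\{1,\dots,T-1\}$, $\operatorname{rank}(X_{t+1})\le r$. Moreover, if option I is used for the returned solution, then $\operatorname{rank}(\bar X)\le r$.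
   Context: $\mathbb{S}^n$ is the space of $n\times n$ real symmetric matrices, $\|\cdot\|_F$ the Frobenius norm, $\|\cdot\|$ the spectral norm; $\lambda_1(M)\ge\dots\ge\lambda_n(M)$ are the eigenvalues of $M\in\mathbb{S}^n$. The spectrahedron is $\mathcal{S}_n=\{X\in\mathbb{S}^n: X\succeq0,\ \operatorname{Tr}(X)=1\}$ and $\Pi_{\mathcal{S}_n}$ is the Euclidean (Frobenius) projection onto it. The function $f:\mathbb{S}^n\to\mathbb{R}$ is convex and $\beta$-smooth, i.e. $\|\nabla f(X)-\nabla f(Y)\|_F\le\beta\|X-Y\|_F$. $\mathcal{X}^*$ is the set of minimizers of $f$ over $\mathcal{S}_n$, and $f^*$ the minimal value. It is understood that $r<n$, so that $\lambda_{n-r}$ is defined. Stochastic oracle: $f$ is accessed through a stochastic first-order oracle which, queried with a point $X\in\mathbb{S}^n$, returns a random matrix $\widehat\nabla\in\mathbb{S}^n$ such that (i) $\mathbb{E}[\widehat\nabla\mid X]=\nabla f(X)$; (ii) $\|\widehat\nabla\|_F\le G$ and $\|\widehat\nabla\|\le B$; (iii) $\mathbb{E}[\|\widehat\nabla-\nabla f(X)\|_F^2\mid X]\le\sigma^2$, for some constants $G,B,\sigma^2>0$. Different oracle calls use independent randomness. Projected SGD with mini-batches: input $X_1\in\mathcal{S}_n$, batch-size $L$, horizon $T$, step-sizes $\{\eta_t\}_{t=1}^{T-1}$. For $t=1,\dots,T-1$: call the oracle $L$ times at $X_t$, obtaining $\widehat\nabla_t^{(1)},\dots,\widehat\nabla_t^{(L)}$;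 set $\widehat\nabla_t=\frac1L\sum_{i=1}^L\widehat\nabla_t^{(i)}$ and $X_{t+1}=\Pi_{\mathcal{S}_n}[X_t-\eta_t\widehat\nabla_t]$. Return $\bar X$ by one of: option I: $\bar X=X_{t_0}$ with $t_0$ uniform on $\{1,\dots,T\}$ (independent of everything else); option II: $\bar X=\frac1T\sum_{i=1}^TX_i$. "$T$ sufficiently large" means larger than a threshold that may depend on the problem parameters. *)

theory Defs
  imports
    "HOL-Probability.Probability"
    "Jordan_Normal_Form.Char_Poly"
    "Jordan_Normal_Form.DL_Rank"
begin

(* The dimension n is a natural number, not a type: universal constants have to be
   quantified before it.  Hence the matrices of Jordan_Normal_Form. *)

definition sym_mats :: "nat \<Rightarrow> real mat set" where
  "sym_mats n = {A \<in> carrier_mat n n. transpose_mat A = A}"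

definition frob_inner :: "real mat \<Rightarrow> real mat \<Rightarrow> real" where
  "frob_inner A B = (\<Sum>i<dim_row A. \<Sum>j<dim_col A. A $$ (i, j) * B $$ (i, j))"

definition frob_norm :: "real mat \<Rightarrow> real" where
  "frob_norm A = sqrt (frob_inner A A)"

(* The operator norm with respect to the Euclidean norm. *)
definition spectral_norm :: "real mat \<Rightarrow> real" where
  "spectral_norm A =
     (SUP v \<in> {v \<in> carrier_vec (dim_col A). scalar_prod v v \<le> 1}.
        sqrt (scalar_prod (A *\<^sub>v v) (A *\<^sub>v v)))"

definition mat_trace :: "real mat \<Rightarrow> real" where
  "mat_trace A = (\<Sum>i<dim_row A. A $$ (i, i))"

definition psd :: "nat \<Rightarrow> real mat \<Rightarrow> bool" where
  "psd n A \<longleftrightarrow> A \<in> sym_mats n \<and> (\<forall>v \<in> carrier_vec n. 0 \<le> scalar_prod v (A *\<^sub>v v))"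

definition spectrahedron :: "nat \<Rightarrow> real mat set" where
  "spectrahedron n = {X. psd n X \<and> mat_trace X = 1}"

(* The k-th largest eigenvalue, counted from 1 and with multiplicity.  For a symmetric
   n x n matrix the characteristic polynomial has exactly n real roots with multiplicity,
   so the value is meaningful for 1 <= k <= n. *)
definition lambda_desc :: "nat \<Rightarrow> real mat \<Rightarrow> real" where
  "lambda_desc k A = rev (sorted_list_of_multiset (proots (char_poly A))) ! (k - 1)"

definition spectrahedron_proj :: "nat \<Rightarrow> real mat \<Rightarrow> real mat" where
  "spectrahedron_proj n Y = arg_min_on (\<lambda>X. frob_norm (X - Y)) (spectrahedron n)"

definition convex_on_sym :: "nat \<Rightarrow> (real mat \<Rightarrow> real) \<Rightarrow> bool" where
  "convex_on_sym n f \<longleftrightarrow>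
     (\<forall>X \<in> sym_mats n. \<forall>Y \<in> sym_mats n. \<forall>u. 0 \<le> u \<and> u \<le> 1 \<longrightarrow>
        f ((1 - u) \<cdot>\<^sub>m X + u \<cdot>\<^sub>m Y) \<le> (1 - u) * f X + u * f Y)"

(* D is the (Frechet) gradient of f at X in the Euclidean space of symmetric matrices
   with the Frobenius inner product. *)
definition has_gradient_sym ::
  "nat \<Rightarrow> (real mat \<Rightarrow> real) \<Rightarrow> real mat \<Rightarrow> real mat \<Rightarrow> bool" where
  "has_gradient_sym n f D X \<longleftrightarrow>
     D \<in> sym_mats n \<and>
     (\<forall>e > 0. \<exists>d > 0. \<forall>Y \<in> sym_mats n. frob_norm (Y - X) < d \<longrightarrow>
        \<bar>f Y - f X - frob_inner D (Y - X)\<bar> \<le> e * frob_norm (Y - X))"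

definition smooth_with_gradient ::
  "nat \<Rightarrow> real \<Rightarrow> (real mat \<Rightarrow> real) \<Rightarrow> (real mat \<Rightarrow> real mat) \<Rightarrow> bool" where
  "smooth_with_gradient n \<beta> f grad \<longleftrightarrow>
     (\<forall>X \<in> sym_mats n. has_gradient_sym n f (grad X) X) \<and>
     (\<forall>X \<in> sym_mats n. \<forall>Y \<in> sym_mats n.
        frob_norm (grad X - grad Y) \<le> \<beta> * frob_norm (X - Y))"

definition opt_value :: "nat \<Rightarrow> (real mat \<Rightarrow> real) \<Rightarrow> real" where
  "opt_value n f = (INF X \<in> spectrahedron n. f X)"

(* The symmetric matrices with their Borel sigma-algebra, i.e. the one generated by
   the entries. *)
definition sym_borel :: "nat \<Rightarrow> real mat measure" where
  "sym_borel n =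
     vimage_algebra (sym_mats n)
       (\<lambda>A. restrict (\<lambda>ij. A $$ ij) ({..<n} \<times> {..<n}))
       (Pi\<^sub>M ({..<n} \<times> {..<n}) (\<lambda>_. borel))"

(* The oracle is a Markov kernel: Or X is the conditional law of the answer to the query X.
   The mean is taken entrywise; the answers are almost surely bounded, hence integrable. *)
definition stochastic_oracle ::
  "nat \<Rightarrow> (real mat \<Rightarrow> real mat) \<Rightarrow> real \<Rightarrow> real \<Rightarrow> real \<Rightarrow> (real mat \<Rightarrow> real mat measure) \<Rightarrow> bool"
where
  "stochastic_oracle n grad G B \<sigma> Or \<longleftrightarrow>
     Or \<in> measurable (sym_borel n) (prob_algebra (sym_borel n)) \<and>
     (\<forall>X \<in> sym_mats n.
        (\<forall>i < n. \<forall>j < n. (LINT A | Or X. A $$ (i, j)) = grad X $$ (i, j)) \<and>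
        (AE A in Or X. frob_norm A \<le> G \<and> spectral_norm A \<le> B) \<and>
        (LINT A | Or X. (frob_norm (A - grad X))\<^sup>2) \<le> \<sigma>\<^sup>2)"

definition avg_mat :: "nat \<Rightarrow> nat \<Rightarrow> (nat \<Rightarrow> real mat) \<Rightarrow> real mat" where
  "avg_mat n m A = mat n n (\<lambda>ij. (\<Sum>k = 1..m. A k $$ ij) / real m)"

(* psgd_law n Or eta L X1 k is the joint law of the iterates X_1, ..., X_{k+1}, a measure on
   functions with domain {1..k+1}.  Given the past w, the L oracle answers at the current
   iterate are independent with law Or (current iterate). *)
fun psgd_law ::
  "nat \<Rightarrow> (real mat \<Rightarrow> real mat measure) \<Rightarrow> (nat \<Rightarrow> real) \<Rightarrow> nat \<Rightarrow> real mat \<Rightarrow> nat \<Rightarrow>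
   (nat \<Rightarrow> real mat) measure"
where
  "psgd_law n Or \<eta> L X1 0 =
     return (Pi\<^sub>M {1..1} (\<lambda>_. sym_borel n)) (restrict (\<lambda>_. X1) {1..1})"
| "psgd_law n Or \<eta> L X1 (Suc k) =
     psgd_law n Or \<eta> L X1 k \<bind>
       (\<lambda>w. let t = Suc k in
          distr (Pi\<^sub>M {1..L} (\<lambda>_. Or (w t))) (Pi\<^sub>M {1..Suc t} (\<lambda>_. sym_borel n))
            (\<lambda>g. w (Suc t := spectrahedron_proj n (w t - \<eta> t \<cdot>\<^sub>m avg_mat n L g))))"

(* The law of (X_1, ..., X_T) together with an independent uniform index t0. *)
definition psgd_space ::
  "nat \<Rightarrow> (real mat \<Rightarrow> real mat measure) \<Rightarrow> (nat \<Rightarrow> real) \<Rightarrow> nat \<Rightarrow> real mat \<Rightarrow> nat \<Rightarrow>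
   ((nat \<Rightarrow> real mat) \<times> nat) measure"
where
  "psgd_space n Or \<eta> L X1 T =
     psgd_law n Or \<eta> L X1 (T - 1) \<Otimes>\<^sub>M uniform_count_measure {1..T}"

datatype output_rule = Random_Iterate | Average

fun psgd_output ::
  "output_rule \<Rightarrow> nat \<Rightarrow> nat \<Rightarrow> (nat \<Rightarrow> real mat) \<times> nat \<Rightarrow> real mat" where
  "psgd_output Random_Iterate n T (X, t0) = X t0"
| "psgd_output Average n T (X, t0) = avg_mat n T X"

definition R0_radius :: "nat \<Rightarrow> real \<Rightarrow> real \<Rightarrow> real \<Rightarrow> real \<Rightarrow> real" where
  "R0_radius r \<beta> B lam \<delta> =
     1 / 8 * inverse (real r * \<beta> + sqrt (2 * real r) * B / lam) * \<delta>"

end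

(* Near an optimum Xs with an eigen-gap the projection step does not increase the rank: if X has
   rank at most r and lies close to Xs, its range is contained in an r-dimensional space V close to
   the bottom eigenspace of the gradient, and the gap makes the average of the stochastic gradient
   over V smaller than its value on every unit vector orthogonal to V.  A rank above r after the
   projection would give a vector contradicting this, whatever the step size.

   The squared distance to Xs plus the accumulated excess 2 eta (f(X_t) - min f) grows in expectation
   by at most eta^2 G^2 per step.  Stopping it at R0^2 on leaving the ball or on a large deviation
   of the mini-batch gives a potential whose expectation stays near R0^2/4, so Markov's
   inequality yields both claims at once.  Deviations are controlled by Hoeffding's inequality on a
   finite net of vectors; the size of the net depends only on n, G and delta and is absorbed by the
   threshold on T. *)
theory Submission
  imports Defs "Jordan_Normal_Form.Spectral_Radius"
begin

unbundle no inner_syntax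
unbundle no vec_syntax

section \<open>Orthonormal frames and the spectral theorem\<close>

text \<open>The rank claim and the convergence claim depend on each other: the rank argument needs
  the iterate inside the ball of radius \<open>R0\<close>, and staying in that ball is controlled
  only in expectation. The step size drops out of the rank argument because two inequalities, one
  from the trace of the projection and one from a vector in its supposedly too large range, both
  contain the eigenvalue threshold \<open>s\<close> of the projection. Eliminating \<open>s\<close>
  leaves a comparison of Rayleigh quotients of the stochastic gradient with \<eta> as a common
  factor. The two summands of \<open>R0\<close> pay for two errors in it: \<open>r * \<beta>\<close>
  for the drift of the gradient between the iterate and \<open>Xs\<close>, and
  \<open>sqrt (2 * r) * B / lam\<close> for the angle between the range of the iterate and the
  bottom eigenspace, by a sine-theta bound in which \<open>lam\<close> is the smallest positive
  eigenvalue of \<open>Xs\<close>.\<close>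

lemma sym_mats_carrier: "A \<in> sym_mats n \<Longrightarrow> A \<in> carrier_mat n n"
  by (simp add: sym_mats_def)

lemma sym_mats_index: "A \<in> sym_mats n \<Longrightarrow> i < n \<Longrightarrow> j < n \<Longrightarrow> A $$ (i, j) = A $$ (j, i)"
proof -
  assume A: "A \<in> sym_mats n" and ij: "i < n" "j < n"
  have "A \<in> carrier_mat n n" using A by (simp add: sym_mats_def)
  then have "transpose_mat A $$ (i, j) = A $$ (j, i)" using ij by simp
  moreover have "transpose_mat A = A" using A by (simp add: sym_mats_def)
  ultimately show "A $$ (i, j) = A $$ (j, i)" by simp
qed

lemma sym_matsI:
  "A \<in> carrier_mat n n \<Longrightarrow> (\<And>i j. i < n \<Longrightarrow> j < n \<Longrightarrow> A $$ (i, j) = A $$ (j, i)) \<Longrightarrow> A \<in> sym_mats n"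
  unfolding sym_mats_def by auto

section \<open>Scalar products and dimension counting\<close>

lemma scalar_prod_sum: "x \<in> carrier_vec n \<Longrightarrow> y \<in> carrier_vec n \<Longrightarrow> x \<bullet> y = (\<Sum>i<n. x $ i * y $ i)"
  by (simp add: scalar_prod_def lessThan_atLeast0)

lemma scalar_prod_self_nonneg: "0 \<le> (x::real vec) \<bullet> x"
  by (simp add: scalar_prod_def sum_nonneg)

lemma scalar_prod_self_eq_0: "(x::real vec) \<in> carrier_vec n \<Longrightarrow> x \<bullet> x = 0 \<longleftrightarrow> x = 0\<^sub>v n"
proof
  assume x: "x \<in> carrier_vec n" and "x \<bullet> x = 0"
  then have "(\<Sum>i<n. x $ i * x $ i) = 0" by (simp add: scalar_prod_sum)
  then have "\<forall>i\<in>{..<n}. x $ i * x $ i = 0" by (subst (asm) sum_nonneg_eq_0_iff) auto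
  then show "x = 0\<^sub>v n" using x by (intro eq_vecI) auto
qed simp

lemma scalar_prod_self_pos: "(x::real vec) \<in> carrier_vec n \<Longrightarrow> x \<noteq> 0\<^sub>v n \<Longrightarrow> 0 < x \<bullet> x"
  using scalar_prod_self_nonneg[of x] scalar_prod_self_eq_0[of x n] by linarith

lemma scalar_prod_comm: "(x::real vec) \<in> carrier_vec n \<Longrightarrow> y \<in> carrier_vec n \<Longrightarrow> x \<bullet> y = y \<bullet> x"
  by (rule comm_scalar_prod)

text \<open>The source of every dimension count in the proof. The determinant criterion for kernel
  vectors needs a square matrix, so the given rows are padded with zero rows; at least one such row
  exists, and the matching unit vector lies in the kernel of the transpose.\<close>

lemma exists_common_orthogonal:
  fixes vs :: "real vec list"
  assumes vs: "set vs \<subseteq> carrier_vec n" and len: "length vs < n"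
  shows "\<exists>z\<in>carrier_vec n. z \<noteq> 0\<^sub>v n \<and> (\<forall>v\<in>set vs. v \<bullet> z = 0)"
proof -
  define M where "M = mat_of_rows n (vs @ replicate (n - length vs) (0\<^sub>v n))"
  have M: "M \<in> carrier_mat n n" unfolding M_def using len by (auto simp: mat_of_rows_def)
  have "row M (n - 1) = 0\<^sub>v n"
    unfolding M_def using len vs by (subst mat_of_rows_row) (auto simp: nth_append)
  then have "M *\<^sub>v (0\<^sub>v n) = 0\<^sub>v n" using M by auto
  have "transpose_mat M *\<^sub>v unit_vec n (n - 1) = 0\<^sub>v n"
  proof (rule eq_vecI)
    fix i assume "i < dim_vec (0\<^sub>v n :: real vec)"
    then have i: "i < n" by simp
    have "(transpose_mat M *\<^sub>v unit_vec n (n - 1)) $ i = M $$ (n - 1, i)"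
      using M i len by simp
    also have "\<dots> = row M (n - 1) $ i" using M i len by simp
    also have "\<dots> = 0" using \<open>row M (n - 1) = 0\<^sub>v n\<close> i by simp
    finally show "(transpose_mat M *\<^sub>v unit_vec n (n - 1)) $ i = 0\<^sub>v n $ i" using i by simp
  qed (use M in auto)
  moreover have "unit_vec n (n - 1) \<noteq> (0\<^sub>v n :: real vec)" using len by auto
  ultimately have "det (transpose_mat M) = 0"
    using det_0_iff_vec_prod_zero_field[of "transpose_mat M" n] M by (meson transpose_carrier_mat unit_vec_carrier)
  then have "det M = 0" using det_transpose[OF M] by simp
  then obtain z where z: "z \<in> carrier_vec n" "z \<noteq> 0\<^sub>v n" "M *\<^sub>v z = 0\<^sub>v n"
    using det_0_iff_vec_prod_zero_field[OF M] by blast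
  have "v \<bullet> z = 0" if "v \<in> set vs" for v
  proof -
    obtain i where i: "i < length vs" "v = vs ! i" using \<open>v \<in> set vs\<close> by (metis in_set_conv_nth)
    have "(M *\<^sub>v z) $ i = row M i \<bullet> z" using M i len by simp
    also have "row M i = v"
      unfolding M_def using len vs i by (subst mat_of_rows_row) (auto simp: nth_append)
    finally show ?thesis using z i len by simp
  qed
  then show ?thesis using z by blast
qed

section \<open>Orthonormal frames and diagonalisation\<close>

definition orthonormal :: "nat \<Rightarrow> 'i set \<Rightarrow> ('i \<Rightarrow> real vec) \<Rightarrow> bool" where
  "orthonormal n I u \<longleftrightarrow> finite I \<and> (\<forall>i\<in>I. u i \<in> carrier_vec n) \<and>
     (\<forall>i\<in>I. \<forall>j\<in>I. u i \<bullet> u j = (if i = j then 1 else 0))"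

lemma orthonormalD:
  assumes "orthonormal n I u"
  shows "finite I" "i \<in> I \<Longrightarrow> u i \<in> carrier_vec n" "i \<in> I \<Longrightarrow> u i \<bullet> u i = 1"
    "i \<in> I \<Longrightarrow> j \<in> I \<Longrightarrow> u i \<bullet> u j = (if i = j then 1 else 0)"
  using assms unfolding orthonormal_def by auto

lemma orthonormal_subset: "orthonormal n I u \<Longrightarrow> J \<subseteq> I \<Longrightarrow> orthonormal n J u"
  unfolding orthonormal_def by (meson rev_finite_subset subsetD)

lemma orthonormal_extend_one:
  assumes u: "orthonormal n {..<k} u" and k: "k < n"
  shows "\<exists>v. orthonormal n {..<Suc k} (u(k := v))"
proof -
  have "\<exists>z\<in>carrier_vec n. z \<noteq> 0\<^sub>v n \<and> (\<forall>v\<in>set (map u [0..<k]). v \<bullet> z = 0)"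
    by (rule exists_common_orthogonal) (use u k in \<open>auto simp: orthonormal_def\<close>)
  then obtain z where z: "z \<in> carrier_vec n" "z \<noteq> 0\<^sub>v n" "\<And>i. i < k \<Longrightarrow> u i \<bullet> z = 0" by auto
  define v where "v = (1 / sqrt (z \<bullet> z)) \<cdot>\<^sub>v z"
  have zz: "z \<bullet> z > 0" using z scalar_prod_self_pos by blast
  have v: "v \<in> carrier_vec n" using z v_def by simp
  have "v \<bullet> v = 1" unfolding v_def using zz z by (simp add: field_simps)
  moreover have "u i \<bullet> v = 0" if "i < k" for i
    unfolding v_def using z that u by (simp add: orthonormal_def)
  moreover have "v \<bullet> u i = 0" if "i < k" for i
    using calculation(2)[OF that] v that u scalar_prod_comm by (metis lessThan_iff orthonormalD(2))
  ultimately have "orthonormal n {..<Suc k} (u(k := v))"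
    using u v unfolding orthonormal_def by (auto simp: less_Suc_eq)
  then show ?thesis ..
qed

lemma orthonormal_extend:
  assumes "orthonormal n {..<k} u" "k \<le> m" "m \<le> n"
  shows "\<exists>w. orthonormal n {..<m} w \<and> (\<forall>i<k. w i = u i)"
  using assms(2,3)
proof (induction m rule: dec_induct)
  case base
  then show ?case using assms(1) by blast
next
  case (step m)
  then obtain w where w: "orthonormal n {..<m} w" "\<forall>i<k. w i = u i" by auto
  obtain v where "orthonormal n {..<Suc m} (w(m := v))" using orthonormal_extend_one[OF w(1)] step by auto
  moreover have "\<forall>i<k. (w(m := v)) i = u i" using w step by auto
  ultimately show ?case by blast
qed

lemma orthonormal_mat:
  assumes u: "orthonormal n {..<n} u"
  defines "U \<equiv> mat n n (\<lambda>(j, i). u i $ j)"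
  shows "U \<in> carrier_mat n n" "\<And>i. i < n \<Longrightarrow> col U i = u i"
    "transpose_mat U * U = 1\<^sub>m n" "U * transpose_mat U = 1\<^sub>m n"
proof -
  show U: "U \<in> carrier_mat n n" by (simp add: U_def)
  show c: "col U i = u i" if "i < n" for i
    using orthonormalD(2)[OF u, of i] that by (intro eq_vecI) (auto simp: U_def)
  show 1: "transpose_mat U * U = 1\<^sub>m n"
    by (rule eq_matI) (use U c u in \<open>auto simp: orthonormal_def\<close>)
  show "U * transpose_mat U = 1\<^sub>m n"
    using mat_mult_left_right_inverse[OF _ U 1] U by simp
qed

text \<open>Over the complex numbers the spectrum is not empty. Symmetry makes the eigenvalue real,
  hence a root of the real characteristic polynomial, and this root yields a real eigenvector; the
  complex eigenvector is then discarded.\<close>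

lemma real_symmetric_eigenvalue:
  assumes A: "A \<in> sym_mats n" and n: "0 < n"
  shows "\<exists>e v. v \<in> carrier_vec n \<and> v \<bullet> v = 1 \<and> A *\<^sub>v v = e \<cdot>\<^sub>v v"
proof -
  define C where "C = map_mat complex_of_real A"
  have Ac: "A \<in> carrier_mat n n" using A by (rule sym_mats_carrier)
  then have C: "C \<in> carrier_mat n n" by (simp add: C_def)
  obtain l where "eigenvalue C l" using spectrum_non_empty[OF C n] by (auto simp: spectrum_def)
  then obtain v where v: "v \<in> carrier_vec n" "v \<noteq> 0\<^sub>v n" "C *\<^sub>v v = l \<cdot>\<^sub>v v"
    using C by (auto simp: eigenvalue_def eigenvector_def)
  define q where "q = (\<Sum>i<n. cnj (v $ i) * v $ i)"
  have q_real: "q = of_real (\<Sum>i<n. (cmod (v $ i))\<^sup>2)"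
    unfolding q_def of_real_sum by (intro sum.cong refl) (metis complex_norm_square mult.commute)
  have "q \<noteq> 0"
  proof
    assume "q = 0"
    then have "(\<Sum>i<n. (cmod (v $ i))\<^sup>2) = 0" using q_real of_real_eq_0_iff by metis
    then have "\<forall>i<n. v $ i = 0" by (subst (asm) sum_nonneg_eq_0_iff) auto
    then show False using v by auto
  qed
  have row: "(\<Sum>j<n. of_real (A $$ (i, j)) * v $ j) = l * v $ i" if "i < n" for i
  proof -
    have "(C *\<^sub>v v) $ i = (\<Sum>j<n. of_real (A $$ (i, j)) * v $ j)"
      using C Ac v(1) that by (simp add: C_def scalar_prod_def lessThan_atLeast0)
    then show ?thesis using v that by simp
  qed
  \<comment> \<open>The Hermitian form of \<open>C\<close> at \<open>v\<close> is evaluated through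
    each of its two arguments. As \<open>A\<close> is real and symmetric, the second evaluation
    produces the conjugate of \<open>l\<close>.\<close>
  have "l * q = (\<Sum>i<n. cnj (v $ i) * (\<Sum>j<n. of_real (A $$ (i, j)) * v $ j))"
    unfolding q_def sum_distrib_left[of l] by (intro sum.cong refl, subst row) auto
  also have "\<dots> = (\<Sum>i<n. \<Sum>j<n. of_real (A $$ (i, j)) * cnj (v $ i) * v $ j)"
    by (simp add: sum_distrib_left mult_ac)
  also have "\<dots> = (\<Sum>j<n. \<Sum>i<n. of_real (A $$ (j, i)) * cnj (v $ i) * v $ j)"
    by (subst sum.swap) (intro sum.cong refl, use sym_mats_index[OF A] in auto)
  also have "\<dots> = (\<Sum>j<n. v $ j * cnj (\<Sum>i<n. of_real (A $$ (j, i)) * v $ i))"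
    by (simp add: sum_distrib_left mult_ac)
  also have "\<dots> = cnj l * q"
    unfolding q_def sum_distrib_left[of "cnj l"] by (intro sum.cong refl, subst row) auto
  finally have "l = cnj l" using \<open>q \<noteq> 0\<close> by simp
  then obtain e where e: "l = of_real e" by (metis Reals_cases Reals_cnj_iff)
  have "poly (char_poly C) l = 0" using \<open>eigenvalue C l\<close> eigenvalue_root_char_poly[OF C] by simp
  then have "poly (map_poly of_real (char_poly A)) (of_real e :: complex) = 0"
    unfolding C_def e using of_real_hom.char_poly_hom[OF Ac] by metis
  then have "of_real (poly (char_poly A) e) = (0 :: complex)"
    using of_real_hom.poly_map_poly[of "char_poly A" e] by metis
  then have "poly (char_poly A) e = 0" using of_real_eq_0_iff by blast
  then have "eigenvalue A e" using eigenvalue_root_char_poly[OF Ac] by simp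
  then obtain w where w: "w \<in> carrier_vec n" "w \<noteq> 0\<^sub>v n" "A *\<^sub>v w = e \<cdot>\<^sub>v w"
    using Ac by (auto simp: eigenvalue_def eigenvector_def)
  define z where "z = (1 / sqrt (w \<bullet> w)) \<cdot>\<^sub>v w"
  have ww: "w \<bullet> w > 0" using w scalar_prod_self_pos by blast
  have "z \<in> carrier_vec n" using w z_def by simp
  moreover have "z \<bullet> z = 1" unfolding z_def using ww w by (simp add: field_simps)
  moreover have "A *\<^sub>v z = e \<cdot>\<^sub>v z"
    unfolding z_def using w Ac by (simp add: mult_mat_vec smult_smult_assoc mult.commute)
  ultimately show ?thesis by blast
qed

text \<open>Deflation: a unit eigenvector is completed to an orthonormal basis, and conjugation by
  this basis splits off a one by one block. The remaining block is again symmetric, so the induction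
  hypothesis diagonalises it.\<close>

lemma spectral_mat:
  assumes "A \<in> sym_mats n"
  shows "\<exists>U d. U \<in> carrier_mat n n \<and> transpose_mat U * U = 1\<^sub>m n \<and>
    transpose_mat U * A * U = mat n n (\<lambda>(i, j). if i = j then d i else (0::real))"
  using assms
proof (induction n arbitrary: A)
  case 0
  then show ?case by (intro exI[of _ "1\<^sub>m 0"]) (auto simp: sym_mats_def intro!: eq_matI)
next
  case (Suc n)
  obtain e v where v: "v \<in> carrier_vec (Suc n)" "v \<bullet> v = 1" "A *\<^sub>v v = e \<cdot>\<^sub>v v"
    using real_symmetric_eigenvalue[OF Suc.prems] by auto
  have "orthonormal (Suc n) {..<1::nat} (\<lambda>_. v)" using v by (auto simp: orthonormal_def)
  then obtain w where w: "orthonormal (Suc n) {..<Suc n} w" "w 0 = v"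
    using orthonormal_extend[of "Suc n" 1 "\<lambda>_. v" "Suc n"] by auto
  define W where "W = mat (Suc n) (Suc n) (\<lambda>(j, i). w i $ j)"
  note W = orthonormal_mat[OF w(1), folded W_def]
  have A: "A \<in> carrier_mat (Suc n) (Suc n)" using Suc.prems by (rule sym_mats_carrier)
  have At: "transpose_mat A = A" using Suc.prems by (simp add: sym_mats_def)
  define B where "B = transpose_mat W * A * W"
  have B: "B \<in> carrier_mat (Suc n) (Suc n)" unfolding B_def using W(1) A by auto
  have Bt: "transpose_mat B = B"
    unfolding B_def using W(1) A At
    by (subst transpose_mult[of _ "Suc n" "Suc n" _ "Suc n"]; (subst transpose_mult[of _ "Suc n" "Suc n" _ "Suc n"])?; auto)
  have Bsym: "B \<in> sym_mats (Suc n)" using B Bt by (simp add: sym_mats_def)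
  \<comment> \<open>Column 0 consists of the scalar products of the basis with
    \<open>A *\<^sub>v v\<close>, a multiple of the first basis vector; symmetry then clears row 0
    as well.\<close>
  have B0: "B $$ (i, 0) = (if i = 0 then e else 0)" if "i < Suc n" for i
  proof -
    have "B $$ (i, 0) = (transpose_mat W * (A * W)) $$ (i, 0)"
      unfolding B_def using W(1) A by (subst assoc_mult_mat[of _ "Suc n" "Suc n" _ "Suc n" _ "Suc n"]) auto
    also have "\<dots> = col W i \<bullet> col (A * W) 0" using W(1) A that by auto
    also have "col (A * W) 0 = A *\<^sub>v v" using W(1) W(2)[of 0] A w(2) by (subst col_mult2) auto
    also have "col W i \<bullet> (A *\<^sub>v v) = e * (w i \<bullet> w 0)"
      using W(2)[OF that] v w that by (auto simp: orthonormal_def)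
    finally show ?thesis using w(1) that by (auto simp: orthonormal_def)
  qed
  define B3 where "B3 = mat n n (\<lambda>(i, j). B $$ (Suc i, Suc j))"
  have "B3 \<in> sym_mats n"
    by (intro sym_matsI) (auto simp: B3_def intro: sym_mats_index[OF Bsym])
  then obtain U3 d3 where U3: "U3 \<in> carrier_mat n n" "transpose_mat U3 * U3 = 1\<^sub>m n"
    "transpose_mat U3 * B3 * U3 = mat n n (\<lambda>(i, j). if i = j then d3 i else (0::real))"
    using Suc.IH by blast
  have B3c: "B3 \<in> carrier_mat n n" by (simp add: B3_def)
  have Bblock: "B = four_block_mat (mat 1 1 (\<lambda>_. e)) (0\<^sub>m 1 n) (0\<^sub>m n 1) B3"
  proof (rule eq_matI)
    fix i j assume "i < dim_row (four_block_mat (mat 1 1 (\<lambda>_. e)) (0\<^sub>m 1 n) (0\<^sub>m n 1) B3)"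
      and "j < dim_col (four_block_mat (mat 1 1 (\<lambda>_. e)) (0\<^sub>m 1 n) (0\<^sub>m n 1) B3)"
    then have ij: "i < Suc n" "j < Suc n" using B3c by auto
    show "B $$ (i, j) = four_block_mat (mat 1 1 (\<lambda>_. e)) (0\<^sub>m 1 n) (0\<^sub>m n 1) B3 $$ (i, j)"
      using ij B0[of i] B0[of j] sym_mats_index[OF Bsym, of 0 j] B3c
      by (cases i; cases j) (auto simp: B3_def)
  qed (use B B3c in auto)
  define Q where "Q = four_block_mat (1\<^sub>m 1) (0\<^sub>m 1 n) (0\<^sub>m n 1) U3"
  have Q: "Q \<in> carrier_mat (Suc n) (Suc n)" unfolding Q_def using U3 by auto
  have Qt: "transpose_mat Q = four_block_mat (1\<^sub>m 1) (0\<^sub>m 1 n) (0\<^sub>m n 1) (transpose_mat U3)"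
    unfolding Q_def using U3 by (subst transpose_four_block_mat[of _ 1 1 _ n _ n]) auto
  have QQ: "transpose_mat Q * Q = 1\<^sub>m (Suc n)"
    unfolding Qt unfolding Q_def using U3
    by (subst mult_four_block_mat[of _ 1 1 _ n _ n _ _ 1 _ n]) auto
  have QB: "transpose_mat Q * B = four_block_mat (mat 1 1 (\<lambda>_. e)) (0\<^sub>m 1 n) (0\<^sub>m n 1) (transpose_mat U3 * B3)"
    unfolding Qt Bblock using U3 B3c
    by (subst mult_four_block_mat[of _ 1 1 _ n _ n _ _ 1 _ n]) auto
  define d where "d = case_nat e d3"
  have QBQ: "transpose_mat Q * B * Q = mat (Suc n) (Suc n) (\<lambda>(i, j). if i = j then d i else 0)"
    unfolding QB unfolding Q_def using U3 B3c
    apply (subst mult_four_block_mat[of _ 1 1 _ n _ n _ _ 1 _ n])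
    apply (auto intro!: eq_matI simp: d_def split: nat.split)
    done
  define U where "U = W * Q"
  have U: "U \<in> carrier_mat (Suc n) (Suc n)" unfolding U_def using W Q by auto
  have Ut: "transpose_mat U = transpose_mat Q * transpose_mat W"
    unfolding U_def using W Q by (intro transpose_mult) auto
  let ?N = "Suc n"
  have "transpose_mat U * U = transpose_mat Q * (transpose_mat W * (W * Q))"
    unfolding Ut unfolding U_def using W Q
    by (subst assoc_mult_mat[of _ ?N ?N _ ?N _ ?N]) auto
  also have "transpose_mat W * (W * Q) = transpose_mat W * W * Q"
    using W(1) Q by (subst assoc_mult_mat[of _ ?N ?N _ ?N _ ?N]) auto
  finally have UU: "transpose_mat U * U = 1\<^sub>m ?N" using W Q QQ by simp
  have "transpose_mat U * A * U = transpose_mat Q * (transpose_mat W * A * W) * Q"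
    unfolding Ut unfolding U_def using W(1) Q A
    by (simp add: assoc_mult_mat[of _ ?N ?N _ ?N _ ?N])
  then have "transpose_mat U * A * U = mat ?N ?N (\<lambda>(i, j). if i = j then d i else 0)"
    using QBQ B_def by simp
  then show ?case using U UU by blast
qed

text \<open>The weighted sum of the rank-one matrices given by \<open>u i\<close> times its
  transpose. Neither orthonormality nor completeness is built in, so one expression serves for
  eigendecompositions, for orthogonal projectors (weights 1 on part of a frame) and for single
  rank-one matrices.\<close>

definition spectral_sum :: "nat \<Rightarrow> 'i set \<Rightarrow> ('i \<Rightarrow> real vec) \<Rightarrow> ('i \<Rightarrow> real) \<Rightarrow> real mat" where
  "spectral_sum n I u d = mat n n (\<lambda>(j, k). \<Sum>i\<in>I. d i * u i $ j * u i $ k)"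

lemma spectral_sum_sym: "spectral_sum n I u d \<in> sym_mats n"
  by (rule sym_matsI) (auto simp: spectral_sum_def mult_ac)

lemmas spectral_sum_carrier = sym_mats_carrier[OF spectral_sum_sym]

lemma spectral_sum_dims [simp]: "dim_row (spectral_sum n I u d) = n" "dim_col (spectral_sum n I u d) = n"
  by (simp_all add: spectral_sum_def)

lemma mult_mat_vec_index:
  "A \<in> carrier_mat n n \<Longrightarrow> x \<in> carrier_vec n \<Longrightarrow> j < n \<Longrightarrow> (A *\<^sub>v x) $ j = (\<Sum>k<n. A $$ (j, k) * x $ k)"
  by (auto simp: scalar_prod_def lessThan_atLeast0 intro!: sum.cong)

lemma bilinear_sum:
  fixes A :: "real mat"
  assumes "A \<in> carrier_mat n n" "x \<in> carrier_vec n" "y \<in> carrier_vec n"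
  shows "y \<bullet> (A *\<^sub>v x) = (\<Sum>j<n. \<Sum>k<n. A $$ (j, k) * y $ j * x $ k)"
proof -
  have "A *\<^sub>v x \<in> carrier_vec n" using assms by simp
  then have "y \<bullet> (A *\<^sub>v x) = (\<Sum>j<n. y $ j * (A *\<^sub>v x) $ j)"
    using assms by (simp add: scalar_prod_sum)
  also have "\<dots> = (\<Sum>j<n. \<Sum>k<n. A $$ (j, k) * y $ j * x $ k)"
    using assms unfolding sum_distrib_left
    by (intro sum.cong refl, subst mult_mat_vec_index) (auto simp: sum_distrib_left mult_ac)
  finally show ?thesis .
qed

lemma sym_bilinear:
  assumes A: "A \<in> sym_mats n" and "x \<in> carrier_vec n" "y \<in> carrier_vec n"
  shows "y \<bullet> (A *\<^sub>v x) = x \<bullet> (A *\<^sub>v y)"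
proof -
  have "y \<bullet> (A *\<^sub>v x) = (\<Sum>j<n. \<Sum>k<n. A $$ (k, j) * y $ k * x $ j)"
    using assms sym_mats_carrier[OF A] by (subst bilinear_sum[of _ n]; simp) (rule sum.swap)
  also have "\<dots> = x \<bullet> (A *\<^sub>v y)"
    using assms sym_mats_carrier[OF A] sym_mats_index[OF A]
    by (subst bilinear_sum[of _ n]) (auto intro!: sum.cong)
  finally show ?thesis .
qed

lemma spectral_sum_mult_vec:
  assumes "\<And>i. i \<in> I \<Longrightarrow> u i \<in> carrier_vec n" "x \<in> carrier_vec n" "j < n"
  shows "(spectral_sum n I u d *\<^sub>v x) $ j = (\<Sum>i\<in>I. d i * (u i \<bullet> x) * u i $ j)"
proof -
  have "(spectral_sum n I u d *\<^sub>v x) $ j = (\<Sum>k<n. \<Sum>i\<in>I. d i * u i $ j * u i $ k * x $ k)"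
    using assms by (subst mult_mat_vec_index[OF spectral_sum_carrier]) (auto simp: spectral_sum_def sum_distrib_right)
  also have "\<dots> = (\<Sum>i\<in>I. \<Sum>k<n. d i * u i $ j * u i $ k * x $ k)" by (rule sum.swap)
  also have "\<dots> = (\<Sum>i\<in>I. d i * (u i \<bullet> x) * u i $ j)"
    using assms by (intro sum.cong refl) (auto simp: scalar_prod_sum[of _ n] sum_distrib_left sum_distrib_right mult_ac)
  finally show ?thesis .
qed

lemma spectral_sum_bilinear:
  assumes "\<And>i. i \<in> I \<Longrightarrow> u i \<in> carrier_vec n" "x \<in> carrier_vec n" "y \<in> carrier_vec n"
  shows "y \<bullet> (spectral_sum n I u d *\<^sub>v x) = (\<Sum>i\<in>I. d i * (u i \<bullet> y) * (u i \<bullet> x))"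
proof -
  have "y \<bullet> (spectral_sum n I u d *\<^sub>v x) = (\<Sum>j<n. \<Sum>i\<in>I. y $ j * (d i * (u i \<bullet> x) * u i $ j))"
    using assms spectral_sum_carrier[of n I u d]
    by (subst scalar_prod_sum[of _ n]) (auto simp: spectral_sum_mult_vec sum_distrib_left simp del: index_mult_mat_vec intro!: sum.cong)
  also have "\<dots> = (\<Sum>i\<in>I. \<Sum>j<n. y $ j * (d i * (u i \<bullet> x) * u i $ j))" by (rule sum.swap)
  also have "\<dots> = (\<Sum>i\<in>I. d i * (u i \<bullet> y) * (u i \<bullet> x))"
    using assms by (intro sum.cong refl) (auto simp: scalar_prod_sum[of _ n] sum_distrib_left sum_distrib_right mult_ac)
  finally show ?thesis .
qed

lemma spectral_sum_quad:
  assumes "\<And>i. i \<in> I \<Longrightarrow> u i \<in> carrier_vec n" "x \<in> carrier_vec n"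
  shows "x \<bullet> (spectral_sum n I u d *\<^sub>v x) = (\<Sum>i\<in>I. d i * (u i \<bullet> x)\<^sup>2)"
  using spectral_sum_bilinear[OF assms(1) assms(2) assms(2)] by (simp add: power2_eq_square mult.assoc)

lemma psd_spectral_sum:
  assumes "\<And>i. i \<in> I \<Longrightarrow> u i \<in> carrier_vec n" "\<And>i. i \<in> I \<Longrightarrow> 0 \<le> d i"
  shows "psd n (spectral_sum n I u d)"
  unfolding psd_def using assms by (auto simp: spectral_sum_sym spectral_sum_quad intro!: sum_nonneg)

lemma trace_spectral_sum:
  assumes "\<And>i. i \<in> I \<Longrightarrow> u i \<in> carrier_vec n"
  shows "mat_trace (spectral_sum n I u d) = (\<Sum>i\<in>I. d i * (u i \<bullet> u i))"
proof -
  have "mat_trace (spectral_sum n I u d) = (\<Sum>j<n. \<Sum>i\<in>I. d i * u i $ j * u i $ j)"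
    by (simp add: mat_trace_def spectral_sum_def)
  also have "\<dots> = (\<Sum>i\<in>I. \<Sum>j<n. d i * u i $ j * u i $ j)" by (rule sum.swap)
  also have "\<dots> = (\<Sum>i\<in>I. d i * (u i \<bullet> u i))"
    using assms by (intro sum.cong refl) (auto simp: scalar_prod_sum[of _ n] sum_distrib_left mult_ac)
  finally show ?thesis .
qed

lemma trace_spectral_sum_orthonormal: "orthonormal n I u \<Longrightarrow> mat_trace (spectral_sum n I u d) = sum d I"
  by (subst trace_spectral_sum) (auto simp: orthonormal_def)

lemma frob_inner_sum: "A \<in> carrier_mat n n \<Longrightarrow> frob_inner A B = (\<Sum>i<n. \<Sum>j<n. A $$ (i, j) * B $$ (i, j))"
  by (auto simp: frob_inner_def)

lemma frob_inner_spectral_sum: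
  assumes "\<And>i. i \<in> I \<Longrightarrow> u i \<in> carrier_vec n" "A \<in> carrier_mat n n"
  shows "frob_inner A (spectral_sum n I u d) = (\<Sum>i\<in>I. d i * (u i \<bullet> (A *\<^sub>v u i)))"
proof -
  have "frob_inner A (spectral_sum n I u d) = (\<Sum>j<n. \<Sum>k<n. \<Sum>i\<in>I. A $$ (j, k) * (d i * u i $ j * u i $ k))"
    using assms by (simp add: frob_inner_sum[of _ n] spectral_sum_def sum_distrib_left)
  also have "\<dots> = (\<Sum>j<n. \<Sum>i\<in>I. \<Sum>k<n. A $$ (j, k) * (d i * u i $ j * u i $ k))"
    by (intro sum.cong refl) (rule sum.swap)
  also have "\<dots> = (\<Sum>i\<in>I. \<Sum>j<n. \<Sum>k<n. A $$ (j, k) * (d i * u i $ j * u i $ k))" by (rule sum.swap)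
  also have "\<dots> = (\<Sum>i\<in>I. d i * (u i \<bullet> (A *\<^sub>v u i)))"
    using assms by (intro sum.cong refl) (auto simp: bilinear_sum[of _ n] sum_distrib_left mult_ac)
  finally show ?thesis .
qed

lemma frob_inner_comm: "A \<in> carrier_mat n n \<Longrightarrow> B \<in> carrier_mat n n \<Longrightarrow> frob_inner A B = frob_inner B A"
  by (simp add: frob_inner_sum[of _ n] mult.commute)

text \<open>A square matrix with orthonormal columns has orthonormal rows, because a left inverse of
  a square matrix is also a right inverse.\<close>

lemma orthonormal_complete:
  assumes u: "orthonormal n {..<n} u" and "j < n" "k < n"
  shows "(\<Sum>i<n. u i $ j * u i $ k) = (if j = k then 1 else (0::real))"
proof -
  define U where "U = mat n n (\<lambda>(j, i). u i $ j)"
  note U = orthonormal_mat[OF u, folded U_def]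
  have "(U * transpose_mat U) $$ (j, k) = (\<Sum>i<n. u i $ j * u i $ k)"
    using assms U(1) by (simp add: scalar_prod_def U_def lessThan_atLeast0)
  then show ?thesis using U(4) assms by simp
qed

lemma spectral_sum_one: "orthonormal n {..<n} u \<Longrightarrow> spectral_sum n {..<n} u (\<lambda>_. 1) = 1\<^sub>m n"
  by (rule eq_matI) (auto simp: spectral_sum_def orthonormal_complete)

lemma parseval_inner:
  assumes u: "orthonormal n {..<n} u" and x: "x \<in> carrier_vec n" and y: "y \<in> carrier_vec n"
  shows "(\<Sum>i<n. (u i \<bullet> x) * (u i \<bullet> y)) = x \<bullet> y"
  using spectral_sum_bilinear[of "{..<n}" u n y x "\<lambda>_. 1"] assms orthonormalD(2)[OF u]
  by (simp add: spectral_sum_one)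

lemma parseval:
  assumes u: "orthonormal n {..<n} u" and x: "x \<in> carrier_vec n"
  shows "(\<Sum>i<n. (u i \<bullet> x)\<^sup>2) = x \<bullet> x"
  using parseval_inner[OF u x x] by (simp add: power2_eq_square)

lemma spectral_sum_eigvec:
  assumes u: "orthonormal n I u" and i: "i \<in> I"
  shows "spectral_sum n I u d *\<^sub>v u i = d i \<cdot>\<^sub>v u i"
proof (rule eq_vecI)
  fix j assume "j < dim_vec (d i \<cdot>\<^sub>v u i)"
  then have j: "j < n" using orthonormalD(2)[OF u i] by simp
  have "(spectral_sum n I u d *\<^sub>v u i) $ j = (\<Sum>k\<in>I. d k * (u k \<bullet> u i) * u k $ j)"
    using j orthonormalD(2)[OF u] i by (intro spectral_sum_mult_vec) auto
  also have "\<dots> = (\<Sum>k\<in>I. if k = i then d i * u i $ j else 0)"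
    using orthonormalD(4)[OF u] i by (intro sum.cong refl) auto
  also have "\<dots> = d i * u i $ j" using i orthonormalD(1)[OF u] by simp
  finally show "(spectral_sum n I u d *\<^sub>v u i) $ j = (d i \<cdot>\<^sub>v u i) $ j" using j orthonormalD(2)[OF u i] by simp
qed (use orthonormalD(2)[OF u i] in simp)

lemma bessel_inequality:
  assumes u: "orthonormal n I u" and x: "x \<in> carrier_vec n"
  shows "(\<Sum>i\<in>I. (u i \<bullet> x)\<^sup>2) \<le> x \<bullet> x"
proof -
  \<comment> \<open>\<open>y\<close> is the orthogonal projection of \<open>x\<close> onto the span
    of the frame; the inequality says that the residual \<open>x - y\<close> has nonnegative squared
    length.\<close>
  define y where "y = spectral_sum n I u (\<lambda>_. 1) *\<^sub>v x"
  have y: "y \<in> carrier_vec n" using spectral_sum_carrier x unfolding y_def by (metis mult_mat_vec_carrier)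
  have uy: "u i \<bullet> y = u i \<bullet> x" if "i \<in> I" for i
  proof -
    have "u i \<bullet> y = (\<Sum>k\<in>I. 1 * (u k \<bullet> u i) * (u k \<bullet> x))" unfolding y_def
      using orthonormalD(2)[OF u] that x by (intro spectral_sum_bilinear) auto
    also have "\<dots> = (\<Sum>k\<in>I. if k = i then u i \<bullet> x else 0)"
      using orthonormalD(4)[OF u] that by (intro sum.cong refl) auto
    finally show ?thesis using that orthonormalD(1)[OF u] by simp
  qed
  have xy: "x \<bullet> y = (\<Sum>i\<in>I. (u i \<bullet> x)\<^sup>2)" unfolding y_def
    using orthonormalD[OF u] x by (subst spectral_sum_quad) auto
  have "y \<bullet> y = (\<Sum>i\<in>I. 1 * (u i \<bullet> y) * (u i \<bullet> x))"
    using orthonormalD[OF u] x y spectral_sum_bilinear[of I u n x y "\<lambda>_. 1"] unfolding y_def by simp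
  also have "\<dots> = (\<Sum>i\<in>I. (u i \<bullet> x)\<^sup>2)" using uy by (simp add: power2_eq_square)
  finally have yy: "y \<bullet> y = (\<Sum>i\<in>I. (u i \<bullet> x)\<^sup>2)" .
  have "0 \<le> (x - y) \<bullet> (x - y)" by (rule scalar_prod_self_nonneg)
  also have "(x - y) \<bullet> (x - y) = x \<bullet> x - x \<bullet> y - (y \<bullet> x - y \<bullet> y)"
    using x y by (simp add: minus_scalar_prod_distrib[of _ n] scalar_prod_minus_distrib[of _ n])
  also have "y \<bullet> x = x \<bullet> y" using x y by (rule scalar_prod_comm[rotated])
  finally show ?thesis using xy yy by simp
qed

text \<open>An orthogonal conjugate of a diagonal matrix is the form from which similarity, and with
  it the characteristic polynomial, can be read off.\<close>

lemma spectral_sum_conj_mat: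
  assumes u: "orthonormal n {..<n} u"
  defines "U \<equiv> mat n n (\<lambda>(j, i). u i $ j)"
  shows "spectral_sum n {..<n} u d = U * mat n n (\<lambda>(i, j). if i = j then d i else 0) * transpose_mat U"
proof (rule eq_matI)
  let ?D = "mat n n (\<lambda>(i, j). if i = j then d i else (0::real))"
  have U: "U \<in> carrier_mat n n" by (simp add: U_def)
  show "dim_row (spectral_sum n {..<n} u d) = dim_row (U * ?D * transpose_mat U)"
    "dim_col (spectral_sum n {..<n} u d) = dim_col (U * ?D * transpose_mat U)" using U by auto
  fix j k assume "j < dim_row (U * ?D * transpose_mat U)" "k < dim_col (U * ?D * transpose_mat U)"
  then have jk: "j < n" "k < n" using U by auto
  have UD: "(U * ?D) $$ (j, i) = U $$ (j, i) * d i" if "i < n" for i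
  proof -
    have "(U * ?D) $$ (j, i) = (\<Sum>l<n. U $$ (j, l) * ?D $$ (l, i))"
      using jk U that by (simp add: scalar_prod_def lessThan_atLeast0)
    also have "\<dots> = (\<Sum>l<n. if l = i then U $$ (j, i) * d i else 0)"
      using that by (intro sum.cong) auto
    finally show ?thesis using that by simp
  qed
  have "(U * ?D * transpose_mat U) $$ (j, k) = (\<Sum>i<n. (U * ?D) $$ (j, i) * U $$ (k, i))"
    using jk U by (simp add: scalar_prod_def lessThan_atLeast0)
  also have "\<dots> = (\<Sum>i<n. d i * u i $ j * u i $ k)"
    using jk U by (intro sum.cong refl) (subst UD, auto simp: U_def)
  finally show "spectral_sum n {..<n} u d $$ (j, k) = (U * ?D * transpose_mat U) $$ (j, k)"
    using jk by (simp add: spectral_sum_def)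
qed

lemma spectral_decomposition:
  assumes A: "A \<in> sym_mats n"
  shows "\<exists>u d. orthonormal n {..<n} u \<and> A = spectral_sum n {..<n} u d"
proof -
  obtain U d where U: "U \<in> carrier_mat n n" "transpose_mat U * U = 1\<^sub>m n"
    and D: "transpose_mat U * A * U = mat n n (\<lambda>(i, j). if i = j then d i else (0::real))"
    using spectral_mat[OF A] by blast
  define u where "u = col U"
  have Ac: "A \<in> carrier_mat n n" using A by (rule sym_mats_carrier)
  have "u i \<bullet> u j = (if i = j then 1 else 0)" if "i < n" "j < n" for i j
  proof -
    have "(transpose_mat U * U) $$ (i, j) = u i \<bullet> u j" using that U(1) by (simp add: u_def)
    then show ?thesis using U(2) that by simp
  qed
  then have u: "orthonormal n {..<n} u" using U(1) by (auto simp: orthonormal_def u_def)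
  have UU: "U * transpose_mat U = 1\<^sub>m n"
    using mat_mult_left_right_inverse[OF _ U(1) U(2)] U(1) by simp
  define D where "D = mat n n (\<lambda>(i, j). if i = j then d i else (0::real))"
  have Dc: "D \<in> carrier_mat n n" by (simp add: D_def)
  have "U * (transpose_mat U * A * U) * transpose_mat U = (U * transpose_mat U) * A * (U * transpose_mat U)"
    using U(1) Ac by (simp add: assoc_mult_mat[of _ n n _ n _ n])
  then have AD: "A = U * D * transpose_mat U" using D Ac by (simp add: UU D_def)
  have "mat n n (\<lambda>(j, i). u i $ j) = U" using U(1) by (intro eq_matI) (auto simp: u_def)
  then have "A = spectral_sum n {..<n} u d"
    using AD spectral_sum_conj_mat[OF u, of d] by (simp add: D_def)
  then show ?thesis using u by blast
qed

section \<open>Characteristic polynomial, ordered eigenvalues and rank\<close>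

lemma proots_char_poly_spectral_sum:
  assumes u: "orthonormal n {..<n} u"
  shows "proots (char_poly (spectral_sum n {..<n} u d)) = mset (map d [0..<n])"
proof -
  define U where "U = mat n n (\<lambda>(j, i). u i $ j)"
  note U = orthonormal_mat[OF u, folded U_def]
  let ?D = "mat n n (\<lambda>(i, j). if i = j then d i else (0::real))"
  have "similar_mat_wit (spectral_sum n {..<n} u d) ?D U (transpose_mat U)"
    by (rule similar_mat_witI[of _ _ n]) (use U spectral_sum_carrier in \<open>auto simp: spectral_sum_conj_mat[OF u, folded U_def]\<close>)
  then have "char_poly (spectral_sum n {..<n} u d) = char_poly ?D"
    by (intro char_poly_similar) (auto simp: similar_mat_def)
  also have "\<dots> = (\<Prod>a\<leftarrow>diag_mat ?D. [:- a, 1:])"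
    by (rule char_poly_upper_triangular[of _ n]) (auto simp: upper_triangular_def)
  also have "diag_mat ?D = map d [0..<n]"
    by (auto simp: diag_mat_def)
  finally have "char_poly (spectral_sum n {..<n} u d) = prod_list (map (\<lambda>a. [:- a, 1:]) (map d [0..<n]))" .
  moreover have "proots (prod_list (map (\<lambda>a. [:- a, 1:]) xs)) = mset xs" for xs :: "real list"
  proof (induction xs)
    case (Cons a xs)
    have "prod_list (map (\<lambda>a. [:- a, 1:]) xs) \<noteq> 0" by (auto simp: prod_list_zero_iff)
    then have "proots ([:- a, 1:] * prod_list (map (\<lambda>a. [:- a, 1:]) xs)) = {#a#} + mset xs"
      using Cons by (subst proots_mult) auto
    then show ?case by (simp del: mult_pCons_left)
  qed simp
  ultimately show ?thesis by (simp only:)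
qed

text \<open>The sorted list of eigenvalues is accessed only through counting, so the eigenframe
  never has to be reordered. In the decreasing list, entries below the k-th one lie strictly after
  position \<open>k - 1\<close> and entries above it strictly before; these counts depend only on
  the multiset.\<close>

lemma lambda_desc_spectral_sum:
  fixes d :: "nat \<Rightarrow> real"
  assumes u: "orthonormal n {..<n} u" and k: "1 \<le> k" "k \<le> n"
  defines "l \<equiv> lambda_desc k (spectral_sum n {..<n} u d)"
  shows "card {i\<in>{..<n}. d i < l} \<le> n - k" "card {i\<in>{..<n}. l < d i} < k"
proof -
  define ys where "ys = rev (sort (map d [0..<n]))"
  have len: "length ys = n" by (simp add: ys_def)
  have l: "l = ys ! (k - 1)"
    unfolding l_def lambda_desc_def proots_char_poly_spectral_sum[OF u] ys_def
    by (simp only: sorted_list_of_multiset_mset)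
  have anti: "ys ! j \<le> ys ! i" if "i \<le> j" "j < n" for i j
    using that unfolding ys_def by (auto simp: rev_nth intro!: sorted_nth_mono)
  have count: "card {i\<in>{..<n}. P (d i)} = card {i\<in>{..<n}. P (ys ! i)}" for P
  proof -
    have "length (filter P (map d [0..<n])) = length (filter P ys)"
      unfolding ys_def by (metis mset_filter mset_rev mset_sort size_mset)
    then have "card {i. i < n \<and> P (map d [0..<n] ! i)} = card {i. i < n \<and> P (ys ! i)}"
      by (simp add: length_filter_conv_card len)
    moreover have "{i. i < n \<and> P (map d [0..<n] ! i)} = {i\<in>{..<n}. P (d i)}" by auto
    ultimately show ?thesis by (simp add: lessThan_def)
  qed
  have "{i\<in>{..<n}. ys ! i < l} \<subseteq> {k..<n}"
  proof
    fix i assume i: "i \<in> {i\<in>{..<n}. ys ! i < l}"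
    then have "\<not> i \<le> k - 1" using anti[of i "k - 1"] k unfolding l by force
    then show "i \<in> {k..<n}" using i k by auto
  qed
  then have "card {i\<in>{..<n}. ys ! i < l} \<le> card {k..<n}" by (intro card_mono) auto
  then show "card {i\<in>{..<n}. d i < l} \<le> n - k" using count[of "\<lambda>x. x < l"] by simp
  have "{i\<in>{..<n}. l < ys ! i} \<subseteq> {..<k - 1}"
  proof
    fix i assume i: "i \<in> {i\<in>{..<n}. l < ys ! i}"
    then have "\<not> k - 1 \<le> i" using anti[of "k - 1" i] k unfolding l by auto
    then show "i \<in> {..<k - 1}" by auto
  qed
  then have "card {i\<in>{..<n}. l < ys ! i} \<le> card {..<k - 1}" by (intro card_mono) auto
  then show "card {i\<in>{..<n}. l < d i} < k" using count[of "\<lambda>x. l < x"] k by simp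
qed

text \<open>The vectors orthogonal to the frame outside \<open>J\<close> form a space of dimension
  \<open>card J\<close>, and fewer than \<open>card J\<close> further linear conditions leave a
  nonzero vector in it. Most rank comparisons take their test vector from here.\<close>

lemma exists_orthogonal_to_frame_part:
  assumes u: "orthonormal n {..<n} u" and J: "J \<subseteq> {..<n}"
    and vs: "set vs \<subseteq> carrier_vec n" and len: "length vs < card J"
  shows "\<exists>z\<in>carrier_vec n. z \<noteq> 0\<^sub>v n \<and> (\<forall>v\<in>set vs. v \<bullet> z = 0) \<and> (\<forall>i\<in>{..<n} - J. u i \<bullet> z = 0)"
proof -
  define ws where "ws = map u (sorted_list_of_set ({..<n} - J))"
  have "card J \<le> n" using card_mono[OF _ J] by simp
  then have "length (vs @ ws) < n"
    using len J by (simp add: ws_def card_Diff_subset finite_subset)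
  moreover have "set (vs @ ws) \<subseteq> carrier_vec n"
    using vs orthonormalD(2)[OF u] by (auto simp: ws_def)
  ultimately obtain z where "z \<in> carrier_vec n" "z \<noteq> 0\<^sub>v n" "\<forall>v\<in>set (vs @ ws). v \<bullet> z = 0"
    using exists_common_orthogonal by blast
  moreover have "set ws = u ` ({..<n} - J)" by (simp add: ws_def)
  ultimately show ?thesis by auto
qed

lemma zero_of_orthogonal_to_basis:
  assumes u: "orthonormal n {..<n} u" and z: "z \<in> carrier_vec n" and "\<And>i. i < n \<Longrightarrow> u i \<bullet> z = 0"
  shows "z = 0\<^sub>v n"
  using parseval[OF u z] assms scalar_prod_self_eq_0[OF z] by simp

text \<open>The rank is the size \<open>card M\<close> of a maximal independent set of columns. Both
  inequalities are dimension counts: more independent columns than nonzero weights admit a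
  nontrivial vanishing combination, while more nonzero weights than independent columns give a
  nonzero vector in the span of their eigenvectors that is orthogonal to all columns, hence in the
  kernel.\<close>

lemma rank_spectral_sum:
  assumes u: "orthonormal n {..<n} u"
  shows "vec_space.rank n (spectral_sum n {..<n} u d) = card {i\<in>{..<n}. d i \<noteq> 0}"
proof -
  interpret V: vec_space "TYPE(real)" n .
  define A where "A = spectral_sum n {..<n} u d"
  define J where "J = {i\<in>{..<n}. d i \<noteq> 0}"
  have A: "A \<in> sym_mats n" and Ac: "A \<in> carrier_mat n n"
    unfolding A_def by (rule spectral_sum_sym, rule spectral_sum_carrier)
  have uc: "u i \<in> carrier_vec n" if "i < n" for i using orthonormalD(2)[OF u] that by simp
  have Au: "A *\<^sub>v u i = d i \<cdot>\<^sub>v u i" if "i < n" for i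
    unfolding A_def using spectral_sum_eigvec[OF u] that by simp
  obtain M where M: "maximal M (\<lambda>T. T \<subseteq> set (cols A) \<and> V.lin_indpt T)"
    using maximal_exists_superset[of "set (cols A)" "\<lambda>T. T \<subseteq> set (cols A) \<and> V.lin_indpt T" "{}"]
    by (auto simp: V.finite_lin_indpt2)
  have rk: "V.rank A = card M" by (rule V.rank_card_indpt[OF Ac M])
  have Msub: "M \<subseteq> set (cols A)" and Mli: "V.lin_indpt M" using M by (auto simp: maximal_def)
  have colsc: "set (cols A) \<subseteq> carrier_vec n" using Ac by (auto simp: cols_def)
  have Mfin: "finite M" using Msub finite_subset by blast
  have Mc: "M \<subseteq> carrier_vec n" using Msub colsc by blast
  obtain ms where ms: "set ms = M" "distinct ms" using finite_distinct_list[OF Mfin] by blast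
  have lms: "length ms = card M" using ms distinct_card by force
  have "card M \<le> card J"
  proof (rule ccontr)
    assume "\<not> card M \<le> card J"
    define C where "C = mat_of_cols n ms"
    have C: "C \<in> carrier_mat n (card M)" unfolding C_def using lms by auto
    have cC: "cols C = ms" unfolding C_def using ms Mc by (simp add: cols_mat_of_cols)
    \<comment> \<open>These conditions on the coefficient vector \<open>z\<close> make
      \<open>C *\<^sub>v z\<close> orthogonal to the eigenvectors of nonzero weight. Orthogonality
      to the others is automatic: the columns come from the symmetric matrix \<open>A\<close>, which
      kills those eigenvectors.\<close>
    define vs where "vs = map (\<lambda>i. transpose_mat C *\<^sub>v u i) (sorted_list_of_set J)"
    have "\<exists>z\<in>carrier_vec (card M). z \<noteq> 0\<^sub>v (card M) \<and> (\<forall>v\<in>set vs. v \<bullet> z = 0)"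
      by (rule exists_common_orthogonal) (use \<open>\<not> card M \<le> card J\<close> C uc in \<open>auto simp: vs_def J_def\<close>)
    then obtain z where z: "z \<in> carrier_vec (card M)" "z \<noteq> 0\<^sub>v (card M)"
      and zo: "\<And>i. i \<in> J \<Longrightarrow> (transpose_mat C *\<^sub>v u i) \<bullet> z = 0" by (auto simp: vs_def J_def)
    have "C *\<^sub>v z = 0\<^sub>v n"
    proof (rule zero_of_orthogonal_to_basis[OF u])
      show Cz: "C *\<^sub>v z \<in> carrier_vec n" using C z by simp
      fix i assume i: "i < n"
      have eq: "u i \<bullet> (C *\<^sub>v z) = (transpose_mat C *\<^sub>v u i) \<bullet> z"
        using transpose_vec_mult_scalar[OF C z(1) uc[OF i]] by simp
      show "u i \<bullet> (C *\<^sub>v z) = 0"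
      proof (cases "i \<in> J")
        case True
        then show ?thesis using zo eq by simp
      next
        case False
        then have "d i = 0" using i by (simp add: J_def)
        have "transpose_mat C *\<^sub>v u i = 0\<^sub>v (card M)"
        proof (rule eq_vecI)
          fix j assume "j < dim_vec (0\<^sub>v (card M) :: real vec)"
          then have j: "j < card M" by simp
          have "ms ! j \<in> set (cols A)" using j lms ms Msub nth_mem by force
          then obtain k where k: "k < n" "ms ! j = col A k" using Ac by (auto simp: cols_def)
          have "(transpose_mat C *\<^sub>v u i) $ j = col C j \<bullet> u i" using C j uc[OF i] by simp
          also have "col C j = col A k" using cC C j k by (metis carrier_matD(2) cols_nth)
          also have "col A k \<bullet> u i = (A *\<^sub>v u i) $ k"
            using Ac k i uc[OF i] sym_mats_index[OF A]
            by (auto simp: scalar_prod_def intro!: sum.cong)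
          also have "\<dots> = 0" using Au[OF i] \<open>d i = 0\<close> uc[OF i] k by simp
          finally show "(transpose_mat C *\<^sub>v u i) $ j = 0\<^sub>v (card M) $ j" using k j by simp
        qed (use C in simp)
        then show ?thesis using eq z by simp
      qed
    qed
    then have "V.lin_dep (set (cols C))"
      by (intro V.lin_depI[OF C z]) (use cC ms in auto)
    then show False using Mli cC ms by simp
  qed
  moreover have "card J \<le> card M"
  proof (rule ccontr)
    assume "\<not> card J \<le> card M"
    then have "\<exists>z\<in>carrier_vec n. z \<noteq> 0\<^sub>v n \<and> (\<forall>v\<in>set ms. v \<bullet> z = 0) \<and> (\<forall>i\<in>{..<n} - J. u i \<bullet> z = 0)"
      using ms(1) Mc lms by (intro exists_orthogonal_to_frame_part[OF u]) (auto simp: J_def)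
    then obtain z where z: "z \<in> carrier_vec n" "z \<noteq> 0\<^sub>v n" "\<And>v. v \<in> M \<Longrightarrow> v \<bullet> z = 0"
      and zo: "\<And>i. i \<in> {..<n} - J \<Longrightarrow> u i \<bullet> z = 0"
      using ms(1) by blast
    \<comment> \<open>Maximality of \<open>M\<close> makes every column a combination of
      \<open>M\<close>, so orthogonality to \<open>M\<close> passes to all columns.\<close>
    have colz: "c \<bullet> z = 0" if c: "c \<in> set (cols A)" for c
    proof -
      have "c \<in> V.span M"
      proof (rule ccontr)
        assume nc: "c \<notin> V.span M"
        have cc: "c \<in> carrier_vec n" using c colsc by blast
        have "c \<notin> M" using nc V.span_mem[of M c] Mc by auto
        have "V.lin_indpt (M \<union> {c})"
          using V.lin_dep_iff_in_span[of M c] Mc Mli cc \<open>c \<notin> M\<close> nc by auto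
        then have "M \<union> {c} = M" using M c Msub by (auto simp: maximal_def)
        then show False using \<open>c \<notin> M\<close> by blast
      qed
      then obtain a where a: "c = V.lincomb a M" using V.finite_in_span[OF Mfin] Mc by blast
      have "c \<bullet> z = (\<Sum>i<n. (\<Sum>x\<in>M. a x * x $ i) * z $ i)"
        using z(1) colsc c Mc by (subst scalar_prod_sum[of _ n]) (auto simp: a V.lincomb_index)
      also have "\<dots> = (\<Sum>x\<in>M. \<Sum>i<n. a x * (x $ i * z $ i))"
        unfolding sum_distrib_right by (subst sum.swap) (simp add: mult.assoc)
      also have "\<dots> = (\<Sum>x\<in>M. a x * (x \<bullet> z))"
        using Mc z(1) by (intro sum.cong refl) (subst scalar_prod_sum[of _ n], auto simp: sum_distrib_left)
      finally show ?thesis using z(3) by simp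
    qed
    have Az: "A *\<^sub>v z = 0\<^sub>v n"
    proof (rule eq_vecI)
      fix k assume "k < dim_vec (0\<^sub>v n :: real vec)"
      then have k: "k < n" by simp
      have "(A *\<^sub>v z) $ k = col A k \<bullet> z"
        using Ac k z sym_mats_index[OF A] by (auto simp: scalar_prod_def intro!: sum.cong)
      also have "\<dots> = 0" using k Ac by (intro colz) (auto simp: cols_def)
      finally show "(A *\<^sub>v z) $ k = 0\<^sub>v n $ k" using k by simp
    qed (use Ac in simp)
    have "z = 0\<^sub>v n"
    proof (rule zero_of_orthogonal_to_basis[OF u z(1)])
      fix i assume i: "i < n"
      have "z \<bullet> (A *\<^sub>v u i) = u i \<bullet> (A *\<^sub>v z)" using sym_bilinear[OF A uc[OF i] z(1)] .
      then have "d i * (z \<bullet> u i) = 0" using Au[OF i] Az uc[OF i] z(1) by simp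
      then show "u i \<bullet> z = 0"
        using zo[of i] i scalar_prod_comm[OF z(1) uc[OF i]] by (auto simp: J_def)
    qed
    then show False using z by simp
  qed
  ultimately show ?thesis using rk unfolding A_def J_def by simp
qed

section \<open>The Frobenius geometry and the projection onto the spectrahedron\<close>

declare minus_carrier_mat [simp]

text \<open>Through the \<open>L2_set\<close> form the Cauchy-Schwarz and triangle inequalities for
  finite families carry over to matrices.\<close>

lemma frob_norm_L2: "A \<in> carrier_mat n n \<Longrightarrow> frob_norm A = L2_set (\<lambda>ij. A $$ ij) ({..<n} \<times> {..<n})"
  by (simp add: frob_norm_def frob_inner_sum[of _ n] L2_set_def sum.cartesian_product power2_eq_square case_prod_unfold)

lemma frob_norm_nonneg [simp]: "0 \<le> frob_norm A"
  by (auto simp: frob_norm_def frob_inner_def intro!: sum_nonneg)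

lemma frob_norm_square: "(frob_norm A)\<^sup>2 = frob_inner A A"
  by (auto simp: frob_norm_def frob_inner_def intro!: real_sqrt_pow2 sum_nonneg)

lemma frob_inner_diff_left:
  "A \<in> carrier_mat n n \<Longrightarrow> B \<in> carrier_mat n n \<Longrightarrow> C \<in> carrier_mat n n \<Longrightarrow>
   frob_inner (A - B) C = frob_inner A C - frob_inner B C"
  by (simp add: frob_inner_def algebra_simps sum_subtractf)

lemma frob_inner_diff_right:
  "A \<in> carrier_mat n n \<Longrightarrow> B \<in> carrier_mat n n \<Longrightarrow> C \<in> carrier_mat n n \<Longrightarrow>
   frob_inner C (A - B) = frob_inner C A - frob_inner C B"
  by (simp add: frob_inner_def algebra_simps sum_subtractf)

lemma frob_inner_smult_left:
  "A \<in> carrier_mat n n \<Longrightarrow> frob_inner (c \<cdot>\<^sub>m A) B = c * frob_inner A B"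
  by (simp add: frob_inner_def sum_distrib_left mult.assoc)

lemma frob_inner_smult_right:
  "A \<in> carrier_mat n n \<Longrightarrow> B \<in> carrier_mat n n \<Longrightarrow> frob_inner A (c \<cdot>\<^sub>m B) = c * frob_inner A B"
  by (simp add: frob_inner_def sum_distrib_left mult_ac)

lemma frob_norm_smult: "A \<in> carrier_mat n n \<Longrightarrow> frob_norm (c \<cdot>\<^sub>m A) = \<bar>c\<bar> * frob_norm A"
  by (simp add: frob_norm_def frob_inner_smult_left[of _ n] frob_inner_smult_right[of _ n] real_sqrt_mult flip: mult.assoc power2_eq_square)

lemma frob_norm_diff_square:
  "A \<in> carrier_mat n n \<Longrightarrow> B \<in> carrier_mat n n \<Longrightarrow>
   (frob_norm (A - B))\<^sup>2 = (frob_norm A)\<^sup>2 - 2 * frob_inner A B + (frob_norm B)\<^sup>2"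
  using frob_inner_comm[of A n B]
  by (simp add: frob_norm_square frob_inner_diff_left[of _ n] frob_inner_diff_right[of _ n])

lemma frob_norm_minus_commute:
  "A \<in> carrier_mat n n \<Longrightarrow> B \<in> carrier_mat n n \<Longrightarrow> frob_norm (A - B) = frob_norm (B - A)"
  by (auto simp: frob_norm_def frob_inner_def algebra_simps intro!: sum.cong)

lemma frob_cauchy_schwarz:
  assumes "A \<in> carrier_mat n n" "B \<in> carrier_mat n n"
  shows "\<bar>frob_inner A B\<bar> \<le> frob_norm A * frob_norm B"
proof -
  have "\<bar>frob_inner A B\<bar> = \<bar>\<Sum>ij\<in>{..<n} \<times> {..<n}. A $$ ij * B $$ ij\<bar>"
    using assms by (simp add: frob_inner_sum[of _ n] sum.cartesian_product case_prod_unfold)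
  also have "\<dots> \<le> (\<Sum>ij\<in>{..<n} \<times> {..<n}. \<bar>A $$ ij\<bar> * \<bar>B $$ ij\<bar>)"
    unfolding abs_mult[symmetric] by (rule sum_abs)
  also have "\<dots> \<le> frob_norm A * frob_norm B"
    unfolding frob_norm_L2[OF assms(1)] frob_norm_L2[OF assms(2)] by (rule L2_set_mult_ineq)
  finally show ?thesis .
qed

lemma frob_norm_triangle:
  assumes "A \<in> carrier_mat n n" "B \<in> carrier_mat n n"
  shows "frob_norm (A + B) \<le> frob_norm A + frob_norm B"
proof -
  have "frob_norm (A + B) = L2_set (\<lambda>ij. A $$ ij + B $$ ij) ({..<n} \<times> {..<n})"
    using assms by (subst frob_norm_L2[of _ n]) (auto intro!: L2_set_cong)
  then show ?thesis
    using L2_set_triangle_ineq[of "\<lambda>ij. A $$ ij" "\<lambda>ij. B $$ ij" "{..<n} \<times> {..<n}"]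
    by (simp add: frob_norm_L2[OF assms(1)] frob_norm_L2[OF assms(2)])
qed

lemma frob_norm_diff_triangle:
  assumes "A \<in> carrier_mat n n" "B \<in> carrier_mat n n" "C \<in> carrier_mat n n"
  shows "frob_norm (A - C) \<le> frob_norm (A - B) + frob_norm (B - C)"
proof -
  have "A - C = (A - B) + (B - C)" using assms by (intro eq_matI) auto
  then show ?thesis using frob_norm_triangle[of "A - B" n "B - C"] assms by simp
qed

lemma frob_norm_eq_0:
  assumes "A \<in> carrier_mat n n" "B \<in> carrier_mat n n" "frob_norm (A - B) = 0"
  shows "A = B"
proof (rule eq_matI)
  have z: "(\<Sum>ij\<in>{..<n} \<times> {..<n}. ((A - B) $$ ij)\<^sup>2) = 0"
    using assms frob_norm_L2[of "A - B" n] by (simp add: L2_set_def)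
  fix i j assume "i < dim_row B" "j < dim_col B"
  then have "((A - B) $$ (i, j))\<^sup>2 = 0" "i < n" "j < n"
    using z assms by (subst (asm) sum_nonneg_eq_0_iff; auto)+
  then show "A $$ (i, j) = B $$ (i, j)" using assms by simp
qed (use assms in auto)

text \<open>The bilinear form is the Frobenius product of \<open>A\<close> with the rank-one matrix
  of entries \<open>y $ j * x $ k\<close>, whose Frobenius norm is the product of the two
  lengths.\<close>

lemma abs_bilinear_le:
  assumes A: "A \<in> carrier_mat n n" and x: "x \<in> carrier_vec n" and y: "y \<in> carrier_vec n"
  shows "\<bar>y \<bullet> (A *\<^sub>v x)\<bar> \<le> frob_norm A * (sqrt (y \<bullet> y) * sqrt (x \<bullet> x))"
proof -
  define W where "W = mat n n (\<lambda>(j, k). y $ j * x $ k)"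
  have W: "W \<in> carrier_mat n n" by (simp add: W_def)
  have "frob_inner A W = y \<bullet> (A *\<^sub>v x)"
    using A x y by (simp add: frob_inner_sum[of _ n] bilinear_sum[of _ n] W_def mult_ac)
  moreover have "frob_inner W W = (y \<bullet> y) * (x \<bullet> x)"
    unfolding frob_inner_sum[OF W] scalar_prod_sum[OF x x] scalar_prod_sum[OF y y] sum_product
    by (intro sum.cong refl) (simp add: W_def)
  ultimately show ?thesis using frob_cauchy_schwarz[OF A W]
    by (simp add: frob_norm_def real_sqrt_mult)
qed

lemma abs_quad_le:
  "A \<in> carrier_mat n n \<Longrightarrow> x \<in> carrier_vec n \<Longrightarrow> \<bar>x \<bullet> (A *\<^sub>v x)\<bar> \<le> frob_norm A * (x \<bullet> x)"
  using abs_bilinear_le[of A n x x] scalar_prod_self_nonneg[of x] by simp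

text \<open>Parseval expands each row of \<open>A\<close> in the frame; exchanging the two sums
  regroups the coefficients into the vectors \<open>A *\<^sub>v u k\<close>.\<close>

lemma frob_norm_square_frame:
  assumes u: "orthonormal n {..<n} u" and A: "A \<in> carrier_mat n n"
  shows "(frob_norm A)\<^sup>2 = (\<Sum>k<n. (A *\<^sub>v u k) \<bullet> (A *\<^sub>v u k))"
proof -
  have "(\<Sum>k<n. (A *\<^sub>v u k) \<bullet> (A *\<^sub>v u k)) = (\<Sum>k<n. \<Sum>j<n. (u k \<bullet> row A j)\<^sup>2)"
  proof (rule sum.cong[OF refl])
    fix k assume "k \<in> {..<n}"
    then have uk: "u k \<in> carrier_vec n" using orthonormalD(2)[OF u] by simp
    have "(A *\<^sub>v u k) \<bullet> (A *\<^sub>v u k) = (\<Sum>j<n. (A *\<^sub>v u k) $ j * (A *\<^sub>v u k) $ j)"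
      using A uk by (intro scalar_prod_sum) auto
    also have "\<dots> = (\<Sum>j<n. (u k \<bullet> row A j)\<^sup>2)"
    proof (rule sum.cong[OF refl])
      fix j assume j: "j \<in> {..<n}"
      have "row A j \<in> carrier_vec n" using A by auto
      then show "(A *\<^sub>v u k) $ j * (A *\<^sub>v u k) $ j = (u k \<bullet> row A j)\<^sup>2"
        using A uk j scalar_prod_comm[of "row A j" n "u k"] by (simp add: power2_eq_square)
    qed
    finally show "(A *\<^sub>v u k) \<bullet> (A *\<^sub>v u k) = (\<Sum>j<n. (u k \<bullet> row A j)\<^sup>2)" .
  qed
  also have "\<dots> = (\<Sum>j<n. \<Sum>k<n. (u k \<bullet> row A j)\<^sup>2)" by (rule sum.swap)
  also have "\<dots> = (\<Sum>j<n. row A j \<bullet> row A j)"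
    using A by (intro sum.cong refl parseval[OF u]) auto
  also have "\<dots> = frob_inner A A"
    using A by (auto simp: frob_inner_sum[OF A] scalar_prod_def lessThan_atLeast0 intro!: sum.cong)
  finally show ?thesis by (simp add: frob_norm_square)
qed

lemma frob_inner_one: "A \<in> carrier_mat n n \<Longrightarrow> frob_inner A (1\<^sub>m n) = mat_trace A"
proof -
  assume A: "A \<in> carrier_mat n n"
  have "frob_inner A (1\<^sub>m n) = (\<Sum>i<n. \<Sum>j<n. if j = i then A $$ (i, i) else 0)"
    unfolding frob_inner_sum[OF A] by (intro sum.cong refl) auto
  then show ?thesis using A by (simp add: mat_trace_def)
qed

lemma trace_frame:
  assumes u: "orthonormal n {..<n} u" and A: "A \<in> carrier_mat n n"
  shows "mat_trace A = (\<Sum>i<n. u i \<bullet> (A *\<^sub>v u i))"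
  using frob_inner_spectral_sum[of "{..<n}" u n A "\<lambda>_. 1"] orthonormalD(2)[OF u] A
  by (simp add: spectral_sum_one[OF u] frob_inner_one)

lemma sym_mats_diff: "A \<in> sym_mats n \<Longrightarrow> B \<in> sym_mats n \<Longrightarrow> A - B \<in> sym_mats n"
  using sym_mats_carrier[of A n] sym_mats_carrier[of B n]
  by (intro sym_matsI) (auto simp: sym_mats_index[of _ n])

lemma sym_mats_add: "A \<in> sym_mats n \<Longrightarrow> B \<in> sym_mats n \<Longrightarrow> A + B \<in> sym_mats n"
  using sym_mats_carrier[of A n] sym_mats_carrier[of B n]
  by (intro sym_matsI) (auto simp: sym_mats_index[of _ n])

lemma sym_mats_smult: "A \<in> sym_mats n \<Longrightarrow> c \<cdot>\<^sub>m A \<in> sym_mats n"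
  using sym_mats_carrier[of A n]
  by (intro sym_matsI) (auto simp: sym_mats_index[of _ n])

section \<open>The spectrahedron and its Euclidean projection\<close>

lemma spectrahedronD:
  assumes "X \<in> spectrahedron n"
  shows "X \<in> sym_mats n" "X \<in> carrier_mat n n" "mat_trace X = 1"
    "\<And>v. v \<in> carrier_vec n \<Longrightarrow> 0 \<le> v \<bullet> (X *\<^sub>v v)"
  using assms sym_mats_carrier[of X n] by (auto simp: spectrahedron_def psd_def)

lemma mult_add_mat_vec:
  fixes A :: "real mat"
  shows "A \<in> carrier_mat n n \<Longrightarrow> B \<in> carrier_mat n n \<Longrightarrow> x \<in> carrier_vec n \<Longrightarrow> y \<in> carrier_vec n \<Longrightarrow>
   y \<bullet> ((A + B) *\<^sub>v x) = y \<bullet> (A *\<^sub>v x) + y \<bullet> (B *\<^sub>v x)"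
  by (simp add: add_mult_distrib_mat_vec[of _ n n] scalar_prod_add_distrib[of _ n])

lemma mult_diff_mat_vec:
  fixes A :: "real mat"
  shows "A \<in> carrier_mat n n \<Longrightarrow> B \<in> carrier_mat n n \<Longrightarrow> x \<in> carrier_vec n \<Longrightarrow> y \<in> carrier_vec n \<Longrightarrow>
   y \<bullet> ((A - B) *\<^sub>v x) = y \<bullet> (A *\<^sub>v x) - y \<bullet> (B *\<^sub>v x)"
  by (simp add: minus_mult_distrib_mat_vec scalar_prod_minus_distrib[of _ n])

lemma mult_smult_mat_vec:
  fixes A :: "real mat"
  shows "A \<in> carrier_mat n n \<Longrightarrow> x \<in> carrier_vec n \<Longrightarrow> y \<in> carrier_vec n \<Longrightarrow>
   y \<bullet> ((c \<cdot>\<^sub>m A) *\<^sub>v x) = c * (y \<bullet> (A *\<^sub>v x))"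
  by (simp add: bilinear_sum[of _ n] sum_distrib_left mult_ac)

lemma convex_comb_spectrahedron:
  assumes X: "X \<in> spectrahedron n" and Y: "Y \<in> spectrahedron n" and t: "0 \<le> t" "t \<le> 1"
  shows "(1 - t) \<cdot>\<^sub>m X + t \<cdot>\<^sub>m Y \<in> spectrahedron n"
proof -
  note X = spectrahedronD[OF X] and Y = spectrahedronD[OF Y]
  have "mat_trace ((1 - t) \<cdot>\<^sub>m X + t \<cdot>\<^sub>m Y) = (1 - t) * mat_trace X + t * mat_trace Y"
    using X(2) Y(2) by (simp add: mat_trace_def sum.distrib sum_distrib_left)
  moreover have "0 \<le> v \<bullet> (((1 - t) \<cdot>\<^sub>m X + t \<cdot>\<^sub>m Y) *\<^sub>v v)" if "v \<in> carrier_vec n" for v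
    using that X Y t by (simp add: mult_add_mat_vec[of _ n] mult_smult_mat_vec[of _ n])
  ultimately show ?thesis
    using X Y t by (auto simp: spectrahedron_def psd_def intro!: sym_mats_add sym_mats_smult)
qed

text \<open>\<open>s\<close> is the threshold of the projection onto the probability simplex. The
  sum is continuous in \<open>s\<close>, vanishes at the maximum of the \<open>y i\<close>, and is
  at least 1 at \<open>y 0 - 1\<close> through its first term alone.\<close>

lemma eigenvalue_shift_exists:
  fixes y :: "nat \<Rightarrow> real"
  assumes n: "0 < n"
  shows "\<exists>s. (\<Sum>i<n. max (y i - s) 0) = 1"
proof -
  define g where "g = (\<lambda>s. \<Sum>i<n. max (y i - s) 0)"
  define M where "M = Max (y ` {..<n})"
  have M: "y i \<le> M" if "i < n" for i unfolding M_def using that by (intro Max_ge) auto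
  have "g M = 0" unfolding g_def using M by (intro sum.neutral) (auto simp: max_def)
  have "1 = (\<Sum>i\<in>{0}. max (y i - (y 0 - 1)) 0)" by simp
  also have "\<dots> \<le> g (y 0 - 1)" unfolding g_def using n by (intro sum_mono2) auto
  finally have "1 \<le> g (y 0 - 1)" .
  moreover have "isCont g x" for x unfolding g_def by (intro continuous_intros)
  ultimately have "\<exists>x\<ge>y 0 - 1. x \<le> M \<and> g x = 1"
    using \<open>g M = 0\<close> M[OF n] by (intro IVT2) auto
  then show ?thesis unfolding g_def by blast
qed

lemma spectral_sum_diff: "spectral_sum n I u d - spectral_sum n I u e = spectral_sum n I u (\<lambda>i. d i - e i)"
  by (rule eq_matI) (auto simp: spectral_sum_def sum_subtractf[symmetric] algebra_simps intro!: sum.cong)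

text \<open>The candidate \<open>P\<close> keeps the eigenvectors of \<open>Y\<close> and projects
  its eigenvalues onto the simplex. The residual \<open>Y - P\<close> has eigenvalues
  \<open>min (y i) s\<close>, all at most \<open>s\<close> and equal to \<open>s\<close> wherever
  \<open>P\<close> is positive. Paired with a positive semidefinite matrix of trace 1 it gives at
  most \<open>s\<close>, with equality at \<open>P\<close>; this is the variational
  inequality.\<close>

lemma spectrahedron_proj_props:
  assumes Y: "Y \<in> sym_mats n" and n: "0 < n"
  shows "\<exists>b y s. orthonormal n {..<n} b \<and> Y = spectral_sum n {..<n} b y \<and>
      spectrahedron_proj n Y = spectral_sum n {..<n} b (\<lambda>i. max (y i - s) 0)"
    and "spectrahedron_proj n Y \<in> spectrahedron n"
    and "Z \<in> spectrahedron n \<Longrightarrow> frob_inner (Y - spectrahedron_proj n Y) (Z - spectrahedron_proj n Y) \<le> 0"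
proof -
  obtain b y where b: "orthonormal n {..<n} b" and Yb: "Y = spectral_sum n {..<n} b y"
    using spectral_decomposition[OF Y] by blast
  obtain s where s: "(\<Sum>i<n. max (y i - s) 0) = 1" using eigenvalue_shift_exists[OF n] by blast
  have bc: "b i \<in> carrier_vec n" if "i < n" for i using orthonormalD(2)[OF b] that by simp
  define P where "P = spectral_sum n {..<n} b (\<lambda>i. max (y i - s) 0)"
  have Pc: "P \<in> carrier_mat n n" unfolding P_def by (rule spectral_sum_carrier)
  have PS: "P \<in> spectrahedron n"
    unfolding spectrahedron_def P_def using bc s by (auto simp: trace_spectral_sum_orthonormal[OF b] intro!: psd_spectral_sum)
  have YP: "Y - P = spectral_sum n {..<n} b (\<lambda>i. min (y i) s)"
    unfolding Yb P_def spectral_sum_diff by (rule arg_cong[where f = "spectral_sum n {..<n} b"]) (auto simp: max_def min_def)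
  have YPc: "Y - P \<in> carrier_mat n n" using sym_mats_carrier[OF Y] Pc by simp
  have var: "frob_inner (Y - P) (Z - P) \<le> 0" if Z: "Z \<in> spectrahedron n" for Z
  proof -
    note Z = spectrahedronD[OF Z]
    have "frob_inner (Y - P) Z = (\<Sum>i<n. min (y i) s * (b i \<bullet> (Z *\<^sub>v b i)))"
      using frob_inner_comm[OF YPc Z(2)] frob_inner_spectral_sum[of "{..<n}" b n Z "\<lambda>i. min (y i) s"] bc Z(2)
      unfolding YP by simp
    also have "\<dots> \<le> (\<Sum>i<n. s * (b i \<bullet> (Z *\<^sub>v b i)))"
      using Z(4) bc by (intro sum_mono mult_right_mono) auto
    also have "\<dots> = s" using trace_frame[OF b Z(2)] Z(3) by (simp flip: sum_distrib_left)
    finally have 1: "frob_inner (Y - P) Z \<le> s" .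
    have "frob_inner (Y - P) P = (\<Sum>i<n. max (y i - s) 0 * (b i \<bullet> ((Y - P) *\<^sub>v b i)))"
      unfolding P_def using bc YPc[unfolded P_def] by (intro frob_inner_spectral_sum) auto
    also have "\<dots> = (\<Sum>i<n. s * max (y i - s) 0)"
    proof (rule sum.cong[OF refl])
      fix i assume i: "i \<in> {..<n}"
      have "b i \<bullet> ((Y - P) *\<^sub>v b i) = min (y i) s"
        unfolding YP using spectral_sum_eigvec[OF b i] bc i orthonormalD(3)[OF b i] by simp
      then show "max (y i - s) 0 * (b i \<bullet> ((Y - P) *\<^sub>v b i)) = s * max (y i - s) 0"
        by (auto simp: max_def min_def)
    qed
    also have "\<dots> = s" using s by (simp flip: sum_distrib_left)
    finally show ?thesis using 1 frob_inner_diff_right[OF Z(2) Pc YPc] by simp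
  qed
  \<comment> \<open>\<open>arg_min_on\<close> selects some minimiser, so uniqueness is needed to
    identify it with \<open>P\<close>. The obtuse angle at \<open>P\<close> makes the squared
    distances superadditive, which gives minimality and uniqueness at once.\<close>
  have least: "frob_norm (P - Y) \<le> frob_norm (Z - Y) \<and> (frob_norm (Z - Y) \<le> frob_norm (P - Y) \<longrightarrow> Z = P)"
    if Z: "Z \<in> spectrahedron n" for Z
  proof -
    note Zc = spectrahedronD(2)[OF Z] and Yc = sym_mats_carrier[OF Y]
    have e: "Z - Y = (Z - P) - (Y - P)" using Zc Yc Pc by (intro eq_matI) auto
    have "(frob_norm (Z - Y))\<^sup>2 = (frob_norm (Z - P))\<^sup>2 - 2 * frob_inner (Z - P) (Y - P) + (frob_norm (Y - P))\<^sup>2"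
      unfolding e using Zc Pc YPc by (intro frob_norm_diff_square) auto
    also have "frob_norm (Y - P) = frob_norm (P - Y)" using Yc Pc by (rule frob_norm_minus_commute)
    also have "frob_inner (Z - P) (Y - P) = frob_inner (Y - P) (Z - P)"
      using Zc Pc YPc by (intro frob_inner_comm) auto
    finally have *: "(frob_norm (Z - P))\<^sup>2 + (frob_norm (P - Y))\<^sup>2 \<le> (frob_norm (Z - Y))\<^sup>2"
      using var[OF Z] by simp
    then have "(frob_norm (P - Y))\<^sup>2 \<le> (frob_norm (Z - Y))\<^sup>2"
      using zero_le_power2[of "frob_norm (Z - P)"] by linarith
    then have 1: "frob_norm (P - Y) \<le> frob_norm (Z - Y)" by (rule power2_le_imp_le) simp
    have "Z = P" if "frob_norm (Z - Y) \<le> frob_norm (P - Y)"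
    proof -
      have "(frob_norm (Z - P))\<^sup>2 \<le> 0"
        using * power_mono[OF that frob_norm_nonneg, of 2] by linarith
      then have "frob_norm (Z - P) = 0" by (metis power2_less_eq_zero_iff)
      then show ?thesis using frob_norm_eq_0[OF Zc Pc] by simp
    qed
    then show ?thesis using 1 by blast
  qed
  have "is_arg_min (\<lambda>X. frob_norm (X - Y)) (\<lambda>X. X \<in> spectrahedron n) P"
    using least PS by (auto simp: is_arg_min_def not_less)
  then have "is_arg_min (\<lambda>X. frob_norm (X - Y)) (\<lambda>X. X \<in> spectrahedron n) (spectrahedron_proj n Y)"
    unfolding spectrahedron_proj_def arg_min_on_def arg_min_def by (rule someI)
  then have "spectrahedron_proj n Y \<in> spectrahedron n" "frob_norm (spectrahedron_proj n Y - Y) \<le> frob_norm (P - Y)"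
    using PS by (auto simp: is_arg_min_linorder)
  then have proj: "spectrahedron_proj n Y = P" using least by blast
  show "\<exists>b y s. orthonormal n {..<n} b \<and> Y = spectral_sum n {..<n} b y \<and>
      spectrahedron_proj n Y = spectral_sum n {..<n} b (\<lambda>i. max (y i - s) 0)"
    unfolding proj P_def using b Yb by blast
  show "spectrahedron_proj n Y \<in> spectrahedron n" unfolding proj by (rule PS)
  show "Z \<in> spectrahedron n \<Longrightarrow> frob_inner (Y - spectrahedron_proj n Y) (Z - spectrahedron_proj n Y) \<le> 0"
    unfolding proj by (rule var)
qed

text \<open>The angle at the projection between \<open>Y\<close> and \<open>Z\<close> is obtuse, so
  dropping the residual only shortens the distance. This form compares the next iterate with
  \<open>Xs\<close>.\<close>

lemma spectrahedron_proj_nonexpansive_to: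
  assumes Y: "Y \<in> sym_mats n" and n: "0 < n" and Z: "Z \<in> spectrahedron n"
  shows "frob_norm (spectrahedron_proj n Y - Z) \<le> frob_norm (Y - Z)"
proof -
  define P where "P = spectrahedron_proj n Y"
  note P = spectrahedron_proj_props(2,3)[OF Y n, folded P_def]
  note c = spectrahedronD(2)[OF P(1)] spectrahedronD(2)[OF Z] sym_mats_carrier[OF Y]
  have e: "Y - Z = (Y - P) - (Z - P)" using c by (intro eq_matI) auto
  have "(frob_norm (Y - Z))\<^sup>2 = (frob_norm (Y - P))\<^sup>2 - 2 * frob_inner (Y - P) (Z - P) + (frob_norm (Z - P))\<^sup>2"
    unfolding e using c by (intro frob_norm_diff_square) auto
  then have "(frob_norm (Z - P))\<^sup>2 \<le> (frob_norm (Y - Z))\<^sup>2"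
    using P(2)[OF Z] zero_le_power2[of "frob_norm (Y - P)"] by linarith
  then have "frob_norm (Z - P) \<le> frob_norm (Y - Z)" by (rule power2_le_imp_le) simp
  then show ?thesis using frob_norm_minus_commute[of P n Z] c by (simp add: P_def)
qed

text \<open>The variational inequalities at the two projections are added, which bounds the squared
  distance by an inner product; Cauchy-Schwarz does the rest. Measurability of the projection comes
  from this Lipschitz bound.\<close>

lemma spectrahedron_proj_nonexpansive:
  assumes Y: "Y \<in> sym_mats n" and Y': "Y' \<in> sym_mats n" and n: "0 < n"
  shows "frob_norm (spectrahedron_proj n Y - spectrahedron_proj n Y') \<le> frob_norm (Y - Y')"
proof -
  define P where "P = spectrahedron_proj n Y"
  define P' where "P' = spectrahedron_proj n Y'"
  note P = spectrahedron_proj_props(2,3)[OF Y n, folded P_def]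
  note P' = spectrahedron_proj_props(2,3)[OF Y' n, folded P'_def]
  note c = spectrahedronD(2)[OF P(1)] spectrahedronD(2)[OF P'(1)] sym_mats_carrier[OF Y] sym_mats_carrier[OF Y']
  have "frob_inner (Y - P) (P' - P) + frob_inner (Y' - P') (P - P') \<le> 0"
    using P(2)[OF P'(1)] P'(2)[OF P(1)] by simp
  then have "(frob_norm (P - P'))\<^sup>2 \<le> frob_inner (Y - Y') (P - P')"
    using c frob_inner_comm[of P n P']
    by (simp add: frob_norm_diff_square[of _ n] frob_norm_square frob_inner_diff_left[of _ n] frob_inner_diff_right[of _ n])
  also have "\<dots> \<le> frob_norm (Y - Y') * frob_norm (P - P')"
    using frob_cauchy_schwarz[of "Y - Y'" n "P - P'"] c by (simp add: abs_le_iff)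
  finally have "frob_norm (P - P') * frob_norm (P - P') \<le> frob_norm (Y - Y') * frob_norm (P - P')"
    by (simp add: power2_eq_square)
  then show ?thesis unfolding P_def[symmetric] P'_def[symmetric]
    by (cases "frob_norm (P - P') = 0") (auto dest!: mult_right_le_imp_le simp: less_le)
qed

section \<open>Optimality conditions and rank preservation\<close>

text \<open>The Frechet condition along a segment, at one suitable \<open>t\<close> only. That is
  enough for the convex gradient inequality and for first-order optimality, which divide by
  \<open>t\<close> and then let \<open>e\<close> tend to 0.\<close>

lemma gradient_along_segment:
  assumes D: "has_gradient_sym n f D X" and X: "X \<in> sym_mats n" and Y: "Y \<in> sym_mats n" and e: "0 < e"
  shows "\<exists>t. 0 < t \<and> t \<le> 1 \<and>
    \<bar>f ((1 - t) \<cdot>\<^sub>m X + t \<cdot>\<^sub>m Y) - f X - t * frob_inner D (Y - X)\<bar> \<le> t * e"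
proof -
  define N where "N = frob_norm (Y - X)"
  have N: "0 \<le> N" by (simp add: N_def)
  have c: "X \<in> carrier_mat n n" "Y \<in> carrier_mat n n" "D \<in> carrier_mat n n"
    using X Y D sym_mats_carrier by (auto simp: has_gradient_sym_def)
  have "0 < e / (N + 1)" using e N by simp
  then obtain d where d: "d > 0" and
    dY: "\<And>Y. Y \<in> sym_mats n \<Longrightarrow> frob_norm (Y - X) < d \<Longrightarrow>
        \<bar>f Y - f X - frob_inner D (Y - X)\<bar> \<le> e / (N + 1) * frob_norm (Y - X)"
    using D unfolding has_gradient_sym_def by meson
  \<comment> \<open>The \<open>N + 1\<close> in the denominator, here and in the tolerance, avoids
    division by zero when \<open>Y = X\<close>.\<close>
  define t where "t = min 1 (d / (2 * (N + 1)))"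
  have t: "0 < t" "t \<le> 1" using d N by (auto simp: t_def)
  have "t * N < d"
  proof -
    have "t * N \<le> d / (2 * (N + 1)) * N" using N by (intro mult_right_mono) (auto simp: t_def)
    also have "\<dots> < d" using d N by (simp add: field_simps add_strict_increasing2)
    finally show ?thesis .
  qed
  define Z where "Z = (1 - t) \<cdot>\<^sub>m X + t \<cdot>\<^sub>m Y"
  have Z: "Z \<in> sym_mats n" unfolding Z_def by (intro sym_mats_add sym_mats_smult X Y)
  have ZX: "Z - X = t \<cdot>\<^sub>m (Y - X)" unfolding Z_def using c by (intro eq_matI) (auto simp: algebra_simps)
  have nZ: "frob_norm (Z - X) = t * N" unfolding ZX N_def using c t by (subst frob_norm_smult[of _ n]) auto
  have "\<bar>f Z - f X - frob_inner D (Z - X)\<bar> \<le> e / (N + 1) * (t * N)"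
    using dY[OF Z] \<open>t * N < d\<close> unfolding nZ by simp
  also have "\<dots> \<le> t * e"
  proof -
    have "N / (N + 1) \<le> 1" using N by simp
    then have "(t * e) * (N / (N + 1)) \<le> t * e" using t e by (intro mult_left_le) auto
    then show ?thesis by (simp add: mult_ac)
  qed
  also have "frob_inner D (Z - X) = t * frob_inner D (Y - X)"
    unfolding ZX using c by (subst frob_inner_smult_right[of _ n]) auto
  finally show ?thesis using t unfolding Z_def by blast
qed

lemma convex_gradient_ineq:
  assumes f: "convex_on_sym n f" and D: "has_gradient_sym n f D X"
    and X: "X \<in> sym_mats n" and Y: "Y \<in> sym_mats n"
  shows "f X + frob_inner D (Y - X) \<le> f Y"
proof (rule field_le_epsilon)
  fix e :: real assume "0 < e"
  then obtain t where t: "0 < t" "t \<le> 1"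
    and b: "\<bar>f ((1 - t) \<cdot>\<^sub>m X + t \<cdot>\<^sub>m Y) - f X - t * frob_inner D (Y - X)\<bar> \<le> t * e"
    using gradient_along_segment[OF D X Y] by blast
  have "f ((1 - t) \<cdot>\<^sub>m X + t \<cdot>\<^sub>m Y) \<le> (1 - t) * f X + t * f Y"
    using f X Y t unfolding convex_on_sym_def by auto
  with b have "t * (f X + frob_inner D (Y - X)) \<le> t * (f Y + e)"
    by (simp add: algebra_simps abs_le_iff)
  then show "f X + frob_inner D (Y - X) \<le> f Y + e" using t by simp
qed

lemma first_order_optimality:
  assumes D: "has_gradient_sym n f D Xs" and opt: "is_arg_min f (\<lambda>X. X \<in> spectrahedron n) Xs"
    and X: "X \<in> spectrahedron n"
  shows "0 \<le> frob_inner D (X - Xs)"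
proof (rule field_le_epsilon)
  fix e :: real assume "0 < e"
  have Xs: "Xs \<in> spectrahedron n" using opt by (simp add: is_arg_min_def)
  obtain t where t: "0 < t" "t \<le> 1"
    and b: "\<bar>f ((1 - t) \<cdot>\<^sub>m Xs + t \<cdot>\<^sub>m X) - f Xs - t * frob_inner D (X - Xs)\<bar> \<le> t * e"
    using gradient_along_segment[OF D spectrahedronD(1)[OF Xs] spectrahedronD(1)[OF X] \<open>0 < e\<close>] by blast
  have "(1 - t) \<cdot>\<^sub>m Xs + t \<cdot>\<^sub>m X \<in> spectrahedron n"
    using Xs X t by (intro convex_comb_spectrahedron) auto
  then have "f Xs \<le> f ((1 - t) \<cdot>\<^sub>m Xs + t \<cdot>\<^sub>m X)" using opt by (simp add: is_arg_min_linorder)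
  with b have "t * 0 \<le> t * (frob_inner D (X - Xs) + e)" by (simp add: algebra_simps abs_le_iff)
  then show "0 \<le> frob_inner D (X - Xs) + e" using t by (simp add: zero_le_mult_iff)
qed

section \<open>Complementary slackness and the bottom eigenspace\<close>

lemma psd_zero_vec:
  assumes A: "psd n A" and v: "v \<in> carrier_vec n" and z: "v \<bullet> (A *\<^sub>v v) = 0"
  shows "A *\<^sub>v v = 0\<^sub>v n"
proof -
  have As: "A \<in> sym_mats n" using A by (simp add: psd_def)
  obtain b c where b: "orthonormal n {..<n} b" and Ab: "A = spectral_sum n {..<n} b c"
    using spectral_decomposition[OF As] by blast
  have bc: "b i \<in> carrier_vec n" if "i < n" for i using orthonormalD(2)[OF b] that by simp
  have c: "0 \<le> c i" if "i < n" for i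
  proof -
    have "0 \<le> b i \<bullet> (A *\<^sub>v b i)" using A bc[OF that] by (simp add: psd_def)
    also have "\<dots> = c i" unfolding Ab using spectral_sum_eigvec[OF b] orthonormalD(3)[OF b] bc that by simp
    finally show ?thesis .
  qed
  have "(\<Sum>i<n. c i * (b i \<bullet> v)\<^sup>2) = 0"
    using z bc v unfolding Ab by (subst (asm) spectral_sum_quad) auto
  then have "\<forall>i\<in>{..<n}. c i * (b i \<bullet> v)\<^sup>2 = 0"
    using c by (subst (asm) sum_nonneg_eq_0_iff) auto
  then have z: "c i * (b i \<bullet> v) = 0" if "i < n" for i using that by force
  show ?thesis
  proof (rule eq_vecI)
    fix j assume "j < dim_vec (0\<^sub>v n :: real vec)"
    then have j: "j < n" by simp
    have "(A *\<^sub>v v) $ j = (\<Sum>i<n. c i * (b i \<bullet> v) * b i $ j)"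
      unfolding Ab using bc v j by (intro spectral_sum_mult_vec) auto
    then show "(A *\<^sub>v v) $ j = 0\<^sub>v n $ j" using z j by simp
  qed (use sym_mats_carrier[OF As] in simp)
qed

text \<open>By symmetry the range of \<open>A\<close> lies in the span of the frame vectors in
  \<open>I\<close>. A larger rank would give a nonzero vector in that range orthogonal to all of
  them.\<close>

lemma frame_kernel_rank:
  assumes u: "orthonormal n {..<n} u" and A: "A \<in> sym_mats n" and I: "I \<subseteq> {..<n}"
    and zero: "\<And>i. i \<in> {..<n} - I \<Longrightarrow> A *\<^sub>v u i = 0\<^sub>v n"
  shows "vec_space.rank n A \<le> card I"
proof (rule ccontr)
  assume neg: "\<not> vec_space.rank n A \<le> card I"
  obtain w e where w: "orthonormal n {..<n} w" and Aw: "A = spectral_sum n {..<n} w e"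
    using spectral_decomposition[OF A] by blast
  define J where "J = {i\<in>{..<n}. e i \<noteq> 0}"
  have rk: "vec_space.rank n A = card J" unfolding Aw J_def by (rule rank_spectral_sum[OF w])
  have fI: "finite I" using I finite_subset by blast
  have uc: "u i \<in> carrier_vec n" if "i < n" for i using orthonormalD(2)[OF u] that by simp
  have wc: "w i \<in> carrier_vec n" if "i < n" for i using orthonormalD(2)[OF w] that by simp
  have "\<exists>z\<in>carrier_vec n. z \<noteq> 0\<^sub>v n \<and> (\<forall>v\<in>set (map u (sorted_list_of_set I)). v \<bullet> z = 0) \<and>
      (\<forall>i\<in>{..<n} - J. w i \<bullet> z = 0)"
    by (rule exists_orthogonal_to_frame_part[OF w]) (use neg rk uc I fI in \<open>auto simp: J_def\<close>)
  then obtain z where z: "z \<in> carrier_vec n" "z \<noteq> 0\<^sub>v n" and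
    zI: "\<And>i. i \<in> I \<Longrightarrow> u i \<bullet> z = 0" and zJ: "\<And>i. i \<in> {..<n} - J \<Longrightarrow> w i \<bullet> z = 0"
    using fI by auto
  have Ac: "A \<in> carrier_mat n n" using A by (rule sym_mats_carrier)
  have "w j \<bullet> z = 0" if j: "j < n" for j
  proof (cases "j \<in> J")
    case True
    have "e j * (w j \<bullet> z) = z \<bullet> (A *\<^sub>v w j)"
      unfolding Aw using spectral_sum_eigvec[OF w, of j] j wc[OF j] z(1) scalar_prod_comm[OF wc[OF j] z(1)] by simp
    also have "\<dots> = (\<Sum>i<n. (u i \<bullet> z) * (u i \<bullet> (A *\<^sub>v w j)))"
      using parseval_inner[OF u z(1), of "A *\<^sub>v w j"] Ac wc[OF j] by simp
    also have "\<dots> = 0"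
    proof (rule sum.neutral, rule ballI)
      fix i assume i: "i \<in> {..<n}"
      show "(u i \<bullet> z) * (u i \<bullet> (A *\<^sub>v w j)) = 0"
      proof (cases "i \<in> I")
        case False
        then have "u i \<bullet> (A *\<^sub>v w j) = 0"
          using sym_bilinear[OF A wc[OF j] uc] zero[of i] i wc[OF j] by simp
        then show ?thesis by simp
      qed (simp add: zI)
    qed
    finally show ?thesis using True by (simp add: J_def)
  qed (use zJ j in auto)
  then show False using zero_of_orthogonal_to_basis[OF w z(1)] z(2) by blast
qed

text \<open>Comparison with the rank-one matrix of a bottom eigenvector forces the mean of the
  eigenvalues weighted by \<open>Xs\<close> down to their minimum, so \<open>Xs\<close> vanishes on
  all higher eigenvectors. The rank of \<open>Xs\<close> then bounds the multiplicity of the bottom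
  eigenvalue from below by \<open>r\<close>, and the gap at position \<open>n - r\<close> bounds it
  from above; hence \<open>I\<close> indexes exactly the bottom eigenspace.\<close>

lemma kkt_structure:
  assumes N: "N \<in> sym_mats n" and Xs: "Xs \<in> spectrahedron n"
    and opt: "\<And>X. X \<in> spectrahedron n \<Longrightarrow> 0 \<le> frob_inner N (X - Xs)"
    and rk: "vec_space.rank n Xs = r" and rn: "r < n"
    and gap: "0 < \<delta>" "\<delta> \<le> lambda_desc (n - r) N - lambda_desc n N"
  shows "\<exists>u d I. orthonormal n {..<n} u \<and> N = spectral_sum n {..<n} u d \<and> I \<subseteq> {..<n} \<and> card I = r \<and>
    (\<forall>i\<in>I. d i = lambda_desc n N) \<and> (\<forall>i\<in>{..<n} - I. lambda_desc n N + \<delta> \<le> d i) \<and>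
    (\<forall>i\<in>{..<n} - I. Xs *\<^sub>v u i = 0\<^sub>v n)"
proof -
  obtain u d where u: "orthonormal n {..<n} u" and Nu: "N = spectral_sum n {..<n} u d"
    using spectral_decomposition[OF N] by blast
  have uc: "u i \<in> carrier_vec n" if "i < n" for i using orthonormalD(2)[OF u] that by simp
  have Nc: "N \<in> carrier_mat n n" using N by (rule sym_mats_carrier)
  note Xsp = spectrahedronD[OF Xs]
  define \<mu> where "\<mu> = lambda_desc n N"
  define \<nu> where "\<nu> = lambda_desc (n - r) N"
  have n: "1 \<le> n" using rn by simp
  have "card {i\<in>{..<n}. d i < \<mu>} = 0" and "card {i\<in>{..<n}. \<mu> < d i} < n"
    using lambda_desc_spectral_sum[OF u n order_refl, of d] unfolding \<mu>_def Nu by auto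
  then have min: "\<mu> \<le> d i" if "i < n" for i using that by (auto simp: not_less[symmetric])
  have "\<exists>i<n. d i = \<mu>"
  proof (rule ccontr)
    assume "\<not> (\<exists>i<n. d i = \<mu>)"
    then have "{i\<in>{..<n}. \<mu> < d i} = {..<n}" using min by (force simp: less_le)
    then show False using \<open>card {i\<in>{..<n}. \<mu> < d i} < n\<close> by simp
  qed
  then obtain i0 where i0: "i0 < n" "d i0 = \<mu>" by blast
  have E: "spectral_sum n {i0} u (\<lambda>_. 1) \<in> spectrahedron n"
    unfolding spectrahedron_def
    using uc i0 trace_spectral_sum_orthonormal[OF orthonormal_subset[OF u], of "{i0}"] by (auto intro!: psd_spectral_sum)
  have "frob_inner N (spectral_sum n {i0} u (\<lambda>_. 1)) = \<mu>"
    using frob_inner_spectral_sum[of "{i0}" u n N "\<lambda>_. 1"] uc i0 Nc spectral_sum_eigvec[OF u, of i0 d] orthonormalD(3)[OF u, of i0]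
    by (simp add: Nu)
  then have le: "frob_inner N Xs \<le> \<mu>"
    using opt[OF E] frob_inner_diff_right[OF spectrahedronD(2)[OF E] Xsp(2) Nc] by simp
  \<comment> \<open>The \<open>x i\<close> are the diagonal entries of \<open>Xs\<close> in the
    eigenframe: a probability vector for which \<open>frob_inner N Xs\<close> is the mean of the
    eigenvalues.\<close>
  define x where "x = (\<lambda>i. u i \<bullet> (Xs *\<^sub>v u i))"
  have x0: "0 \<le> x i" if "i < n" for i unfolding x_def using Xsp(4) uc[OF that] .
  have x1: "(\<Sum>i<n. x i) = 1" using trace_frame[OF u Xsp(2)] Xsp(3) by (simp add: x_def)
  have "frob_inner N Xs = (\<Sum>i<n. d i * x i)"
    using frob_inner_comm[OF Nc Xsp(2)] frob_inner_spectral_sum[of "{..<n}" u n Xs d] uc Xsp(2) by (simp add: Nu x_def)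
  then have "(\<Sum>i<n. (d i - \<mu>) * x i) \<le> 0"
    using le x1 by (simp add: left_diff_distrib sum_subtractf flip: sum_distrib_left)
  moreover have nn: "0 \<le> (d i - \<mu>) * x i" if "i \<in> {..<n}" for i using min x0 that by simp
  ultimately have "(\<Sum>i<n. (d i - \<mu>) * x i) = 0" by (intro antisym sum_nonneg) auto
  then have xz: "(d i - \<mu>) * x i = 0" if "i < n" for i
    using nn that by (subst (asm) sum_nonneg_eq_0_iff) auto
  define I where "I = {i\<in>{..<n}. d i = \<mu>}"
  have I: "I \<subseteq> {..<n}" by (auto simp: I_def)
  have Xz: "Xs *\<^sub>v u i = 0\<^sub>v n" if "i \<in> {..<n} - I" for i
    using that xz[of i] Xs uc by (intro psd_zero_vec) (auto simp: I_def x_def spectrahedron_def)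
  have ge: "r \<le> card I" using frame_kernel_rank[OF u Xsp(1) I Xz] rk by simp
  have le': "card {i\<in>{..<n}. d i < \<nu>} \<le> r"
    using lambda_desc_spectral_sum(1)[OF u, of "n - r" d] rn unfolding \<nu>_def Nu by simp
  have \<mu>\<nu>: "\<mu> + \<delta> \<le> \<nu>" using gap(2) by (simp add: \<mu>_def \<nu>_def)
  have sub: "I \<subseteq> {i\<in>{..<n}. d i < \<nu>}" using \<mu>\<nu> gap(1) by (auto simp: I_def)
  then have "card I \<le> card {i\<in>{..<n}. d i < \<nu>}" by (intro card_mono) auto
  then have cI: "card I = r" using ge le' by simp
  \<comment> \<open>Every eigenvalue below \<open>\<nu>\<close> is already indexed by
    \<open>I\<close>, so those outside are at least \<open>\<nu>\<close>, a full gap above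
    \<open>\<mu>\<close>.\<close>
  have "I = {i\<in>{..<n}. d i < \<nu>}"
    by (rule card_subset_eq[OF _ sub]) (use \<open>card I \<le> card {i\<in>{..<n}. d i < \<nu>}\<close> cI le' in auto)
  then have "\<mu> + \<delta> \<le> d i" if "i \<in> {..<n} - I" for i using that \<mu>\<nu> by force
  then show ?thesis unfolding \<mu>_def[symmetric] using u Nu I cI Xz
    by (intro exI[of _ u] exI[of _ d] exI[of _ I]) (auto simp: I_def)
qed

text \<open>A sine-theta bound. \<open>X\<close> kills each \<open>a k\<close> with \<open>k\<close>
  outside \<open>K\<close>, so \<open>X - Xs\<close> acts there as \<open>- Xs\<close>, which
  stretches the component in the range of \<open>Xs\<close> by at least \<open>l\<close>. These
  components together are the mass of the range of \<open>Xs\<close> missed by the span of the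
  \<open>a k\<close> with \<open>k\<close> in \<open>K\<close>, and this mass dominates the overlap
  deficit of \<open>I\<close>, whose span contains that range.\<close>

lemma range_overlap_bound:
  assumes u: "orthonormal n {..<n} u" and Xs: "Xs \<in> spectrahedron n" and I: "I \<subseteq> {..<n}"
    and zero: "\<And>i. i \<in> {..<n} - I \<Longrightarrow> Xs *\<^sub>v u i = 0\<^sub>v n"
    and rk: "vec_space.rank n Xs = r" and r: "1 \<le> r" "r \<le> n"
    and a: "orthonormal n {..<n} a" and X: "X \<in> carrier_mat n n" and K: "K \<subseteq> {..<n}" and cK: "card K = r"
    and Xzero: "\<And>k. k \<in> {..<n} - K \<Longrightarrow> X *\<^sub>v a k = 0\<^sub>v n"
  shows "0 < lambda_desc r Xs"
    and "(lambda_desc r Xs)\<^sup>2 * (real r - (\<Sum>k\<in>K. \<Sum>i\<in>I. (u i \<bullet> a k)\<^sup>2)) \<le> (frob_norm (X - Xs))\<^sup>2"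
proof -
  note Xsp = spectrahedronD[OF Xs]
  obtain w e where w: "orthonormal n {..<n} w" and Xw: "Xs = spectral_sum n {..<n} w e"
    using spectral_decomposition[OF Xsp(1)] by blast
  have uc: "u i \<in> carrier_vec n" if "i < n" for i using orthonormalD(2)[OF u] that by simp
  have wc: "w i \<in> carrier_vec n" if "i < n" for i using orthonormalD(2)[OF w] that by simp
  have ac: "a i \<in> carrier_vec n" if "i < n" for i using orthonormalD(2)[OF a] that by simp
  have Xw_eig: "Xs *\<^sub>v w i = e i \<cdot>\<^sub>v w i" if "i < n" for i unfolding Xw using spectral_sum_eigvec[OF w] that by simp
  have e0: "0 \<le> e i" if "i < n" for i
    using Xsp(4)[OF wc[OF that]] Xw_eig[OF that] wc[OF that] orthonormalD(3)[OF w, of i] that by simp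
  define l where "l = lambda_desc r Xs"
  define J where "J = {i\<in>{..<n}. e i \<noteq> 0}"
  have cJ: "card J = r" using rank_spectral_sum[OF w, of e] rk unfolding J_def Xw by simp
  have lt: "card {i\<in>{..<n}. e i < l} \<le> n - r" and gt: "card {i\<in>{..<n}. l < e i} < r"
    using lambda_desc_spectral_sum[OF w r, of e] unfolding l_def Xw by auto
  have l0: "0 < l"
  proof (rule ccontr)
    assume "\<not> 0 < l"
    then have "J \<subseteq> {i\<in>{..<n}. l < e i}" using e0 by (force simp: J_def less_le)
    then have "card J \<le> card {i\<in>{..<n}. l < e i}" by (intro card_mono) auto
    then show False using gt cJ by simp
  qed
  \<comment> \<open>The \<open>n - r\<close> zero eigenvalues already exhaust the indices that may
    lie below \<open>l\<close>, so the nonzero ones are at least \<open>l\<close>.\<close>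
  have el: "l \<le> e i" if "i \<in> J" for i
  proof -
    have "card ({..<n} - J) = n - r" using cJ by (subst card_Diff_subset) (auto simp: J_def)
    moreover have "{..<n} - J \<subseteq> {i\<in>{..<n}. e i < l}" using l0 by (auto simp: J_def)
    ultimately have "{..<n} - J = {i\<in>{..<n}. e i < l}"
      using lt by (intro card_seteq) auto
    then show ?thesis using that by (force simp: J_def not_less[symmetric])
  qed
  show "0 < lambda_desc r Xs" using l0 by (simp add: l_def)
  have fin: "finite I" "finite J" "finite K" using I K finite_subset by (auto simp: J_def)
  have wu: "u i \<bullet> w j = 0" if "i \<in> {..<n} - I" "j \<in> J" for i j
  proof -
    have ij: "i < n" "j < n" using that by (auto simp: J_def)
    have "e j * (u i \<bullet> w j) = u i \<bullet> (Xs *\<^sub>v w j)"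
      using Xw_eig[OF ij(2)] uc[OF ij(1)] wc[OF ij(2)] by simp
    also have "\<dots> = w j \<bullet> (Xs *\<^sub>v u i)" using sym_bilinear[OF Xsp(1)] uc wc ij by blast
    also have "\<dots> = 0" using zero that wc ij by simp
    finally show ?thesis using that by (simp add: J_def)
  qed
  \<comment> \<open>\<open>z\<close> is the projection of \<open>v\<close> onto the span of the
    \<open>u i\<close> with \<open>i\<close> in \<open>I\<close>. The eigenvectors
    \<open>w j\<close> with \<open>j\<close> in \<open>J\<close> lie in that span, so their products
    with \<open>z\<close> and with \<open>v\<close> agree, and Bessel's inequality applies to
    \<open>z\<close>.\<close>
  have JI: "(\<Sum>j\<in>J. (w j \<bullet> v)\<^sup>2) \<le> (\<Sum>i\<in>I. (u i \<bullet> v)\<^sup>2)" if v: "v \<in> carrier_vec n" for v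
  proof -
    define z where "z = spectral_sum n I u (\<lambda>_. 1) *\<^sub>v v"
    have uI: "orthonormal n I u" using u I by (rule orthonormal_subset)
    have z: "z \<in> carrier_vec n" using spectral_sum_carrier v unfolding z_def by (metis mult_mat_vec_carrier)
    have wz: "w j \<bullet> z = w j \<bullet> v" if j: "j \<in> J" for j
    proof -
      have jn: "j < n" using j by (auto simp: J_def)
      have "w j \<bullet> z = (\<Sum>i\<in>I. 1 * (u i \<bullet> w j) * (u i \<bullet> v))"
        unfolding z_def using orthonormalD(2)[OF uI] v wc jn by (intro spectral_sum_bilinear) auto
      also have "\<dots> = (\<Sum>i<n. (u i \<bullet> w j) * (u i \<bullet> v))"
        using I wu j by (intro sum.mono_neutral_cong_left) auto
      also have "\<dots> = w j \<bullet> v" using v wc jn by (intro parseval_inner[OF u]) auto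
      finally show ?thesis .
    qed
    have uz: "u i \<bullet> z = u i \<bullet> v" if i: "i \<in> I" for i
    proof -
      have "u i \<bullet> z = (\<Sum>k\<in>I. 1 * (u k \<bullet> u i) * (u k \<bullet> v))"
        unfolding z_def using orthonormalD(2)[OF uI] v i by (intro spectral_sum_bilinear) auto
      also have "\<dots> = (\<Sum>k\<in>I. if k = i then u i \<bullet> v else 0)"
        using orthonormalD(4)[OF uI] i by (intro sum.cong refl) auto
      finally show ?thesis using i fin by simp
    qed
    have "z \<bullet> z = (\<Sum>i\<in>I. 1 * (u i \<bullet> z) * (u i \<bullet> v))"
      using orthonormalD(2)[OF uI] v z spectral_sum_bilinear[of I u n v z "\<lambda>_. 1"] unfolding z_def by simp
    also have "\<dots> = (\<Sum>i\<in>I. (u i \<bullet> v)\<^sup>2)" using uz by (simp add: power2_eq_square)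
    finally have zz: "z \<bullet> z = (\<Sum>i\<in>I. (u i \<bullet> v)\<^sup>2)" .
    have "(\<Sum>j\<in>J. (w j \<bullet> v)\<^sup>2) = (\<Sum>j\<in>J. (w j \<bullet> z)\<^sup>2)" using wz by simp
    also have "\<dots> \<le> z \<bullet> z" by (rule bessel_inequality[OF orthonormal_subset[OF w] z]) (auto simp: J_def)
    finally show ?thesis using zz by simp
  qed
  have XsA: "(Xs *\<^sub>v v) \<bullet> (Xs *\<^sub>v v) = (\<Sum>j<n. (e j)\<^sup>2 * (w j \<bullet> v)\<^sup>2)" if v: "v \<in> carrier_vec n" for v
  proof -
    have y: "Xs *\<^sub>v v \<in> carrier_vec n" using Xsp(2) v by simp
    have "(Xs *\<^sub>v v) \<bullet> (Xs *\<^sub>v v) = (\<Sum>j<n. (w j \<bullet> (Xs *\<^sub>v v))\<^sup>2)" using parseval[OF w y] by simp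
    also have "\<dots> = (\<Sum>j<n. (e j)\<^sup>2 * (w j \<bullet> v)\<^sup>2)"
    proof (rule sum.cong[OF refl])
      fix j assume "j \<in> {..<n}"
      then have j: "j < n" by simp
      have "w j \<bullet> (Xs *\<^sub>v v) = v \<bullet> (Xs *\<^sub>v w j)" using sym_bilinear[OF Xsp(1) v wc[OF j]] .
      also have "\<dots> = e j * (w j \<bullet> v)" using Xw_eig[OF j] wc[OF j] v scalar_prod_comm[OF v wc[OF j]] by simp
      finally show "(w j \<bullet> (Xs *\<^sub>v v))\<^sup>2 = (e j)\<^sup>2 * (w j \<bullet> v)\<^sup>2" by (simp add: power_mult_distrib)
    qed
    finally show ?thesis .
  qed
  have "l\<^sup>2 * (real r - (\<Sum>k\<in>K. \<Sum>i\<in>I. (u i \<bullet> a k)\<^sup>2)) \<le> l\<^sup>2 * (real r - (\<Sum>k\<in>K. \<Sum>j\<in>J. (w j \<bullet> a k)\<^sup>2))"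
    using JI ac K by (intro mult_left_mono diff_left_mono sum_mono) auto
  \<comment> \<open>Each \<open>w j\<close> has unit length, so its squared coefficients in the full
    frame \<open>a\<close> add up to 1. The total \<open>r\<close> is split at
    \<open>K\<close>.\<close>
  also have "real r - (\<Sum>k\<in>K. \<Sum>j\<in>J. (w j \<bullet> a k)\<^sup>2) = (\<Sum>k\<in>{..<n} - K. \<Sum>j\<in>J. (w j \<bullet> a k)\<^sup>2)"
  proof -
    have "(\<Sum>k<n. \<Sum>j\<in>J. (w j \<bullet> a k)\<^sup>2) = (\<Sum>j\<in>J. \<Sum>k<n. (w j \<bullet> a k)\<^sup>2)" by (rule sum.swap)
    also have "\<dots> = (\<Sum>j\<in>J. \<Sum>k<n. (a k \<bullet> w j)\<^sup>2)"
      using scalar_prod_comm[OF wc ac] by (intro sum.cong refl) (auto simp: J_def)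
    also have "\<dots> = (\<Sum>j\<in>J. 1)"
    proof (rule sum.cong[OF refl])
      fix j assume "j \<in> J"
      then have j: "j \<in> {..<n}" by (simp add: J_def)
      show "(\<Sum>k<n. (a k \<bullet> w j)\<^sup>2) = 1" using parseval[OF a] orthonormalD(2,3)[OF w j] by simp
    qed
    finally have "(\<Sum>k<n. \<Sum>j\<in>J. (w j \<bullet> a k)\<^sup>2) = real r" using cJ by simp
    then show ?thesis using sum.subset_diff[OF K, of "\<lambda>k. \<Sum>j\<in>J. (w j \<bullet> a k)\<^sup>2"] by simp
  qed
  also have "l\<^sup>2 * (\<Sum>k\<in>{..<n} - K. \<Sum>j\<in>J. (w j \<bullet> a k)\<^sup>2) \<le> (\<Sum>k\<in>{..<n} - K. ((X - Xs) *\<^sub>v a k) \<bullet> ((X - Xs) *\<^sub>v a k))"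
    unfolding sum_distrib_left
  proof (rule sum_mono)
    fix k assume k: "k \<in> {..<n} - K"
    then have kc: "a k \<in> carrier_vec n" using ac by simp
    have "(\<Sum>j\<in>J. l\<^sup>2 * (w j \<bullet> a k)\<^sup>2) \<le> (\<Sum>j\<in>J. (e j)\<^sup>2 * (w j \<bullet> a k)\<^sup>2)"
      using el l0 by (intro sum_mono mult_right_mono power_mono) auto
    also have "\<dots> \<le> (\<Sum>j<n. (e j)\<^sup>2 * (w j \<bullet> a k)\<^sup>2)"
      by (intro sum_mono2) (auto simp: J_def)
    also have "\<dots> = (Xs *\<^sub>v a k) \<bullet> (Xs *\<^sub>v a k)" using XsA[OF kc] by simp
    also have "\<dots> = ((X - Xs) *\<^sub>v a k) \<bullet> ((X - Xs) *\<^sub>v a k)"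
    proof -
      have "(X - Xs) *\<^sub>v a k = - (Xs *\<^sub>v a k)"
        using Xzero[OF k] X Xsp(2) kc by (simp add: minus_mult_distrib_mat_vec[of _ n n])
      then show ?thesis using Xsp(2) kc by simp
    qed
    finally show "(\<Sum>j\<in>J. l\<^sup>2 * (w j \<bullet> a k)\<^sup>2) \<le> ((X - Xs) *\<^sub>v a k) \<bullet> ((X - Xs) *\<^sub>v a k)" .
  qed
  also have "\<dots> \<le> (\<Sum>k<n. ((X - Xs) *\<^sub>v a k) \<bullet> ((X - Xs) *\<^sub>v a k))"
    using scalar_prod_self_nonneg by (intro sum_mono2) auto
  also have "\<dots> = (frob_norm (X - Xs))\<^sup>2"
    using X Xsp(2) by (intro frob_norm_square_frame[OF a, symmetric]) auto
  finally show "(lambda_desc r Xs)\<^sup>2 * (real r - (\<Sum>k\<in>K. \<Sum>i\<in>I. (u i \<bullet> a k)\<^sup>2)) \<le> (frob_norm (X - Xs))\<^sup>2"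
    by (simp add: l_def)
qed


text \<open>Suppose that more than \<open>r\<close> eigenvalues of \<open>Y\<close> exceed the
  threshold \<open>s\<close>. Then some \<open>z\<close> in the span of their eigenvectors is
  orthogonal to the \<open>a k\<close> with \<open>k\<close> in \<open>K\<close>, and its Rayleigh
  quotient for \<open>Y\<close> is at least \<open>s\<close>; the unit trace of the projection
  bounds the quotients over \<open>K\<close> from the other side. Eliminating \<open>s\<close> shows
  that the mean of \<open>g\<close> over these \<open>a k\<close> is at least its quotient at
  \<open>z\<close>. The gap excludes this, because the \<open>a k\<close> lie near the bottom
  eigenspace and \<open>z\<close> is almost orthogonal to it; \<open>num\<close> is exactly the
  negation of the resulting inequality.\<close>

lemma rank_proj_step_le:
  assumes N: "N = spectral_sum n {..<n} u d" and u: "orthonormal n {..<n} u" and I: "I \<subseteq> {..<n}" and cI: "card I = r"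
    and dI: "\<And>i. i \<in> I \<Longrightarrow> d i = \<mu>" and dgap: "\<And>i. i \<in> {..<n} - I \<Longrightarrow> \<mu> + \<delta> \<le> d i"
    and dup: "\<And>i. i < n \<Longrightarrow> d i \<le> \<mu> + M"
    and a: "orthonormal n {..<n} a" and X: "X = spectral_sum n {..<n} a c" and XS: "X \<in> spectrahedron n"
    and K: "K \<subseteq> {..<n}" and cK: "card K = r" and cz: "\<And>k. k \<in> {..<n} - K \<Longrightarrow> c k = 0"
    and g: "g \<in> sym_mats n" and err: "\<And>x. x \<in> carrier_vec n \<Longrightarrow> \<bar>x \<bullet> ((g - N) *\<^sub>v x)\<bar> \<le> \<kappa> * (x \<bullet> x)"
    and eta: "0 < \<eta>" and n: "0 < n" and \<delta>: "0 < \<delta>"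
    and E: "E = real r - (\<Sum>k\<in>K. \<Sum>i\<in>I. (u i \<bullet> a k)\<^sup>2)"
    and num: "M * E + 2 * real r * \<kappa> + real r * \<delta> * E < real r * \<delta>"
  shows "vec_space.rank n (spectrahedron_proj n (X - \<eta> \<cdot>\<^sub>m g)) \<le> r"
proof (rule ccontr)
  define Y where "Y = X - \<eta> \<cdot>\<^sub>m g"
  assume "\<not> ?thesis"
  then have neg: "r < vec_space.rank n (spectrahedron_proj n Y)" by (simp add: Y_def)
  note XSp = spectrahedronD[OF XS]
  have gc: "g \<in> carrier_mat n n" and Nc: "N \<in> carrier_mat n n"
    using g sym_mats_carrier N spectral_sum_carrier by auto
  have Ys: "Y \<in> sym_mats n" unfolding Y_def by (intro sym_mats_diff sym_mats_smult XSp g)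
  have uc: "u i \<in> carrier_vec n" if "i < n" for i using orthonormalD(2)[OF u] that by simp
  have ac: "a i \<in> carrier_vec n" if "i < n" for i using orthonormalD(2)[OF a] that by simp
  have Kn: "k < n" if "k \<in> K" for k using that K by auto
  have fin: "finite I" "finite K" using I K finite_subset by auto
  obtain b y s where b: "orthonormal n {..<n} b" and Yb: "Y = spectral_sum n {..<n} b y" and
    Pb: "spectrahedron_proj n Y = spectral_sum n {..<n} b (\<lambda>i. max (y i - s) 0)"
    using spectrahedron_proj_props(1)[OF Ys n] by blast
  define P where "P = spectrahedron_proj n Y"
  have PS: "P \<in> spectrahedron n" unfolding P_def by (rule spectrahedron_proj_props(2)[OF Ys n])
  note PSp = spectrahedronD[OF PS]
  have bc: "b i \<in> carrier_vec n" if "i < n" for i using orthonormalD(2)[OF b] that by simp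
  define J where "J = {i\<in>{..<n}. max (y i - s) 0 \<noteq> 0}"
  have "r < card J" using neg rank_spectral_sum[OF b, of "\<lambda>i. max (y i - s) 0"] unfolding Pb J_def by simp
  then have "\<exists>z\<in>carrier_vec n. z \<noteq> 0\<^sub>v n \<and> (\<forall>v\<in>set (map a (sorted_list_of_set K)). v \<bullet> z = 0) \<and>
      (\<forall>i\<in>{..<n} - J. b i \<bullet> z = 0)"
    by (intro exists_orthogonal_to_frame_part[OF b]) (use ac Kn fin cK in \<open>auto simp: J_def\<close>)
  then obtain z where z: "z \<in> carrier_vec n" "z \<noteq> 0\<^sub>v n" and
    zK: "\<And>k. k \<in> K \<Longrightarrow> a k \<bullet> z = 0" and zJ: "\<And>i. i \<in> {..<n} - J \<Longrightarrow> b i \<bullet> z = 0"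
    using fin by auto
  have zpos: "0 < z \<bullet> z" using z by (rule scalar_prod_self_pos)
  have Yq: "x \<bullet> (Y *\<^sub>v x) = x \<bullet> (X *\<^sub>v x) - \<eta> * (x \<bullet> (g *\<^sub>v x))" if "x \<in> carrier_vec n" for x
    unfolding Y_def using that XSp(2) gc
    by (simp add: mult_diff_mat_vec[of _ n] mult_smult_mat_vec[of _ n])
  have "s * (z \<bullet> z) = (\<Sum>i<n. s * (b i \<bullet> z)\<^sup>2)" using parseval[OF b z(1)] by (simp flip: sum_distrib_left)
  also have "\<dots> \<le> (\<Sum>i<n. y i * (b i \<bullet> z)\<^sup>2)"
  proof (rule sum_mono)
    fix i assume i: "i \<in> {..<n}"
    show "s * (b i \<bullet> z)\<^sup>2 \<le> y i * (b i \<bullet> z)\<^sup>2"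
    proof (cases "i \<in> J")
      case True
      then have "s \<le> y i" by (auto simp: J_def max_def split: if_splits)
      then show ?thesis by (intro mult_right_mono) auto
    qed (use zJ i in auto)
  qed
  also have "\<dots> = z \<bullet> (Y *\<^sub>v z)" unfolding Yb using bc z(1) by (intro spectral_sum_quad[symmetric]) auto
  also have "\<dots> = - \<eta> * (z \<bullet> (g *\<^sub>v z))"
  proof -
    have "z \<bullet> (X *\<^sub>v z) = (\<Sum>k<n. c k * (a k \<bullet> z)\<^sup>2)" unfolding X using ac z(1) by (intro spectral_sum_quad) auto
    also have "\<dots> = 0" using cz zK by (intro sum.neutral) (metis DiffI mult_zero_left mult_zero_right zero_power2)
    finally show ?thesis using Yq[OF z(1)] by simp
  qed
  finally have sz: "s * (z \<bullet> z) \<le> - \<eta> * (z \<bullet> (g *\<^sub>v z))" .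
  \<comment> \<open>In quadratic form the projection dominates \<open>Y\<close> minus
    \<open>s\<close> times the identity, and its partial trace over \<open>K\<close> is at most 1.
    The contribution of \<open>X\<close> on the left is also 1, so the constants cancel and a
    relation between \<open>\<eta>\<close> and \<open>s\<close> remains.\<close>
  have "1 - \<eta> * (\<Sum>k\<in>K. a k \<bullet> (g *\<^sub>v a k)) - s * r \<le> 1"
  proof -
    have "sum c {..<n} = 1" using XSp(3) trace_spectral_sum_orthonormal[OF a, of c] by (simp add: X)
    then have "sum c K = 1" using sum.mono_neutral_right[of "{..<n}" K c] K cz by simp
    moreover have "a k \<bullet> (X *\<^sub>v a k) = c k" if "k \<in> K" for k
      unfolding X using spectral_sum_eigvec[OF a, of k c] orthonormalD(3)[OF a, of k] ac Kn[OF that] by simp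
    ultimately have "1 - \<eta> * (\<Sum>k\<in>K. a k \<bullet> (g *\<^sub>v a k)) - s * r = (\<Sum>k\<in>K. a k \<bullet> (Y *\<^sub>v a k) - s)"
      using Yq ac Kn cK by (simp add: sum_subtractf sum_distrib_left)
    also have "\<dots> \<le> (\<Sum>k\<in>K. a k \<bullet> (P *\<^sub>v a k))"
    proof (rule sum_mono)
      fix k assume "k \<in> K"
      then have k: "a k \<in> carrier_vec n" "k \<in> {..<n}" using ac Kn by auto
      have "a k \<bullet> (Y *\<^sub>v a k) - s = (\<Sum>i<n. (y i - s) * (b i \<bullet> a k)\<^sup>2)"
        unfolding Yb using parseval[OF b k(1)] orthonormalD(3)[OF a k(2)] bc k(1)
        by (subst spectral_sum_quad) (auto simp: left_diff_distrib sum_subtractf simp flip: sum_distrib_left)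
      also have "\<dots> \<le> (\<Sum>i<n. max (y i - s) 0 * (b i \<bullet> a k)\<^sup>2)"
        by (intro sum_mono mult_right_mono) auto
      also have "\<dots> = a k \<bullet> (P *\<^sub>v a k)"
        unfolding P_def Pb using bc k by (intro spectral_sum_quad[symmetric]) auto
      finally show "a k \<bullet> (Y *\<^sub>v a k) - s \<le> a k \<bullet> (P *\<^sub>v a k)" .
    qed
    also have "\<dots> \<le> (\<Sum>k<n. a k \<bullet> (P *\<^sub>v a k))"
      using K PSp(4) ac by (intro sum_mono2) auto
    also have "\<dots> = 1" using trace_frame[OF a PSp(2)] PSp(3) by simp
    finally show ?thesis .
  qed
  then have "- \<eta> * (\<Sum>k\<in>K. a k \<bullet> (g *\<^sub>v a k)) * (z \<bullet> z) \<le> s * r * (z \<bullet> z)"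
    using zpos by (intro mult_right_mono) auto
  also have "\<dots> \<le> r * (- \<eta> * (z \<bullet> (g *\<^sub>v z)))"
    using mult_left_mono[OF sz, of "real r"] by (simp add: mult_ac)
  finally have "\<eta> * (r * (z \<bullet> (g *\<^sub>v z))) \<le> \<eta> * ((\<Sum>k\<in>K. a k \<bullet> (g *\<^sub>v a k)) * (z \<bullet> z))"
    by (simp add: mult_ac)
  then have key: "r * (z \<bullet> (g *\<^sub>v z)) \<le> (\<Sum>k\<in>K. a k \<bullet> (g *\<^sub>v a k)) * (z \<bullet> z)"
    using eta by simp
  have gq: "\<bar>x \<bullet> (g *\<^sub>v x) - x \<bullet> (N *\<^sub>v x)\<bar> \<le> \<kappa> * (x \<bullet> x)" if "x \<in> carrier_vec n" for x
    using err[OF that] mult_diff_mat_vec[OF gc Nc that that] by simp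
  have Nq: "x \<bullet> (N *\<^sub>v x) = (\<Sum>i<n. d i * (u i \<bullet> x)\<^sup>2)" if "x \<in> carrier_vec n" for x
    unfolding N using uc that by (intro spectral_sum_quad) auto
  have split: "(\<Sum>i<n. h i) = (\<Sum>i\<in>I. h i) + (\<Sum>i\<in>{..<n} - I. h i)" for h :: "nat \<Rightarrow> real"
    using sum.subset_diff[OF I, of h] by simp
  have Nlow: "\<mu> * (x \<bullet> x) + \<delta> * (x \<bullet> x - (\<Sum>i\<in>I. (u i \<bullet> x)\<^sup>2)) \<le> x \<bullet> (N *\<^sub>v x)"
    and Nup: "x \<bullet> (N *\<^sub>v x) \<le> \<mu> * (x \<bullet> x) + M * (x \<bullet> x - (\<Sum>i\<in>I. (u i \<bullet> x)\<^sup>2))"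
    if x: "x \<in> carrier_vec n" for x
  proof -
    have xx: "x \<bullet> x = (\<Sum>i\<in>I. (u i \<bullet> x)\<^sup>2) + (\<Sum>i\<in>{..<n} - I. (u i \<bullet> x)\<^sup>2)"
      using parseval[OF u x] split by simp
    have NN: "x \<bullet> (N *\<^sub>v x) = \<mu> * (\<Sum>i\<in>I. (u i \<bullet> x)\<^sup>2) + (\<Sum>i\<in>{..<n} - I. d i * (u i \<bullet> x)\<^sup>2)"
      unfolding Nq[OF x] split using dI by (simp add: sum_distrib_left)
    have "(\<Sum>i\<in>{..<n} - I. (\<mu> + \<delta>) * (u i \<bullet> x)\<^sup>2) \<le> (\<Sum>i\<in>{..<n} - I. d i * (u i \<bullet> x)\<^sup>2)"
      using dgap by (intro sum_mono mult_right_mono) auto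
    then show "\<mu> * (x \<bullet> x) + \<delta> * (x \<bullet> x - (\<Sum>i\<in>I. (u i \<bullet> x)\<^sup>2)) \<le> x \<bullet> (N *\<^sub>v x)"
      unfolding NN xx by (simp add: algebra_simps sum.distrib sum_distrib_left)
    have "(\<Sum>i\<in>{..<n} - I. d i * (u i \<bullet> x)\<^sup>2) \<le> (\<Sum>i\<in>{..<n} - I. (\<mu> + M) * (u i \<bullet> x)\<^sup>2)"
      using dup by (intro sum_mono mult_right_mono) auto
    then show "x \<bullet> (N *\<^sub>v x) \<le> \<mu> * (x \<bullet> x) + M * (x \<bullet> x - (\<Sum>i\<in>I. (u i \<bullet> x)\<^sup>2))"
      unfolding NN xx by (simp add: algebra_simps sum.distrib sum_distrib_left)
  qed
  have "(\<Sum>k\<in>K. a k \<bullet> (g *\<^sub>v a k)) \<le> (\<Sum>k\<in>K. \<mu> + M * (1 - (\<Sum>i\<in>I. (u i \<bullet> a k)\<^sup>2)) + \<kappa>)"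
  proof (rule sum_mono)
    fix k assume "k \<in> K"
    then have k: "k \<in> {..<n}" using Kn by auto
    show "a k \<bullet> (g *\<^sub>v a k) \<le> \<mu> + M * (1 - (\<Sum>i\<in>I. (u i \<bullet> a k)\<^sup>2)) + \<kappa>"
      using Nup[OF orthonormalD(2)[OF a k]] gq[OF orthonormalD(2)[OF a k]] orthonormalD(3)[OF a k] by simp
  qed
  also have "\<dots> = r * \<mu> + M * E + r * \<kappa>"
    unfolding E using cK by (simp add: sum.distrib sum_subtractf algebra_simps sum_distrib_left)
  finally have up: "(\<Sum>k\<in>K. a k \<bullet> (g *\<^sub>v a k)) \<le> r * \<mu> + M * E + r * \<kappa>" .
  \<comment> \<open>\<open>z\<close> is orthogonal to the \<open>a k\<close> with \<open>k\<close>
    in \<open>K\<close>, so \<open>u i\<close> meets it only through its coefficients outside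
    \<open>K\<close>. Over \<open>I\<close> the squares of these add up to \<open>card I\<close>
    minus the overlap, which is \<open>E\<close>.\<close>
  have small: "(\<Sum>i\<in>I. (u i \<bullet> z)\<^sup>2) \<le> E * (z \<bullet> z)"
  proof -
    have "(u i \<bullet> z)\<^sup>2 \<le> (\<Sum>k\<in>{..<n} - K. (u i \<bullet> a k)\<^sup>2) * (z \<bullet> z)" if i: "i \<in> I" for i
    proof -
      have uic: "u i \<in> carrier_vec n" using uc i I by auto
      have "u i \<bullet> z = (\<Sum>k<n. (a k \<bullet> u i) * (a k \<bullet> z))" using parseval_inner[OF a uic z(1)] by simp
      also have "\<dots> = (\<Sum>k\<in>{..<n} - K. (a k \<bullet> u i) * (a k \<bullet> z))"
        using zK K by (intro sum.mono_neutral_right) auto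
      finally have "(u i \<bullet> z)\<^sup>2 = (\<Sum>k\<in>{..<n} - K. (a k \<bullet> u i) * (a k \<bullet> z))\<^sup>2" by simp
      also have "\<dots> \<le> (\<Sum>k\<in>{..<n} - K. (a k \<bullet> u i)\<^sup>2) * (\<Sum>k\<in>{..<n} - K. (a k \<bullet> z)\<^sup>2)"
        by (rule Cauchy_Schwarz_ineq_sum)
      also have "\<dots> \<le> (\<Sum>k\<in>{..<n} - K. (a k \<bullet> u i)\<^sup>2) * (z \<bullet> z)"
        using bessel_inequality[OF orthonormal_subset[OF a] z(1), of "{..<n} - K"]
        by (intro mult_left_mono sum_nonneg) auto
      also have "(\<Sum>k\<in>{..<n} - K. (a k \<bullet> u i)\<^sup>2) = (\<Sum>k\<in>{..<n} - K. (u i \<bullet> a k)\<^sup>2)"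
        using scalar_prod_comm[OF uic ac] by (intro sum.cong) auto
      finally show ?thesis .
    qed
    then have "(\<Sum>i\<in>I. (u i \<bullet> z)\<^sup>2) \<le> (\<Sum>i\<in>I. \<Sum>k\<in>{..<n} - K. (u i \<bullet> a k)\<^sup>2) * (z \<bullet> z)"
      unfolding sum_distrib_right[of _ I] by (rule sum_mono)
    also have "(\<Sum>i\<in>I. \<Sum>k\<in>{..<n} - K. (u i \<bullet> a k)\<^sup>2) = E"
    proof -
      have "(\<Sum>i\<in>I. \<Sum>k<n. (u i \<bullet> a k)\<^sup>2) = (\<Sum>i\<in>I. 1)"
      proof (rule sum.cong[OF refl])
        fix i assume "i \<in> I"
        then have i: "i \<in> {..<n}" using I by auto
        have "(\<Sum>k<n. (u i \<bullet> a k)\<^sup>2) = (\<Sum>k<n. (a k \<bullet> u i)\<^sup>2)"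
          using scalar_prod_comm[OF uc ac] i by (intro sum.cong) auto
        then show "(\<Sum>k<n. (u i \<bullet> a k)\<^sup>2) = 1" using parseval[OF a] orthonormalD(2,3)[OF u i] by simp
      qed
      moreover have "(\<Sum>i\<in>I. \<Sum>k<n. (u i \<bullet> a k)\<^sup>2) =
          (\<Sum>i\<in>I. \<Sum>k\<in>{..<n} - K. (u i \<bullet> a k)\<^sup>2) + (\<Sum>i\<in>I. \<Sum>k\<in>K. (u i \<bullet> a k)\<^sup>2)"
        by (subst sum.distrib[symmetric]) (intro sum.cong refl, use sum.subset_diff[OF K] in auto)
      moreover have "(\<Sum>i\<in>I. \<Sum>k\<in>K. (u i \<bullet> a k)\<^sup>2) = (\<Sum>k\<in>K. \<Sum>i\<in>I. (u i \<bullet> a k)\<^sup>2)"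
        by (rule sum.swap)
      ultimately show ?thesis unfolding E using cI by simp
    qed
    finally show ?thesis .
  qed
  have "\<mu> * (z \<bullet> z) + \<delta> * (z \<bullet> z - E * (z \<bullet> z)) - \<kappa> * (z \<bullet> z) \<le> z \<bullet> (g *\<^sub>v z)"
  proof -
    have "\<delta> * (\<Sum>i\<in>I. (u i \<bullet> z)\<^sup>2) \<le> \<delta> * (E * (z \<bullet> z))"
      using small \<delta> by (intro mult_left_mono) auto
    then show ?thesis using Nlow[OF z(1)] gq[OF z(1)]
      by (simp add: right_diff_distrib abs_le_iff)
  qed
  then have "r * ((\<mu> + \<delta> * (1 - E) - \<kappa>) * (z \<bullet> z)) \<le> r * (z \<bullet> (g *\<^sub>v z))"
    by (intro mult_left_mono) (auto simp: algebra_simps)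
  also have "\<dots> \<le> (r * \<mu> + M * E + r * \<kappa>) * (z \<bullet> z)"
    using key mult_right_mono[OF up less_imp_le[OF zpos]] by linarith
  finally have "(r * (\<mu> + \<delta> * (1 - E) - \<kappa>)) * (z \<bullet> z) \<le> (r * \<mu> + M * E + r * \<kappa>) * (z \<bullet> z)"
    by (simp add: mult.assoc)
  then have "r * (\<mu> + \<delta> * (1 - E) - \<kappa>) \<le> r * \<mu> + M * E + r * \<kappa>"
    using zpos by simp
  then show False using num by (simp add: algebra_simps)
qed

section \<open>Measurability and finite nets\<close>

lemma space_sym_borel [simp]: "space (sym_borel n) = sym_mats n"
  by (simp add: sym_borel_def)

lemma measurable_sym_borel_entry:
  assumes "i < n" "j < n"
  shows "(\<lambda>A. A $$ (i, j)) \<in> borel_measurable (sym_borel n)"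
proof -
  have "(\<lambda>A. restrict (\<lambda>ij. A $$ ij) ({..<n} \<times> {..<n})) \<in>
      measurable (sym_borel n) (Pi\<^sub>M ({..<n} \<times> {..<n}) (\<lambda>_. borel :: real measure))"
    unfolding sym_borel_def by (rule measurable_vimage_algebra1) (auto simp: space_PiM)
  then have "(\<lambda>A. restrict (\<lambda>ij. A $$ ij) ({..<n} \<times> {..<n}) (i, j)) \<in> borel_measurable (sym_borel n)"
    by (rule measurable_compose) (use assms in \<open>auto intro!: measurable_component_singleton\<close>)
  then show ?thesis using assms by simp
qed

lemma measurable_sym_borelI:
  assumes "\<And>x. x \<in> space M \<Longrightarrow> F x \<in> sym_mats n"
    and "\<And>i j. i < n \<Longrightarrow> j < n \<Longrightarrow> (\<lambda>x. F x $$ (i, j)) \<in> borel_measurable M"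
  shows "F \<in> measurable M (sym_borel n)"
  unfolding sym_borel_def
proof (rule measurable_vimage_algebra2)
  show "(\<lambda>x. restrict (\<lambda>ij. F x $$ ij) ({..<n} \<times> {..<n})) \<in>
      measurable M (Pi\<^sub>M ({..<n} \<times> {..<n}) (\<lambda>_. borel :: real measure))"
    by (rule measurable_restrict) (use assms(2) in auto)
qed (use assms in auto)

text \<open>Openness relative to the symmetric matrices: the link between estimates in the Frobenius
  norm and the sigma-algebra \<open>sym_borel\<close>, which is generated by the entries.\<close>

definition frob_open :: "nat \<Rightarrow> real mat set \<Rightarrow> bool" where
  "frob_open n U \<longleftrightarrow> U \<subseteq> sym_mats n \<and>
     (\<forall>A\<in>U. \<exists>e>0. \<forall>B\<in>sym_mats n. frob_norm (B - A) < e \<longrightarrow> B \<in> U)"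

text \<open>\<open>T\<close> embeds a matrix into the functions on all index pairs, where product
  and Borel sigma-algebra agree, and \<open>S\<close> sends every such function back to a symmetric
  matrix. Since \<open>S\<close> is defined everywhere and continuous, the functions it maps into
  \<open>U\<close> form an open set, and \<open>T\<close> pulls this set back to
  \<open>U\<close>.\<close>

lemma frob_open_measurable:
  assumes U: "frob_open n U"
  shows "U \<in> sets (sym_borel n)"
proof -
  define S where "S = (\<lambda>x :: nat \<times> nat \<Rightarrow> real. mat n n (\<lambda>(i, j). (x (i, j) + x (j, i)) / 2))"
  have S: "S x \<in> sym_mats n" for x unfolding S_def by (intro sym_matsI) auto
  define T where "T = (\<lambda>A :: real mat. \<lambda>ij. if ij \<in> {..<n} \<times> {..<n} then A $$ ij else 0)"
  have ST: "S (T A) = A" if A: "A \<in> sym_mats n" for A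
    using sym_mats_carrier[OF A] sym_mats_index[OF A] by (intro eq_matI) (auto simp: S_def T_def)
  have T: "T \<in> measurable (sym_borel n) borel"
  proof -
    have "T \<in> measurable (sym_borel n) (Pi\<^sub>M UNIV (\<lambda>_. borel))"
    proof (rule measurable_PiM_single')
      fix ij :: "nat \<times> nat"
      show "(\<lambda>A. T A ij) \<in> borel_measurable (sym_borel n)"
        using measurable_sym_borel_entry[of "fst ij" n "snd ij"]
        by (cases "ij \<in> {..<n} \<times> {..<n}") (auto simp: T_def)
    qed auto
    then show ?thesis using measurable_cong_sets[OF refl sets_PiM_equal_borel] by blast
  qed
  have "open {x. S x \<in> U}"
  proof (subst open_subopen, intro ballI)
    fix x assume "x \<in> {x. S x \<in> U}"
    then obtain e where e: "e > 0" "\<And>B. B \<in> sym_mats n \<Longrightarrow> frob_norm (B - S x) < e \<Longrightarrow> B \<in> U"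
      using U unfolding frob_open_def by auto
    define q where "q = (\<lambda>y. frob_norm (S y - S x))"
    have "q = (\<lambda>y. sqrt (\<Sum>i<n. \<Sum>j<n. ((y (i, j) + y (j, i)) / 2 - (x (i, j) + x (j, i)) / 2) *
        ((y (i, j) + y (j, i)) / 2 - (x (i, j) + x (j, i)) / 2)))"
      by (simp add: q_def frob_norm_def frob_inner_def S_def)
    then have "continuous_on UNIV q"
      by (simp only:) (auto intro!: continuous_intros continuous_on_product_coordinates)
    then have "open {y. q y < e}"
      by (intro open_Collect_less) auto
    moreover have "frob_norm (S x - S x) = 0" by (simp add: frob_norm_def frob_inner_def)
    ultimately show "\<exists>T. open T \<and> x \<in> T \<and> T \<subseteq> {x. S x \<in> U}"
      using e S by (intro exI[of _ "{y. q y < e}"]) (auto simp: q_def)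
  qed
  then have "T -` {x. S x \<in> U} \<inter> space (sym_borel n) \<in> sets (sym_borel n)"
    by (intro measurable_sets[OF T]) auto
  also have "T -` {x. S x \<in> U} \<inter> space (sym_borel n) = U"
    using U ST by (auto simp: frob_open_def)
  finally show ?thesis .
qed

lemma frob_continuous_measurable:
  fixes F :: "real mat \<Rightarrow> real"
  assumes cont: "\<And>A e. A \<in> sym_mats n \<Longrightarrow> 0 < e \<Longrightarrow>
    \<exists>d>0. \<forall>B\<in>sym_mats n. frob_norm (B - A) < d \<longrightarrow> \<bar>F B - F A\<bar> < e"
  shows "F \<in> borel_measurable (sym_borel n)"
proof (rule borel_measurableI_greater)
  fix y
  have "frob_open n {A \<in> sym_mats n. y < F A}"
    unfolding frob_open_def
  proof (intro conjI ballI)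
    fix A assume "A \<in> {A \<in> sym_mats n. y < F A}"
    then have "A \<in> sym_mats n" "0 < F A - y" by auto
    then obtain d where "d > 0" "\<forall>B\<in>sym_mats n. frob_norm (B - A) < d \<longrightarrow> \<bar>F B - F A\<bar> < F A - y"
      using cont by blast
    then show "\<exists>e>0. \<forall>B\<in>sym_mats n. frob_norm (B - A) < e \<longrightarrow> B \<in> {A \<in> sym_mats n. y < F A}"
      by (intro exI[of _ d]) (auto simp: abs_less_iff)
  qed auto
  then show "{x \<in> space (sym_borel n). y < F x} \<in> sets (sym_borel n)"
    using frob_open_measurable by simp
qed

lemma frob_lipschitz_measurable:
  fixes F :: "real mat \<Rightarrow> real"
  assumes "\<And>A B. A \<in> sym_mats n \<Longrightarrow> B \<in> sym_mats n \<Longrightarrow> \<bar>F B - F A\<bar> \<le> frob_norm (B - A)"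
  shows "F \<in> borel_measurable (sym_borel n)"
  by (rule frob_continuous_measurable) (metis assms le_less_trans)

lemma abs_entry_le_frob_norm:
  assumes "A \<in> carrier_mat n n" "i < n" "j < n"
  shows "\<bar>A $$ (i, j)\<bar> \<le> frob_norm A"
  unfolding frob_norm_L2[OF assms(1)]
  using member_le_L2_set[of "{..<n} \<times> {..<n}" "(i, j)" "\<lambda>ij. \<bar>A $$ ij\<bar>"] assms
  by (simp add: L2_set_def)

text \<open>Nonexpansiveness makes every entry of the projection a Lipschitz function.\<close>

lemma measurable_spectrahedron_proj:
  assumes n: "0 < n"
  shows "spectrahedron_proj n \<in> measurable (sym_borel n) (sym_borel n)"
proof (rule measurable_sym_borelI)
  have P: "spectrahedron_proj n A \<in> sym_mats n" if "A \<in> sym_mats n" for A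
    using spectrahedron_proj_props(2)[OF that n] spectrahedronD by blast
  then show "spectrahedron_proj n x \<in> sym_mats n" if "x \<in> space (sym_borel n)" for x using that by simp
  fix i j assume ij: "i < n" "j < n"
  show "(\<lambda>x. spectrahedron_proj n x $$ (i, j)) \<in> borel_measurable (sym_borel n)"
  proof (rule frob_lipschitz_measurable)
    fix A B assume AB: "A \<in> sym_mats n" "B \<in> sym_mats n"
    have "\<bar>(spectrahedron_proj n B - spectrahedron_proj n A) $$ (i, j)\<bar> \<le> frob_norm (spectrahedron_proj n B - spectrahedron_proj n A)"
      using P AB sym_mats_carrier ij by (intro abs_entry_le_frob_norm) auto
    also have "\<dots> \<le> frob_norm (B - A)" using AB n by (intro spectrahedron_proj_nonexpansive) auto
    finally show "\<bar>spectrahedron_proj n B $$ (i, j) - spectrahedron_proj n A $$ (i, j)\<bar> \<le> frob_norm (B - A)"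
      using sym_mats_carrier[OF P[OF AB(1)]] sym_mats_carrier[OF P[OF AB(2)]] ij by simp
  qed
qed

lemma measurable_frob_dist:
  assumes C: "C \<in> sym_mats n"
  shows "(\<lambda>A. frob_norm (A - C)) \<in> borel_measurable (sym_borel n)"
proof (rule frob_lipschitz_measurable)
  fix A B assume "A \<in> sym_mats n" "B \<in> sym_mats n"
  then have c: "A \<in> carrier_mat n n" "B \<in> carrier_mat n n" "C \<in> carrier_mat n n"
    using C sym_mats_carrier by auto
  show "\<bar>frob_norm (B - C) - frob_norm (A - C)\<bar> \<le> frob_norm (B - A)"
    using frob_norm_diff_triangle[OF c(2,1,3)] frob_norm_diff_triangle[OF c]
      frob_norm_minus_commute[OF c(1,2)] by linarith
qed

text \<open>Lower semicontinuity of the rank. Let \<open>c\<close> be the smallest nonzero absolute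
  eigenvalue of \<open>A\<close>. If \<open>B\<close> is closer to \<open>A\<close> than
  \<open>c\<close> and has rank at most \<open>r\<close>, some nonzero \<open>z\<close> in the range
  of \<open>A\<close> is killed by \<open>B\<close>. Then \<open>A *\<^sub>v z\<close> is at least
  \<open>c\<close> times as long as \<open>z\<close>, yet it equals
  \<open>(A - B) *\<^sub>v z\<close>, which is shorter.\<close>

lemma frob_open_rank_greater: "frob_open n {A \<in> sym_mats n. r < vec_space.rank n A}"
  unfolding frob_open_def
proof (intro conjI ballI)
  fix A assume "A \<in> {A \<in> sym_mats n. r < vec_space.rank n A}"
  then have A: "A \<in> sym_mats n" and rk: "r < vec_space.rank n A" by auto
  obtain w e where w: "orthonormal n {..<n} w" and Aw: "A = spectral_sum n {..<n} w e"
    using spectral_decomposition[OF A] by blast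
  have wc: "w i \<in> carrier_vec n" if "i < n" for i using orthonormalD(2)[OF w] that by simp
  define J where "J = {i\<in>{..<n}. e i \<noteq> 0}"
  have cJ: "r < card J" using rk rank_spectral_sum[OF w, of e] by (simp add: J_def Aw)
  then have "J \<noteq> {}" by auto
  have fJ: "finite J" by (simp add: J_def)
  define c where "c = Min ((\<lambda>i. \<bar>e i\<bar>) ` J)"
  have c0: "0 < c" unfolding c_def using fJ \<open>J \<noteq> {}\<close> by (subst Min_gr_iff) (auto simp: J_def)
  have ce: "c \<le> \<bar>e i\<bar>" if "i \<in> J" for i unfolding c_def using fJ that by (intro Min_le) auto
  have "r < vec_space.rank n B" if B: "B \<in> sym_mats n" and d: "frob_norm (B - A) < c" for B
  proof (rule ccontr)
    assume neg: "\<not> r < vec_space.rank n B"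
    obtain b h where b: "orthonormal n {..<n} b" and Bb: "B = spectral_sum n {..<n} b h"
      using spectral_decomposition[OF B] by blast
    have bc: "b i \<in> carrier_vec n" if "i < n" for i using orthonormalD(2)[OF b] that by simp
    define H where "H = {i\<in>{..<n}. h i \<noteq> 0}"
    have cH: "card H \<le> r" using neg rank_spectral_sum[OF b, of h] by (simp add: H_def Bb)
    have fH: "finite H" by (simp add: H_def)
    have "\<exists>z\<in>carrier_vec n. z \<noteq> 0\<^sub>v n \<and> (\<forall>v\<in>set (map b (sorted_list_of_set H)). v \<bullet> z = 0) \<and>
        (\<forall>i\<in>{..<n} - J. w i \<bullet> z = 0)"
      by (rule exists_orthogonal_to_frame_part[OF w]) (use cH cJ bc in \<open>auto simp: J_def H_def\<close>)
    then obtain z where z: "z \<in> carrier_vec n" "z \<noteq> 0\<^sub>v n" and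
      zH: "\<And>i. i \<in> H \<Longrightarrow> b i \<bullet> z = 0" and zJ: "\<And>i. i \<in> {..<n} - J \<Longrightarrow> w i \<bullet> z = 0"
      using fH by auto
    have zz: "0 < z \<bullet> z" using z by (rule scalar_prod_self_pos)
    note cc = sym_mats_carrier[OF A] sym_mats_carrier[OF B]
    define y where "y = A *\<^sub>v z"
    have y: "y \<in> carrier_vec n" using cc z by (simp add: y_def)
    have yB: "y \<bullet> (B *\<^sub>v z) = 0"
    proof -
      have "y \<bullet> (B *\<^sub>v z) = (\<Sum>i<n. h i * (b i \<bullet> y) * (b i \<bullet> z))"
        unfolding Bb using bc y z by (intro spectral_sum_bilinear) auto
      also have "\<dots> = 0" using zH by (intro sum.neutral) (auto simp: H_def)
      finally show ?thesis .
    qed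
    have "c\<^sup>2 * (z \<bullet> z) = (\<Sum>i<n. c\<^sup>2 * (w i \<bullet> z)\<^sup>2)"
      using parseval[OF w z(1)] by (simp flip: sum_distrib_left)
    also have "\<dots> \<le> (\<Sum>i<n. (e i)\<^sup>2 * (w i \<bullet> z)\<^sup>2)"
    proof (rule sum_mono)
      fix i assume i: "i \<in> {..<n}"
      show "c\<^sup>2 * (w i \<bullet> z)\<^sup>2 \<le> (e i)\<^sup>2 * (w i \<bullet> z)\<^sup>2"
      proof (cases "i \<in> J")
        case True
        have "c\<^sup>2 \<le> \<bar>e i\<bar>\<^sup>2" using ce[OF True] c0 by (intro power_mono) auto
        then show ?thesis by (intro mult_right_mono) auto
      qed (use zJ i in auto)
    qed
    also have "\<dots> = (\<Sum>i<n. (w i \<bullet> y)\<^sup>2)"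
    proof (rule sum.cong[OF refl])
      fix i assume "i \<in> {..<n}"
      then have i: "i < n" by simp
      have "w i \<bullet> y = z \<bullet> (A *\<^sub>v w i)" unfolding y_def using sym_bilinear[OF A z(1) wc[OF i]] .
      also have "\<dots> = e i * (w i \<bullet> z)"
        using spectral_sum_eigvec[OF w, of i e] i wc[OF i] z(1) scalar_prod_comm[OF z(1) wc[OF i]] by (simp add: Aw)
      finally show "(e i)\<^sup>2 * (w i \<bullet> z)\<^sup>2 = (w i \<bullet> y)\<^sup>2" by (simp add: power_mult_distrib)
    qed
    also have "\<dots> = y \<bullet> y" using parseval[OF w y] .
    finally have low: "c\<^sup>2 * (z \<bullet> z) \<le> y \<bullet> y" .
    have "0 < c\<^sup>2 * (z \<bullet> z)" using c0 zz by simp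
    then have yy: "0 < y \<bullet> y" using low by linarith
    have "y \<bullet> y = y \<bullet> ((A - B) *\<^sub>v z)"
      using mult_diff_mat_vec[OF cc z(1) y] yB by (simp add: y_def)
    also have "\<dots> \<le> frob_norm (A - B) * (sqrt (y \<bullet> y) * sqrt (z \<bullet> z))"
      using abs_bilinear_le[of "A - B" n z y] cc z y by (simp add: abs_le_iff)
    also have "\<dots> < c * (sqrt (y \<bullet> y) * sqrt (z \<bullet> z))"
      using d frob_norm_minus_commute[OF cc] yy zz by (intro mult_strict_right_mono) auto
    finally have "sqrt (y \<bullet> y) * sqrt (y \<bullet> y) < (c * sqrt (z \<bullet> z)) * sqrt (y \<bullet> y)"
      using yy by (simp add: mult_ac)
    then have "sqrt (y \<bullet> y) < c * sqrt (z \<bullet> z)"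
      by (rule mult_right_less_imp_less) (use yy in auto)
    moreover have "c * sqrt (z \<bullet> z) \<le> sqrt (y \<bullet> y)"
      using real_sqrt_le_mono[OF low] c0 by (simp add: real_sqrt_mult)
    ultimately show False by simp
  qed
  then show "\<exists>e>0. \<forall>B\<in>sym_mats n. frob_norm (B - A) < e \<longrightarrow> B \<in> {A \<in> sym_mats n. r < vec_space.rank n A}"
    using c0 by blast
qed auto

lemma rank_le_measurable:
  "Measurable.pred (sym_borel n) (\<lambda>A. vec_space.rank n A \<le> r)"
proof -
  have "sym_mats n - {A \<in> sym_mats n. r < vec_space.rank n A} \<in> sets (sym_borel n)"
    using frob_open_measurable[OF frob_open_rank_greater] sets.top[of "sym_borel n"] by auto
  also have "sym_mats n - {A \<in> sym_mats n. r < vec_space.rank n A} = {A \<in> space (sym_borel n). vec_space.rank n A \<le> r}"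
    by auto
  finally show ?thesis by (simp add: pred_def)
qed

text \<open>A gradient at every point makes \<open>f\<close> continuous, by Cauchy-Schwarz on the
  linear term.\<close>

lemma gradient_measurable:
  assumes D: "\<And>X. X \<in> sym_mats n \<Longrightarrow> has_gradient_sym n f (grad X) X"
  shows "f \<in> borel_measurable (sym_borel n)"
proof (rule frob_continuous_measurable)
  fix A and e :: real assume A: "A \<in> sym_mats n" and e: "0 < e"
  have "\<forall>e>0. \<exists>d>0. \<forall>Y\<in>sym_mats n. frob_norm (Y - A) < d \<longrightarrow>
      \<bar>f Y - f A - frob_inner (grad A) (Y - A)\<bar> \<le> e * frob_norm (Y - A)"
    using D[OF A] by (simp add: has_gradient_sym_def)
  from this[rule_format, of 1] obtain d where d: "d > 0" and
    dB: "\<And>B. B \<in> sym_mats n \<Longrightarrow> frob_norm (B - A) < d \<Longrightarrow>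
      \<bar>f B - f A - frob_inner (grad A) (B - A)\<bar> \<le> 1 * frob_norm (B - A)"
    by auto
  have gA: "grad A \<in> carrier_mat n n" using D[OF A] sym_mats_carrier by (auto simp: has_gradient_sym_def)
  define N where "N = frob_norm (grad A) + 1"
  have N: "0 < N" by (simp add: N_def add_nonneg_pos)
  have "\<bar>f B - f A\<bar> < e" if B: "B \<in> sym_mats n" and l: "frob_norm (B - A) < min d (e / N)" for B
  proof -
    have "\<bar>frob_inner (grad A) (B - A)\<bar> \<le> frob_norm (grad A) * frob_norm (B - A)"
      using gA sym_mats_carrier[OF A] by (intro frob_cauchy_schwarz) auto
    then have "\<bar>f B - f A\<bar> \<le> N * frob_norm (B - A)"
      using dB[OF B] l by (simp add: N_def algebra_simps)
    also have "\<dots> < e" using l N by (simp add: field_simps)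
    finally show ?thesis .
  qed
  then show "\<exists>d>0. \<forall>B\<in>sym_mats n. frob_norm (B - A) < d \<longrightarrow> \<bar>f B - f A\<bar> < e"
    using d N e by (intro exI[of _ "min d (e / N)"]) auto
qed

text \<open>The complement is open: a member \<open>B\<close> within half the distance from
  \<open>A\<close> to its projection \<open>P\<close> would be at least as close to \<open>P\<close>
  as to \<open>A\<close>, and the triangle inequality from \<open>P\<close> to \<open>A\<close>
  through \<open>B\<close> would fail.\<close>

lemma spectrahedron_measurable:
  assumes n: "0 < n"
  shows "spectrahedron n \<in> sets (sym_borel n)"
proof -
  have "frob_open n (sym_mats n - spectrahedron n)"
    unfolding frob_open_def
  proof (intro conjI ballI)
    fix A assume "A \<in> sym_mats n - spectrahedron n"
    then have A: "A \<in> sym_mats n" "A \<notin> spectrahedron n" by auto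
    define P where "P = spectrahedron_proj n A"
    have P: "P \<in> spectrahedron n" unfolding P_def by (rule spectrahedron_proj_props(2)[OF A(1) n])
    note c = sym_mats_carrier[OF A(1)] spectrahedronD(2)[OF P]
    have pos: "0 < frob_norm (P - A)"
      using frob_norm_eq_0[OF c(2) c(1)] A P frob_norm_nonneg[of "P - A"] by (auto simp: less_le)
    have "B \<in> sym_mats n - spectrahedron n" if B: "B \<in> sym_mats n" and d: "frob_norm (B - A) < frob_norm (P - A) / 2" for B
    proof -
      have "B \<notin> spectrahedron n"
      proof
        assume BS: "B \<in> spectrahedron n"
        have "frob_norm (P - B) \<le> frob_norm (A - B)"
          unfolding P_def using spectrahedron_proj_nonexpansive_to[OF A(1) n BS] .
        moreover have "frob_norm (P - A) \<le> frob_norm (P - B) + frob_norm (B - A)"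
          using c sym_mats_carrier[OF B] by (intro frob_norm_diff_triangle) auto
        ultimately show False using d frob_norm_minus_commute[OF c(1) sym_mats_carrier[OF B]] by simp
      qed
      then show ?thesis using B by blast
    qed
    then show "\<exists>e>0. \<forall>B\<in>sym_mats n. frob_norm (B - A) < e \<longrightarrow> B \<in> sym_mats n - spectrahedron n"
      using pos by (intro exI[of _ "frob_norm (P - A) / 2"]) auto
  qed auto
  from sets.compl_sets[OF frob_open_measurable[OF this]] show ?thesis
    using spectrahedronD(1) by (simp add: double_diff subset_iff)
qed

section \<open>Product kernels, independence and finite nets\<close>

lemma measurable_PiM_kernel:
  assumes K: "K \<in> measurable N (prob_algebra S)" and I: "finite I"
  shows "(\<lambda>x. Pi\<^sub>M I (\<lambda>_. K x)) \<in> measurable N (prob_algebra (Pi\<^sub>M I (\<lambda>_. S)))"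
proof (rule measurable_prob_algebra_generated[OF sets_PiM Int_stable_prod_algebra prod_algebra_sets_into_space])
  have Kx: "sets (K x) = sets S" "prob_space (K x)" if "x \<in> space N" for x
    using measurable_space[OF K that] by (auto simp: space_prob_algebra)
  fix x assume x: "x \<in> space N"
  show "prob_space (Pi\<^sub>M I (\<lambda>_. K x))" using Kx(2)[OF x] by (intro prob_space_PiM)
  show "sets (Pi\<^sub>M I (\<lambda>_. K x)) = sets (Pi\<^sub>M I (\<lambda>_. S))" using Kx(1)[OF x] by (intro sets_PiM_cong) auto
next
  have Kx: "sets (K x) = sets S" "prob_space (K x)" if "x \<in> space N" for x
    using measurable_space[OF K that] by (auto simp: space_prob_algebra)
  \<comment> \<open>It suffices to treat the rectangles that generate the product sigma-algebra,
    where the measure is a finite product of measurable functions of the parameter.\<close>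
  fix A assume "A \<in> prod_algebra I (\<lambda>_. S)"
  then obtain X where A: "A = Pi\<^sub>E I X" and X: "\<And>i. i \<in> I \<Longrightarrow> X i \<in> sets S"
    using I by (auto simp: prod_algebra_eq_finite)
  have "emeasure (Pi\<^sub>M I (\<lambda>_. K x)) A = (\<Prod>i\<in>I. emeasure (K x) (X i))" if x: "x \<in> space N" for x
  proof -
    interpret product_prob_space "\<lambda>_. K x" I
      using Kx(2)[OF x] by (intro product_prob_spaceI)
    show ?thesis unfolding A using X Kx(1)[OF x] I by (intro emeasure_PiM) auto
  qed
  moreover have "(\<lambda>x. \<Prod>i\<in>I. emeasure (K x) (X i)) \<in> borel_measurable N"
  proof (rule borel_measurable_prod_ennreal)
    fix i assume i: "i \<in> I"
    show "(\<lambda>x. emeasure (K x) (X i)) \<in> borel_measurable N"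
      using measurable_compose[OF measurable_prob_algebraD[OF K] measurable_emeasure_subprob_algebra[OF X[OF i]]] .
  qed
  ultimately show "(\<lambda>x. emeasure (Pi\<^sub>M I (\<lambda>_. K x)) A) \<in> borel_measurable N"
    by (subst measurable_cong) auto
qed

text \<open>Under a product measure the joint law of the coordinates is the measure itself, which is
  the product of the marginals; that equality is the criterion for independence.\<close>

lemma indep_vars_PiM_coordinates:
  assumes "\<And>i. i \<in> I \<Longrightarrow> prob_space (M i)" "I \<noteq> {}"
  shows "prob_space.indep_vars (Pi\<^sub>M I M) M (\<lambda>i \<omega>. \<omega> i) I"
proof -
  interpret P: prob_space "Pi\<^sub>M I M" using assms(1) by (rule prob_space_PiM)
  have "distr (Pi\<^sub>M I M) (Pi\<^sub>M I M) (\<lambda>x. \<lambda>i\<in>I. x i) = distr (Pi\<^sub>M I M) (Pi\<^sub>M I M) (\<lambda>x. x)"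
    by (rule distr_cong) (auto simp: space_PiM)
  also have "\<dots> = Pi\<^sub>M I M" by (rule distr_id)
  also have "Pi\<^sub>M I M = Pi\<^sub>M I (\<lambda>i. distr (Pi\<^sub>M I M) (M i) (\<lambda>\<omega>. \<omega> i))"
    using distr_PiM_component[of I M] assms(1) by (intro PiM_cong) auto
  finally show ?thesis using assms(2)
    by (subst P.indep_vars_iff_distr_eq_PiM') (auto intro: measurable_component_singleton)
qed

text \<open>A grid of mesh \<open>1 / m\<close> with coordinates between -1 and 1. Rounding goes
  towards zero, so that a rounded unit vector stays in the unit ball, where the tail bound is
  applied. Each coordinate moves by at most \<open>1 / m\<close>, which explains the choice of
  \<open>m\<close> above \<open>sqrt n / \<kappa>\<close>.\<close>

lemma finite_net:
  assumes \<kappa>: "0 < (\<kappa>::real)"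
  shows "\<exists>S. finite S \<and> (\<forall>v\<in>S. v \<in> carrier_vec n \<and> v \<bullet> v \<le> 1) \<and>
     (\<forall>x\<in>carrier_vec n. x \<bullet> x = 1 \<longrightarrow> (\<exists>v\<in>S. (x - v) \<bullet> (x - v) \<le> \<kappa>\<^sup>2))"
proof -
  obtain m :: nat where "max 1 (sqrt n / \<kappa>) < real m" using reals_Archimedean2 by blast
  then have m: "real m > sqrt n / \<kappa>" "m > 0" by (simp, intro gr0I) auto
  define mk where "mk = (\<lambda>k :: nat \<Rightarrow> int. vec n (\<lambda>i. real_of_int (k i) / m))"
  define S where "S = mk ` (Pi\<^sub>E {..<n} (\<lambda>_. {- int m..int m})) \<inter> {v. v \<bullet> v \<le> 1}"
  have fin: "finite S" unfolding S_def by (intro finite_Int disjI1 finite_imageI finite_PiE) auto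
  have mkc: "mk k \<in> carrier_vec n" for k by (simp add: mk_def)
  have "\<forall>v\<in>S. v \<in> carrier_vec n \<and> v \<bullet> v \<le> 1" unfolding S_def using mkc by blast
  moreover have "\<exists>v\<in>S. (x - v) \<bullet> (x - v) \<le> \<kappa>\<^sup>2" if x: "x \<in> carrier_vec n" and x1: "x \<bullet> x = 1" for x
  proof -
    define k where "k = (\<lambda>i\<in>{..<n}. if x $ i \<ge> 0 then \<lfloor>m * x $ i\<rfloor> else - \<lfloor>m * - (x $ i)\<rfloor>)"
    have absx: "\<bar>x $ i\<bar> \<le> 1" if "i < n" for i
    proof -
      have "(x $ i)\<^sup>2 \<le> (\<Sum>i<n. (x $ i)\<^sup>2)" using that by (intro member_le_sum) auto
      also have "\<dots> = 1" using x1 x by (simp add: scalar_prod_sum[of _ n] power2_eq_square)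
      finally show ?thesis by (simp add: abs_square_le_1)
    qed
    have near: "\<bar>x $ i - k i / m\<bar> \<le> 1 / m \<and> \<bar>k i / m\<bar> \<le> \<bar>x $ i\<bar>" if i: "i < n" for i
    proof -
      define y where "y = m * \<bar>x $ i\<bar>"
      have y: "0 \<le> y" "0 \<le> real_of_int \<lfloor>y\<rfloor>" "real_of_int \<lfloor>y\<rfloor> \<le> y" "y - real_of_int \<lfloor>y\<rfloor> \<le> 1"
        unfolding y_def by (simp, simp, linarith, linarith)
      have xi: "\<bar>x $ i\<bar> = y / m" using m by (simp add: y_def)
      have "\<bar>\<bar>x $ i\<bar> - \<lfloor>y\<rfloor> / m\<bar> \<le> 1 / m"
      proof -
        have "\<bar>x $ i\<bar> - \<lfloor>y\<rfloor> / m = (y - \<lfloor>y\<rfloor>) / m" unfolding xi by (simp add: diff_divide_distrib)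
        then show ?thesis using y m by (simp add: divide_right_mono)
      qed
      moreover have "\<lfloor>y\<rfloor> / m \<le> \<bar>x $ i\<bar>" unfolding xi using y m by (intro divide_right_mono) auto
      moreover have "0 \<le> \<lfloor>y\<rfloor> / m" using y by simp
      moreover have "k i / m = (if 0 \<le> x $ i then \<lfloor>y\<rfloor> / m else - (\<lfloor>y\<rfloor> / m))"
        using i by (simp add: k_def y_def)
      ultimately show ?thesis using m(2) by (auto simp: abs_if split: if_splits)
    qed
    define v where "v = mk k"
    have v: "v \<in> carrier_vec n" by (simp add: v_def mk_def)
    have vi: "v $ i = k i / m" if "i < n" for i using that by (simp add: v_def mk_def)
    have "v \<bullet> v = (\<Sum>i<n. (v $ i)\<^sup>2)" using v by (simp add: scalar_prod_sum[of _ n] power2_eq_square)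
    also have "\<dots> \<le> (\<Sum>i<n. (x $ i)\<^sup>2)"
      using near by (intro sum_mono) (simp add: vi abs_le_square_iff[symmetric])
    also have "\<dots> = 1" using x1 x by (simp add: scalar_prod_sum[of _ n] power2_eq_square)
    finally have vv: "v \<bullet> v \<le> 1" .
    have "k \<in> Pi\<^sub>E {..<n} (\<lambda>_. {- int m..int m})"
    proof (rule PiE_I)
      fix i assume "i \<in> {..<n}"
      then have i: "i < n" by simp
      have "\<bar>real_of_int (k i)\<bar> / m \<le> 1" using near[OF i] absx[OF i] by simp
      then have "\<bar>real_of_int (k i)\<bar> \<le> real m" using m by (simp add: field_simps)
      then show "k i \<in> {- int m..int m}" by auto
    qed (simp add: k_def)
    then have "v \<in> S" using vv by (auto simp: S_def v_def)
    moreover have "(x - v) \<bullet> (x - v) \<le> \<kappa>\<^sup>2"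
    proof -
      have "(x - v) \<bullet> (x - v) = (\<Sum>i<n. (x $ i - v $ i)\<^sup>2)"
        using x v by (subst scalar_prod_sum[of _ n]) (auto simp: power2_eq_square)
      also have "\<dots> \<le> (\<Sum>i<n. (1 / m)\<^sup>2)"
      proof (rule sum_mono)
        fix i assume "i \<in> {..<n}"
        then have "\<bar>x $ i - v $ i\<bar> \<le> 1 / m" using near by (simp add: vi)
        then show "(x $ i - v $ i)\<^sup>2 \<le> (1 / m)\<^sup>2" by (metis abs_ge_zero power2_abs power_mono)
      qed
      also have "\<dots> = (sqrt n / m)\<^sup>2" by (simp add: power_divide)
      also have "\<dots> \<le> \<kappa>\<^sup>2"
        using m \<kappa> by (intro power_mono) (auto simp: field_simps intro: less_imp_le)
      finally show ?thesis .
    qed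
    ultimately show ?thesis by blast
  qed
  ultimately show ?thesis using fin by blast
qed

lemma scalar_prod_cauchy_schwarz:
  assumes "x \<in> carrier_vec n" "y \<in> carrier_vec n"
  shows "\<bar>x \<bullet> y\<bar> \<le> sqrt (x \<bullet> x) * sqrt (y \<bullet> y)"
proof -
  have "(x \<bullet> y)\<^sup>2 \<le> (x \<bullet> x) * (y \<bullet> (y :: real vec))"
    using Cauchy_Schwarz_ineq_sum[of "\<lambda>i. x $ i" "\<lambda>i. y $ i" "{..<n}"] assms
    by (simp add: scalar_prod_sum[of _ n] power2_eq_square)
  then have "sqrt ((x \<bullet> y)\<^sup>2) \<le> sqrt ((x \<bullet> x) * (y \<bullet> y))" by (rule real_sqrt_le_mono)
  then show ?thesis by (simp add: real_sqrt_mult)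
qed

text \<open>The supremum in \<open>spectral_norm\<close> dominates its members only if they are
  bounded above, and the Frobenius norm supplies such a bound. General \<open>x\<close> are reduced
  to unit vectors by scaling.\<close>

lemma spectral_norm_quad:
  assumes A: "A \<in> carrier_mat n n" and sn: "spectral_norm A \<le> B" and x: "x \<in> carrier_vec n"
  shows "\<bar>x \<bullet> (A *\<^sub>v x)\<bar> \<le> B * (x \<bullet> x)"
proof (cases "x = 0\<^sub>v n")
  case False
  define V :: "real vec set" where "V = {v \<in> carrier_vec (dim_col A). v \<bullet> v \<le> 1}"
  define h where "h = (\<lambda>v. sqrt ((A *\<^sub>v v) \<bullet> (A *\<^sub>v v)))"
  have xx: "0 < x \<bullet> x" using scalar_prod_self_pos[OF x False] .
  \<comment> \<open>\<open>A *\<^sub>v v\<close> is tested against itself and one factor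
    \<open>h v\<close> cancels.\<close>
  have "h v \<le> frob_norm A" if v: "v \<in> V" for v
  proof (cases "h v = 0")
    case False
    have vc: "v \<in> carrier_vec n" "v \<bullet> v \<le> 1" using v A by (auto simp: V_def)
    have h0: "0 < h v" using False scalar_prod_self_nonneg by (auto simp: h_def less_le)
    have "h v * h v = (A *\<^sub>v v) \<bullet> (A *\<^sub>v v)" using scalar_prod_self_nonneg by (simp add: h_def)
    also have "\<dots> \<le> frob_norm A * (h v * sqrt (v \<bullet> v))"
      using abs_bilinear_le[OF A vc(1), of "A *\<^sub>v v"] A vc by (simp add: h_def abs_le_iff)
    also have "\<dots> \<le> frob_norm A * (h v * 1)"
      using vc(2) h0 scalar_prod_self_nonneg[of v] by (intro mult_left_mono) (auto intro!: real_le_lsqrt)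
    finally have "h v * h v \<le> frob_norm A * h v" by simp
    then show ?thesis using h0 by simp
  qed simp
  then have "bdd_above (h ` V)" by (intro bdd_aboveI2)
  moreover define v where "v = (1 / sqrt (x \<bullet> x)) \<cdot>\<^sub>v x"
  have vc: "v \<in> carrier_vec n" using x by (simp add: v_def)
  have v1: "v \<bullet> v = 1" unfolding v_def using x xx by (simp add: field_simps)
  have "v \<in> V" using A vc v1 by (simp add: V_def)
  ultimately have "h v \<le> (SUP v\<in>V. h v)" by (intro cSUP_upper)
  also have "\<dots> \<le> B" using sn by (simp add: spectral_norm_def V_def h_def)
  finally have hB: "h v \<le> B" .
  have "\<bar>v \<bullet> (A *\<^sub>v v)\<bar> \<le> h v"
    using scalar_prod_cauchy_schwarz[OF vc, of "A *\<^sub>v v"] A vc v1 by (simp add: h_def)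
  then have "\<bar>v \<bullet> (A *\<^sub>v v)\<bar> * (x \<bullet> x) \<le> B * (x \<bullet> x)" using hB xx by (intro mult_right_mono) auto
  moreover have "v \<bullet> (A *\<^sub>v v) = (x \<bullet> (A *\<^sub>v x)) / (x \<bullet> x)"
    unfolding v_def using A x xx
    by (simp add: mult_mat_vec[of _ n n] field_simps)
  ultimately show ?thesis using xx by (simp add: abs_div_pos[symmetric] abs_mult)
qed (use A in auto)

section \<open>Mini-batch averages\<close>

lemma integrable_integral_cong:
  fixes f g :: "'a \<Rightarrow> real"
  assumes "\<And>x. x \<in> space M \<Longrightarrow> f x = g x" "integrable M g"
  shows "integrable M f \<and> (LINT x|M. f x) = (LINT x|M. g x)"
  using assms by (simp cong: Bochner_Integration.integrable_cong Bochner_Integration.integral_cong)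

lemma avg_mat_carrier [simp]: "avg_mat n m A \<in> carrier_mat n n"
  by (simp add: avg_mat_def)

lemma avg_mat_sym: "(\<And>k. k \<in> {1..m} \<Longrightarrow> A k \<in> sym_mats n) \<Longrightarrow> avg_mat n m A \<in> sym_mats n"
  using sym_mats_index[of _ n] by (intro sym_matsI) (auto simp: avg_mat_def intro!: sum.cong)

lemma frob_inner_avg_mat:
  assumes A: "\<And>k. k \<in> {1..m} \<Longrightarrow> A k \<in> carrier_mat n n"
  shows "frob_inner (avg_mat n m A) Z = (\<Sum>k=1..m. frob_inner (A k) Z) / m"
proof -
  have "frob_inner (avg_mat n m A) Z = (\<Sum>i<n. \<Sum>j<n. \<Sum>k=1..m. A k $$ (i, j) * Z $$ (i, j) / m)"
    unfolding frob_inner_sum[OF avg_mat_carrier]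
    by (intro sum.cong refl) (simp add: avg_mat_def sum_distrib_right sum_divide_distrib)
  also have "\<dots> = (\<Sum>i<n. \<Sum>k=1..m. \<Sum>j<n. A k $$ (i, j) * Z $$ (i, j) / m)"
    by (rule sum.cong[OF refl], rule sum.swap)
  also have "\<dots> = (\<Sum>k=1..m. \<Sum>i<n. \<Sum>j<n. A k $$ (i, j) * Z $$ (i, j) / m)" by (rule sum.swap)
  also have "\<dots> = (\<Sum>k=1..m. frob_inner (A k) Z / m)"
    using A by (intro sum.cong refl) (simp add: frob_inner_sum[of _ n] sum_divide_distrib)
  finally show ?thesis by (simp add: sum_divide_distrib)
qed

lemma measurable_avg_mat:
  assumes M: "sets M = sets (sym_borel n)"
  shows "avg_mat n m \<in> measurable (Pi\<^sub>M {1..m} (\<lambda>_. M)) (sym_borel n)"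
proof (rule measurable_sym_borelI)
  have sp: "space M = sym_mats n" using sets_eq_imp_space_eq[OF M] by simp
  show "avg_mat n m g \<in> sym_mats n" if "g \<in> space (Pi\<^sub>M {1..m} (\<lambda>_. M))" for g
    using that sp by (intro avg_mat_sym) (auto simp: space_PiM)
  fix i j assume ij: "i < n" "j < n"
  have "(\<lambda>g. (\<Sum>k=1..m. g k $$ (i, j)) / real m) \<in> borel_measurable (Pi\<^sub>M {1..m} (\<lambda>_. M))"
  proof (intro borel_measurable_divide borel_measurable_sum borel_measurable_const)
    fix k assume "k \<in> {1..m}"
    then have "(\<lambda>g. g k) \<in> measurable (Pi\<^sub>M {1..m} (\<lambda>_. M)) M" by (rule measurable_component_singleton)
    moreover have "(\<lambda>A. A $$ (i, j)) \<in> borel_measurable M"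
      using measurable_sym_borel_entry[OF ij] measurable_cong_sets[OF M refl] by blast
    ultimately show "(\<lambda>g. g k $$ (i, j)) \<in> borel_measurable (Pi\<^sub>M {1..m} (\<lambda>_. M))"
      by (rule measurable_compose)
  qed
  then show "(\<lambda>g. avg_mat n m g $$ (i, j)) \<in> borel_measurable (Pi\<^sub>M {1..m} (\<lambda>_. M))" using ij by (simp add: avg_mat_def)
qed

text \<open>One answer at a frozen query point: given the history, the current iterate is a
  constant, and \<open>M\<close> is the law of an answer to it, with mean \<open>D\<close>.\<close>

locale query_law = prob_space M for M :: "real mat measure" +
  fixes n :: nat and D :: "real mat" and G B :: real
  assumes sets_M: "sets M = sets (sym_borel n)"
    and D_sym: "D \<in> sym_mats n"
    and mean: "\<And>i j. i < n \<Longrightarrow> j < n \<Longrightarrow> (LINT A|M. A $$ (i, j)) = D $$ (i, j)"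
    and AE_bound: "AE A in M. frob_norm A \<le> G \<and> spectral_norm A \<le> B"
    and B_pos: "0 < B" and G_pos: "0 < G"
begin

lemma space_M: "space M = sym_mats n"
  using sets_eq_imp_space_eq[OF sets_M] by simp

lemma entry_measurable: "i < n \<Longrightarrow> j < n \<Longrightarrow> (\<lambda>A. A $$ (i, j)) \<in> borel_measurable M"
  using measurable_sym_borel_entry[of i n j] measurable_cong_sets[OF sets_M refl] by blast

lemma entry_integrable: "i < n \<Longrightarrow> j < n \<Longrightarrow> integrable M (\<lambda>A. A $$ (i, j))"
proof (rule integrable_const_bound[of _ G])
  assume ij: "i < n" "j < n"
  show "(\<lambda>A. A $$ (i, j)) \<in> borel_measurable M" using ij by (rule entry_measurable)
  show "AE A in M. norm (A $$ (i, j)) \<le> G"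
    using AE_bound
  proof (rule AE_mp, intro AE_I2 impI)
    fix A assume A: "A \<in> space M" and b: "frob_norm A \<le> G \<and> spectral_norm A \<le> B"
    then have "\<bar>A $$ (i, j)\<bar> \<le> frob_norm A"
      using ij sym_mats_carrier space_M by (intro abs_entry_le_frob_norm) auto
    then show "norm (A $$ (i, j)) \<le> G" using b by simp
  qed
qed

lemma integral_linear:
  shows "integrable M (\<lambda>A. \<Sum>i<n. \<Sum>j<n. A $$ (i, j) * c i j)"
    and "(LINT A|M. (\<Sum>i<n. \<Sum>j<n. A $$ (i, j) * c i j)) = (\<Sum>i<n. \<Sum>j<n. D $$ (i, j) * c i j)"
proof -
  have 1: "integrable M (\<lambda>A. A $$ (i, j) * c i j)" if "i \<in> {..<n}" "j \<in> {..<n}" for i j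
    using that by (intro integrable_mult_left entry_integrable) auto
  then show "integrable M (\<lambda>A. \<Sum>i<n. \<Sum>j<n. A $$ (i, j) * c i j)"
    by (intro Bochner_Integration.integrable_sum)
  have "(LINT A|M. (\<Sum>i<n. \<Sum>j<n. A $$ (i, j) * c i j)) = (\<Sum>i<n. \<Sum>j<n. LINT A|M. A $$ (i, j) * c i j)"
  proof -
    have "(LINT A|M. (\<Sum>i<n. \<Sum>j<n. A $$ (i, j) * c i j)) = (\<Sum>i<n. LINT A|M. (\<Sum>j<n. A $$ (i, j) * c i j))"
      using 1 by (intro Bochner_Integration.integral_sum Bochner_Integration.integrable_sum) auto
    also have "\<dots> = (\<Sum>i<n. \<Sum>j<n. LINT A|M. A $$ (i, j) * c i j)"
      using 1 by (intro sum.cong refl Bochner_Integration.integral_sum) auto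
    finally show ?thesis .
  qed
  then show "(LINT A|M. (\<Sum>i<n. \<Sum>j<n. A $$ (i, j) * c i j)) = (\<Sum>i<n. \<Sum>j<n. D $$ (i, j) * c i j)"
    by (simp add: mean)
qed

lemma frob_integral:
  shows "integrable M (\<lambda>A. frob_inner A Z)" "(LINT A|M. frob_inner A Z) = frob_inner D Z"
proof -
  have e: "frob_inner A Z = (\<Sum>i<n. \<Sum>j<n. A $$ (i, j) * Z $$ (i, j))" if "A \<in> space M" for A
    using that sym_mats_carrier space_M by (intro frob_inner_sum) auto
  have "integrable M (\<lambda>A. frob_inner A Z) \<and>
      (LINT A|M. frob_inner A Z) = (LINT A|M. (\<Sum>i<n. \<Sum>j<n. A $$ (i, j) * Z $$ (i, j)))"
    using e integral_linear(1) by (rule integrable_integral_cong)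
  then show "integrable M (\<lambda>A. frob_inner A Z)" "(LINT A|M. frob_inner A Z) = frob_inner D Z"
    using integral_linear(2)[of "\<lambda>i j. Z $$ (i, j)"] frob_inner_sum[OF sym_mats_carrier[OF D_sym], of Z] by auto
qed

lemma quad_integral:
  assumes x: "x \<in> carrier_vec n"
  shows "integrable M (\<lambda>A. x \<bullet> (A *\<^sub>v x))" "(LINT A|M. x \<bullet> (A *\<^sub>v x)) = x \<bullet> (D *\<^sub>v x)"
proof -
  have e: "x \<bullet> (A *\<^sub>v x) = (\<Sum>i<n. \<Sum>j<n. A $$ (i, j) * (x $ i * x $ j))" if "A \<in> sym_mats n" for A
    using that sym_mats_carrier x bilinear_sum[of A n x x] by (auto simp: mult.assoc)
  then have e': "x \<bullet> (A *\<^sub>v x) = (\<Sum>i<n. \<Sum>j<n. A $$ (i, j) * (x $ i * x $ j))" if "A \<in> space M" for A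
    using that space_M by simp
  have "integrable M (\<lambda>A. x \<bullet> (A *\<^sub>v x)) \<and>
      (LINT A|M. x \<bullet> (A *\<^sub>v x)) = (LINT A|M. (\<Sum>i<n. \<Sum>j<n. A $$ (i, j) * (x $ i * x $ j)))"
    using e' integral_linear(1) by (rule integrable_integral_cong)
  then show "integrable M (\<lambda>A. x \<bullet> (A *\<^sub>v x))" "(LINT A|M. x \<bullet> (A *\<^sub>v x)) = x \<bullet> (D *\<^sub>v x)"
    using integral_linear(2)[of "\<lambda>i j. x $ i * x $ j"] e[OF D_sym] by auto
qed

lemma AE_quad:
  assumes x: "x \<in> carrier_vec n"
  shows "AE A in M. \<bar>x \<bullet> (A *\<^sub>v x)\<bar> \<le> B * (x \<bullet> x)"
  using AE_bound
proof (rule AE_mp, intro AE_I2 impI)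
  fix A assume "A \<in> space M" "frob_norm A \<le> G \<and> spectral_norm A \<le> B"
  then show "\<bar>x \<bullet> (A *\<^sub>v x)\<bar> \<le> B * (x \<bullet> x)"
    using spectral_norm_quad[OF _ _ x] sym_mats_carrier space_M by auto
qed

text \<open>The mean inherits the bound on the answers. Evaluated at eigenvectors of
  \<open>D\<close>, this places the eigenvalues of the gradient between \<open>- B\<close> and
  \<open>B\<close>.\<close>

lemma mean_quad:
  assumes x: "x \<in> carrier_vec n"
  shows "\<bar>x \<bullet> (D *\<^sub>v x)\<bar> \<le> B * (x \<bullet> x)"
proof -
  have "\<bar>x \<bullet> (D *\<^sub>v x)\<bar> \<le> (LINT A|M. \<bar>x \<bullet> (A *\<^sub>v x)\<bar>)"
    unfolding quad_integral(2)[OF x, symmetric] by (rule integral_abs_bound)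
  also have "\<dots> \<le> (LINT A|M. B * (x \<bullet> x))"
    using quad_integral(1)[OF x] AE_quad[OF x] by (intro integral_mono_AE) auto
  finally show ?thesis by (simp add: prob_space)
qed

text \<open>The answer is paired with the fixed matrix \<open>D\<close>; the mean of this pairing is
  \<open>(frob_norm D)\<^sup>2\<close>, and after Cauchy-Schwarz one factor cancels.\<close>

lemma mean_frob_norm: "frob_norm D \<le> G"
proof -
  have Dc: "D \<in> carrier_mat n n" using D_sym by (rule sym_mats_carrier)
  have "(frob_norm D)\<^sup>2 = (LINT A|M. frob_inner A D)" by (simp add: frob_integral frob_norm_square)
  also have "\<dots> \<le> (LINT A|M. G * frob_norm D)"
  proof (rule integral_mono_AE)
    show "AE A in M. frob_inner A D \<le> G * frob_norm D"
      using AE_bound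
    proof (rule AE_mp, intro AE_I2 impI)
      fix A assume "A \<in> space M" and b: "frob_norm A \<le> G \<and> spectral_norm A \<le> B"
      then have "frob_inner A D \<le> frob_norm A * frob_norm D"
        using frob_cauchy_schwarz[of A n D] Dc sym_mats_carrier space_M by (auto simp: abs_le_iff)
      also have "\<dots> \<le> G * frob_norm D" using b by (intro mult_right_mono) auto
      finally show "frob_inner A D \<le> G * frob_norm D" .
    qed
  qed (auto intro: frob_integral)
  finally have "frob_norm D * frob_norm D \<le> G * frob_norm D"
    by (simp add: prob_space power2_eq_square)
  then show ?thesis using G_pos frob_norm_nonneg[of D]
    by (cases "frob_norm D = 0") (auto simp: less_le)
qed

end

section \<open>Averages of independent answers and their deviations\<close>

locale minibatch = query_law +
  fixes L :: nat
  assumes L_pos: "1 \<le> L"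
begin

abbreviation P :: "(nat \<Rightarrow> real mat) measure" where
  "P \<equiv> Pi\<^sub>M {1..L} (\<lambda>_. M)"

sublocale P: prob_space P
  by (rule prob_space_PiM) (rule prob_space_axioms)

lemma batch_sym: "g \<in> space P \<Longrightarrow> k \<in> {1..L} \<Longrightarrow> g k \<in> sym_mats n"
  using space_M by (auto simp: space_PiM)

lemma avg_sym: "g \<in> space P \<Longrightarrow> avg_mat n L g \<in> sym_mats n"
  using batch_sym by (rule avg_mat_sym)

lemma avg_frob_inner:
  assumes g: "g \<in> space P"
  shows "frob_inner (avg_mat n L g) Z = (\<Sum>k=1..L. frob_inner (g k) Z) / L"
  using sym_mats_carrier[OF batch_sym[OF g]] by (rule frob_inner_avg_mat)

lemma avg_quad:
  assumes g: "g \<in> space P" and x: "x \<in> carrier_vec n"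
  shows "x \<bullet> (avg_mat n L g *\<^sub>v x) = (\<Sum>k=1..L. x \<bullet> (g k *\<^sub>v x)) / L"
proof -
  have e: "x \<bullet> (A *\<^sub>v x) = frob_inner A (spectral_sum n {0::nat} (\<lambda>_. x) (\<lambda>_. 1))" if "A \<in> carrier_mat n n" for A
    using frob_inner_spectral_sum[of "{0::nat}" "\<lambda>_. x" n A "\<lambda>_. 1"] x that by simp
  show ?thesis
    using avg_frob_inner[OF g] sym_mats_carrier[OF batch_sym[OF g]] by (simp add: e avg_mat_carrier)
qed

lemma AE_avg_frob_norm: "AE g in P. frob_norm (avg_mat n L g) \<le> G"
proof -
  have "AE g in P. \<forall>k\<in>{1..L}. frob_norm (g k) \<le> G"
    unfolding AE_finite_all[OF finite_atLeastAtMost]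
  proof
    fix k assume k: "k \<in> {1..L}"
    have "AE A in M. frob_norm A \<le> G" using AE_bound by auto
    then show "AE g in P. frob_norm (g k) \<le> G"
      by (intro AE_PiM_component[where M = "\<lambda>_. M", OF _ k]) (auto intro: prob_space_axioms)
  qed
  then show ?thesis
  proof (rule AE_mp, intro AE_I2 impI)
    fix g assume g: "g \<in> space P" and b: "\<forall>k\<in>{1..L}. frob_norm (g k) \<le> G"
    let ?a = "avg_mat n L g"
    \<comment> \<open>The average is paired with itself; Cauchy-Schwarz in each summand leaves one
      factor to cancel.\<close>
    have "(frob_norm ?a)\<^sup>2 = (\<Sum>k=1..L. frob_inner (g k) ?a) / L"
      using avg_frob_inner[OF g] by (simp add: frob_norm_square)
    also have "\<dots> \<le> (\<Sum>k=1..L. G * frob_norm ?a) / L"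
    proof (intro divide_right_mono sum_mono)
      fix k assume k: "k \<in> {1..L}"
      have "frob_inner (g k) ?a \<le> frob_norm (g k) * frob_norm ?a"
        using frob_cauchy_schwarz[OF sym_mats_carrier[OF batch_sym[OF g k]] avg_mat_carrier] by (simp add: abs_le_iff)
      also have "\<dots> \<le> G * frob_norm ?a" using b k by (intro mult_right_mono) auto
      finally show "frob_inner (g k) ?a \<le> G * frob_norm ?a" .
    qed simp
    also have "\<dots> = G * frob_norm ?a" using L_pos by simp
    finally have "frob_norm ?a * frob_norm ?a \<le> G * frob_norm ?a" by (simp add: power2_eq_square)
    then show "frob_norm ?a \<le> G" using G_pos frob_norm_nonneg[of ?a]
      by (cases "frob_norm ?a = 0") (auto simp: less_le)
  qed
qed

lemma component_integral:
  assumes k: "k \<in> {1..L}" and h: "integrable M h"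
  shows "integrable P (\<lambda>g. h (g k))" "(LINT g|P. h (g k)) = (LINT A|M. h (A :: real mat) :: real)"
proof -
  have d: "distr P M (\<lambda>g. g k) = M"
    using prob_space_axioms k by (intro distr_PiM_component) auto
  have m: "(\<lambda>g. g k) \<in> measurable P M" using k by (rule measurable_component_singleton)
  show "integrable P (\<lambda>g. h (g k))"
    using integrable_distr[OF m, of h] h d by simp
  show "(LINT g|P. h (g k)) = (LINT A|M. h A)"
    using integral_distr[OF m, of h] h d by simp
qed

lemma avg_frob_integral:
  shows "integrable P (\<lambda>g. frob_inner (avg_mat n L g) Z)"
    and "(LINT g|P. frob_inner (avg_mat n L g) Z) = frob_inner D Z"
proof -
  have i: "integrable P (\<lambda>g. (\<Sum>k=1..L. frob_inner (g k) Z) / L)"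
    using component_integral(1)[OF _ frob_integral(1)] by (intro integrable_divide Bochner_Integration.integrable_sum) auto
  have "(LINT g|P. (\<Sum>k=1..L. frob_inner (g k) Z) / L) = (\<Sum>k=1..L. LINT g|P. frob_inner (g k) Z) / L"
    using component_integral(1)[OF _ frob_integral(1)] by (subst Bochner_Integration.integral_sum[symmetric]) auto
  also have "\<dots> = (\<Sum>k=1..L. frob_inner D Z) / L"
    using component_integral(2)[OF _ frob_integral(1)] frob_integral(2)
    by (intro arg_cong[where f = "\<lambda>x. x / real L"] sum.cong refl) auto
  also have "\<dots> = frob_inner D Z" using L_pos by simp
  finally have mean_sum: "(LINT g|P. (\<Sum>k=1..L. frob_inner (g k) Z) / L) = frob_inner D Z" .
  have "integrable P (\<lambda>g. frob_inner (avg_mat n L g) Z) \<and>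
      (LINT g|P. frob_inner (avg_mat n L g) Z) = (LINT g|P. (\<Sum>k=1..L. frob_inner (g k) Z) / L)"
    using avg_frob_inner i by (rule integrable_integral_cong)
  then show "integrable P (\<lambda>g. frob_inner (avg_mat n L g) Z)"
    and "(LINT g|P. frob_inner (avg_mat n L g) Z) = frob_inner D Z" using mean_sum by auto
qed

text \<open>For fixed \<open>v\<close> the numbers \<open>v \<bullet> (g k *\<^sub>v v)\<close> are
  independent and lie in an interval of length \<open>2 * B\<close>. Hoeffding's exponent
  \<open>2 * (L * e)\<^sup>2 / (L * (2 * B)\<^sup>2)\<close> simplifies to
  \<open>L * e\<^sup>2 / (2 * B\<^sup>2)\<close>.\<close>

lemma hoeffding_quad:
  fixes e :: real
  assumes v: "v \<in> carrier_vec n" "v \<bullet> v \<le> 1" and e: "0 \<le> e"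
  shows "P.prob {g \<in> space P. e \<le> \<bar>v \<bullet> (avg_mat n L g *\<^sub>v v) - v \<bullet> (D *\<^sub>v v)\<bar>} \<le> 2 * exp (- (L * e\<^sup>2 / (2 * B\<^sup>2)))"
proof -
  define h where "h = (\<lambda>A. v \<bullet> (A *\<^sub>v v))"
  have hi: "integrable M h" unfolding h_def by (rule quad_integral(1)[OF v(1)])
  have "P.indep_vars (\<lambda>_. borel) (\<lambda>k g. h (g k)) {1..L}"
    by (rule P.indep_vars_compose2[OF indep_vars_PiM_coordinates])
      (use L_pos prob_space_axioms hi in auto)
  moreover have "AE g in P. h (g k) \<in> {- B..B}" if k: "k \<in> {1..L}" for k
  proof (rule AE_PiM_component[where M = "\<lambda>_. M", OF _ k])
    show "AE A in M. h A \<in> {- B..B}"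
      using AE_quad[OF v(1)]
    proof (rule AE_mp, intro AE_I2 impI)
      fix A assume "\<bar>v \<bullet> (A *\<^sub>v v)\<bar> \<le> B * (v \<bullet> v)"
      moreover have "B * (v \<bullet> v) \<le> B * 1" using B_pos v(2) by (intro mult_left_mono) auto
      ultimately show "h A \<in> {- B..B}" by (auto simp: h_def abs_le_iff)
    qed
  qed (rule prob_space_axioms)
  ultimately interpret H: Hoeffding_ineq P "{1..L}" "\<lambda>k g. h (g k)" "\<lambda>_. - B" "\<lambda>_. B" "\<Sum>k\<in>{1..L}. P.expectation (\<lambda>g. h (g k))"
    by unfold_locales auto
  have mu: "(\<Sum>k\<in>{1..L}. P.expectation (\<lambda>g. h (g k))) = L * (v \<bullet> (D *\<^sub>v v))"
    using component_integral(2)[OF _ hi] quad_integral(2)[OF v(1)] by (simp add: h_def)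
  have "{g \<in> space P. e \<le> \<bar>v \<bullet> (avg_mat n L g *\<^sub>v v) - v \<bullet> (D *\<^sub>v v)\<bar>} =
      {g \<in> space P. \<bar>(\<Sum>k=1..L. h (g k)) - (\<Sum>k\<in>{1..L}. P.expectation (\<lambda>g. h (g k)))\<bar> \<ge> L * e}"
  proof (intro Collect_cong conj_cong refl)
    fix g assume g: "g \<in> space P"
    have "v \<bullet> (avg_mat n L g *\<^sub>v v) - v \<bullet> (D *\<^sub>v v) =
        ((\<Sum>k=1..L. h (g k)) - L * (v \<bullet> (D *\<^sub>v v))) / L"
      unfolding avg_quad[OF g v(1)] h_def using L_pos by (simp add: diff_divide_distrib)
    also have "L * (v \<bullet> (D *\<^sub>v v)) = (\<Sum>k\<in>{1..L}. P.expectation (\<lambda>g. h (g k)))" by (rule mu[symmetric])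
    finally show "e \<le> \<bar>v \<bullet> (avg_mat n L g *\<^sub>v v) - v \<bullet> (D *\<^sub>v v)\<bar> \<longleftrightarrow>
        L * e \<le> \<bar>(\<Sum>k=1..L. h (g k)) - (\<Sum>k\<in>{1..L}. P.expectation (\<lambda>g. h (g k)))\<bar>"
      using L_pos by (simp add: abs_divide pos_le_divide_eq mult.commute)
  qed
  also have "P.prob \<dots> \<le> 2 * exp (-2 * (L * e)\<^sup>2 / (\<Sum>k\<in>{1..L}. (B - - B)\<^sup>2))"
    using e L_pos B_pos by (intro H.Hoeffding_ineq_abs_ge) auto
  also have "-2 * (L * e)\<^sup>2 / (\<Sum>k\<in>{1..L}. (B - - B)\<^sup>2) = - (L * e\<^sup>2 / (2 * B\<^sup>2))"
    using L_pos B_pos by (simp add: field_simps power2_eq_square)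
  finally show ?thesis .
qed

text \<open>The event refers to the vectors in \<open>S\<close> alone: for finite \<open>S\<close>
  it is measurable and open to a union bound, and all other vectors are reached by
  approximation.\<close>

definition deviating :: "real vec set \<Rightarrow> real \<Rightarrow> (nat \<Rightarrow> real mat) set" where
  "deviating S e = (\<Union>v\<in>S. {g \<in> space P. e \<le> \<bar>v \<bullet> (avg_mat n L g *\<^sub>v v) - v \<bullet> (D *\<^sub>v v)\<bar>})"

lemma deviating_event:
  assumes v: "v \<in> carrier_vec n"
  shows "{g \<in> space P. e \<le> \<bar>v \<bullet> (avg_mat n L g *\<^sub>v v) - v \<bullet> (D *\<^sub>v v)\<bar>} \<in> sets P"
proof -
  have "(\<lambda>g. (\<Sum>k=1..L. v \<bullet> (g k *\<^sub>v v)) / L) \<in> borel_measurable P"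
    using component_integral(1)[OF _ quad_integral(1)[OF v]]
    by (intro borel_measurable_divide borel_measurable_sum borel_measurable_const) auto
  then have "(\<lambda>g. v \<bullet> (avg_mat n L g *\<^sub>v v)) \<in> borel_measurable P"
    using avg_quad[OF _ v] by (subst measurable_cong) auto
  then show ?thesis by measurable
qed

lemma deviating_prob:
  fixes e :: real
  assumes S: "finite S" "\<And>v. v \<in> S \<Longrightarrow> v \<in> carrier_vec n \<and> v \<bullet> v \<le> 1" and e: "0 \<le> e"
  shows "deviating S e \<in> sets P"
    and "P.prob (deviating S e) \<le> card S * (2 * exp (- (L * e\<^sup>2 / (2 * B\<^sup>2))))"
proof -
  show "deviating S e \<in> sets P"
    unfolding deviating_def using S deviating_event by (intro sets.finite_UN) auto
  have "P.prob (deviating S e) \<le> (\<Sum>v\<in>S. P.prob {g \<in> space P. e \<le> \<bar>v \<bullet> (avg_mat n L g *\<^sub>v v) - v \<bullet> (D *\<^sub>v v)\<bar>})"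
    unfolding deviating_def using S deviating_event by (intro P.finite_measure_subadditive_finite) auto
  also have "\<dots> \<le> (\<Sum>v\<in>S. 2 * exp (- (L * e\<^sup>2 / (2 * B\<^sup>2))))"
    using S e by (intro sum_mono hoeffding_quad) auto
  finally show "P.prob (deviating S e) \<le> card S * (2 * exp (- (L * e\<^sup>2 / (2 * B\<^sup>2))))" by simp
qed

text \<open>Off the event the error at a net point is below \<open>e\<close>. Passing to a unit
  vector \<open>y\<close> costs at most another \<open>e\<close>: the difference of the two
  quadratic forms factors as \<open>(y + v) \<bullet> (A *\<^sub>v (y - v))\<close>, which is at
  most \<open>2 * G * 2 * (e / (4 * G))\<close>. The resolution of the net is chosen for this
  product.\<close>

lemma not_deviating_quad:
  assumes S: "\<And>v. v \<in> S \<Longrightarrow> v \<in> carrier_vec n \<and> v \<bullet> v \<le> 1"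
    and net: "\<And>x. x \<in> carrier_vec n \<Longrightarrow> x \<bullet> x = 1 \<Longrightarrow> \<exists>v\<in>S. (x - v) \<bullet> (x - v) \<le> (e / (4 * G))\<^sup>2"
    and e: "0 < e" and g: "g \<in> space P" "g \<notin> deviating S e" and gG: "frob_norm (avg_mat n L g) \<le> G"
    and x: "x \<in> carrier_vec n"
  shows "\<bar>x \<bullet> ((avg_mat n L g - D) *\<^sub>v x)\<bar> \<le> 2 * e * (x \<bullet> x)"
proof (cases "x = 0\<^sub>v n")
  case True
  have "(avg_mat n L g - D) *\<^sub>v x \<in> carrier_vec n"
    using avg_mat_carrier sym_mats_carrier[OF D_sym] x by (metis minus_carrier_mat mult_mat_vec_carrier)
  then show ?thesis using True by simp
next
  case False
  define A where "A = avg_mat n L g - D"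
  have Dc: "D \<in> carrier_mat n n" using D_sym by (rule sym_mats_carrier)
  have As: "A \<in> sym_mats n" unfolding A_def by (intro sym_mats_diff avg_sym D_sym g)
  have Ac: "A \<in> carrier_mat n n" using As by (rule sym_mats_carrier)
  have AG: "frob_norm A \<le> 2 * G"
  proof -
    have "A = avg_mat n L g + (- 1) \<cdot>\<^sub>m D" unfolding A_def using avg_mat_carrier[of n L g] Dc by (intro eq_matI) auto
    then have "frob_norm A \<le> frob_norm (avg_mat n L g) + frob_norm ((- 1) \<cdot>\<^sub>m D)"
      using frob_norm_triangle[OF avg_mat_carrier, of "(- 1) \<cdot>\<^sub>m D"] Dc by simp
    then show ?thesis using gG mean_frob_norm frob_norm_smult[OF Dc, of "- 1"] by simp
  qed
  have unit: "\<bar>y \<bullet> (A *\<^sub>v y)\<bar> \<le> 2 * e" if y: "y \<in> carrier_vec n" "y \<bullet> y = 1" for y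
  proof -
    obtain v where v: "v \<in> S" "(y - v) \<bullet> (y - v) \<le> (e / (4 * G))\<^sup>2" using net[OF y] by blast
    have vc: "v \<in> carrier_vec n" "v \<bullet> v \<le> 1" using S v by auto
    have "\<bar>v \<bullet> (A *\<^sub>v v)\<bar> < e"
      using g v(1) mult_diff_mat_vec[OF avg_mat_carrier Dc vc(1) vc(1)]
      unfolding A_def deviating_def by (auto simp: not_le)
    moreover have "\<bar>(y + v) \<bullet> (A *\<^sub>v (y - v))\<bar> \<le> e"
    proof -
      have "sqrt ((y - v) \<bullet> (y - v)) \<le> e / (4 * G)"
        using real_sqrt_le_mono[OF v(2)] e G_pos by simp
      moreover have "sqrt ((y + v) \<bullet> (y + v)) \<le> 2"
      proof -
        have "(y + v) \<bullet> (y + v) = y \<bullet> y + 2 * (y \<bullet> v) + v \<bullet> v"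
          using y vc scalar_prod_comm[OF y(1) vc(1)]
          by (simp add: add_scalar_prod_distrib[of _ n] scalar_prod_add_distrib[of _ n])
        moreover have "y \<bullet> v \<le> 1"
        proof -
          have "y \<bullet> v \<le> sqrt (y \<bullet> y) * sqrt (v \<bullet> v)"
            using scalar_prod_cauchy_schwarz[OF y(1) vc(1)] by (simp add: abs_le_iff)
          also have "\<dots> \<le> 1" using y(2) vc(2) by simp
          finally show ?thesis .
        qed
        ultimately have "(y + v) \<bullet> (y + v) \<le> 2\<^sup>2" using y(2) vc(2) by simp
        then show ?thesis by (rule real_le_lsqrt[rotated]) simp
      qed
      ultimately have "sqrt ((y + v) \<bullet> (y + v)) * sqrt ((y - v) \<bullet> (y - v)) \<le> 2 * (e / (4 * G))"
        using scalar_prod_self_nonneg by (intro mult_mono) auto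
      then have "frob_norm A * (sqrt ((y + v) \<bullet> (y + v)) * sqrt ((y - v) \<bullet> (y - v))) \<le> (2 * G) * (2 * (e / (4 * G)))"
        by (rule mult_mono[OF AG]) (use G_pos scalar_prod_self_nonneg in auto)
      also have "\<dots> = e" using G_pos by simp
      finally show ?thesis using abs_bilinear_le[OF Ac, of "y - v" "y + v"] y vc by simp
    qed
    moreover have "(y + v) \<bullet> (A *\<^sub>v (y - v)) = y \<bullet> (A *\<^sub>v y) - v \<bullet> (A *\<^sub>v v)"
      using sym_bilinear[OF As y(1) vc(1)] y(1) vc(1) Ac
      by (simp add: mult_minus_distrib_mat_vec[of _ n n] add_scalar_prod_distrib[of _ n] scalar_prod_minus_distrib[of _ n])
    ultimately show ?thesis by linarith
  qed
  have xx: "0 < x \<bullet> x" using scalar_prod_self_pos[OF x False] .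
  define y where "y = (1 / sqrt (x \<bullet> x)) \<cdot>\<^sub>v x"
  have yc: "y \<in> carrier_vec n" using x by (simp add: y_def)
  have y1: "y \<bullet> y = 1" unfolding y_def using x xx by (simp add: field_simps)
  have "y \<bullet> (A *\<^sub>v y) = (x \<bullet> (A *\<^sub>v x)) / (x \<bullet> x)"
    unfolding y_def using Ac x xx by (simp add: mult_mat_vec[of _ n n] field_simps)
  then have "\<bar>x \<bullet> (A *\<^sub>v x)\<bar> / (x \<bullet> x) \<le> 2 * e"
    using unit[OF yc y1] by (simp only: abs_divide abs_of_pos[OF xx])
  then have "\<bar>x \<bullet> (A *\<^sub>v x)\<bar> \<le> 2 * e * (x \<bullet> x)" using xx by (simp only: pos_divide_le_eq)
  then show ?thesis unfolding A_def .
qed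

end

section \<open>The descent and rank potential\<close>

text \<open>With \<open>Q = r * \<beta> + q\<close> the radius is \<open>\<delta> / (8 * Q)\<close>,
  so \<open>r * \<beta> * R\<close> and \<open>q * R\<close> are each at most
  \<open>\<delta> / 8\<close>. The square of the second bound, with
  \<open>\<delta> \<le> 2 * B\<close>, limits both \<open>2 * B * E\<close> and
  \<open>r * \<delta> * E\<close> to \<open>\<delta> / 32\<close>. The total is at most
  \<open>\<delta> / 16 + \<delta> / 4 + r * \<delta> / 4\<close>, well below
  \<open>r * \<delta>\<close>.\<close>

lemma radius_numeric:
  fixes \<beta> B lam \<delta> E :: real and r :: nat
  assumes r: "1 \<le> r" and \<beta>: "0 \<le> \<beta>" and B: "0 < B" and lam: "0 < lam" and \<delta>: "0 < \<delta>" "\<delta> \<le> 2 * B"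
    and E: "lam\<^sup>2 * E \<le> (R0_radius r \<beta> B lam \<delta>)\<^sup>2"
  defines "R \<equiv> R0_radius r \<beta> B lam \<delta>"
  shows "0 < R" "2 * B * E + 2 * real r * (\<beta> * R + \<delta> / 8) + real r * \<delta> * E < real r * \<delta>"
proof -
  define q where "q = sqrt (2 * r) * B / lam"
  define Q where "Q = r * \<beta> + q"
  have q: "0 < q" using r B lam by (simp add: q_def)
  have Q: "0 < Q" using q \<beta> by (simp add: Q_def add_nonneg_pos)
  have R: "R = \<delta> / (8 * Q)" by (simp add: R_def R0_radius_def Q_def q_def field_simps)
  show R0: "0 < R" using R Q \<delta> by simp
  have QR: "Q * R = \<delta> / 8" using R Q by simp
  have a: "r * \<beta> * R \<le> \<delta> / 8" and b: "q * R \<le> \<delta> / 8"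
    using QR q \<beta> R0 mult_pos_pos[OF q R0] mult_nonneg_nonneg[of "r * \<beta>" R] by (auto simp: Q_def distrib_right)
  have "(q * R)\<^sup>2 \<le> (\<delta> / 8)\<^sup>2" using b q R0 by (intro power_mono) auto
  moreover have "(q * R)\<^sup>2 = 2 * r * B\<^sup>2 * (R\<^sup>2 / lam\<^sup>2)"
    by (simp add: q_def power_mult_distrib power_divide)
  moreover have "E \<le> R\<^sup>2 / lam\<^sup>2" using E lam by (simp add: R_def pos_le_divide_eq mult.commute)
  then have "2 * r * B\<^sup>2 * E \<le> 2 * r * B\<^sup>2 * (R\<^sup>2 / lam\<^sup>2)" by (intro mult_left_mono) auto
  ultimately have "2 * r * B\<^sup>2 * E \<le> (\<delta> / 8)\<^sup>2" by linarith
  then have key: "2 * B\<^sup>2 * (r * E) \<le> \<delta>\<^sup>2 / 64" by (simp add: power_divide mult_ac)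
  have "B * (2 * B * (r * E)) \<le> B * (\<delta> / 32)"
  proof -
    have "\<delta> * \<delta> \<le> \<delta> * (2 * B)" using \<delta> by (intro mult_left_mono) auto
    then have "\<delta> * \<delta> \<le> 2 * (B * \<delta>)" by (simp add: mult_ac)
    then show ?thesis using key by (simp add: power2_eq_square)
  qed
  then have BE: "2 * B * (r * E) \<le> \<delta> / 32" using B by simp
  have "2 * B * E \<le> \<delta> / 32"
  proof (cases "0 \<le> E")
    case True
    then have "E \<le> r * E" using r by (simp add: mult_le_cancel_right1)
    then have "2 * B * E \<le> 2 * B * (r * E)" using B by (intro mult_left_mono) auto
    then show ?thesis using BE by simp
  next
    case False
    then have "2 * B * E \<le> 0" using B by (simp add: mult_nonneg_nonpos)
    then show ?thesis using \<delta> by simp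
  qed
  moreover have "r * \<delta> * E \<le> \<delta> / 32"
  proof -
    have "(2 * B) * (r * E) \<le> (2 * B) * (1 / 32)" using BE \<delta> by linarith
    then have "r * E \<le> 1 / 32" by (rule mult_left_le_imp_le) (use B in simp)
    then have "\<delta> * (r * E) \<le> \<delta> * (1 / 32)" using \<delta> by (intro mult_left_mono) auto
    then show ?thesis by (simp add: mult_ac)
  qed
  moreover have "2 * real r * (\<beta> * R + \<delta> / 8) \<le> \<delta> / 4 + r * \<delta> / 4" using a by (simp add: algebra_simps)
  moreover have "\<delta> \<le> r * \<delta>" using r \<delta> by simp
  ultimately show "2 * B * E + 2 * real r * (\<beta> * R + \<delta> / 8) + real r * \<delta> * E < real r * \<delta>" using \<delta> by linarith
qed

section \<open>The problem data and the rank of one step\<close>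

locale low_rank_problem =
  fixes n r :: nat and \<beta> G B \<sigma> \<delta> lam :: real
    and f :: "real mat \<Rightarrow> real" and grad :: "real mat \<Rightarrow> real mat" and Or :: "real mat \<Rightarrow> real mat measure"
    and Xs :: "real mat" and R0 :: real
  assumes conv: "convex_on_sym n f" and smooth: "smooth_with_gradient n \<beta> f grad"
    and G: "0 < G" and B: "0 < B" and answers: "stochastic_oracle n grad G B \<sigma> Or"
    and opt: "is_arg_min f (\<lambda>X. X \<in> spectrahedron n) Xs"
    and rk: "vec_space.rank n Xs = r" and rn: "r < n" and lam: "lam = lambda_desc r Xs"
    and \<delta>: "0 < \<delta>" "\<delta> \<le> lambda_desc (n - r) (grad Xs) - lambda_desc n (grad Xs)"
    and R0: "R0 = R0_radius r \<beta> B lam \<delta>"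
begin

lemma n_pos: "0 < n" using rn by simp

lemma Xs: "Xs \<in> spectrahedron n" using opt by (simp add: is_arg_min_def)

lemma f_min: "X \<in> spectrahedron n \<Longrightarrow> f Xs \<le> f X" using opt by (simp add: is_arg_min_linorder)

lemma opt_value_eq: "opt_value n f = f Xs"
  unfolding opt_value_def using Xs f_min by (intro cInf_eq_minimum) auto

lemma gradient: "X \<in> sym_mats n \<Longrightarrow> has_gradient_sym n f (grad X) X"
  using smooth by (simp add: smooth_with_gradient_def)

lemma grad_sym: "X \<in> sym_mats n \<Longrightarrow> grad X \<in> sym_mats n"
  using gradient by (simp add: has_gradient_sym_def)

lemma grad_lipschitz: "X \<in> sym_mats n \<Longrightarrow> Y \<in> sym_mats n \<Longrightarrow> frob_norm (grad X - grad Y) \<le> \<beta> * frob_norm (X - Y)"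
  using smooth by (simp add: smooth_with_gradient_def)

lemma query_kernel: "Or \<in> measurable (sym_borel n) (prob_algebra (sym_borel n))"
  using answers by (simp add: stochastic_oracle_def)

lemma query_law: assumes X: "X \<in> sym_mats n" shows "query_law (Or X) n (grad X) G B"
proof -
  have O: "sets (Or X) = sets (sym_borel n)" "prob_space (Or X)"
    using measurable_space[OF query_kernel, of X] X by (auto simp: space_prob_algebra)
  then interpret prob_space "Or X" by simp
  show ?thesis
    using O answers X grad_sym[OF X] G B by unfold_locales (auto simp: stochastic_oracle_def)
qed

lemma r_pos: "1 \<le> r"
proof (rule ccontr)
  assume "\<not> 1 \<le> r"
  obtain w e where w: "orthonormal n {..<n} w" and Xw: "Xs = spectral_sum n {..<n} w e"
    using spectral_decomposition[OF spectrahedronD(1)[OF Xs]] by blast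
  have "card {i\<in>{..<n}. e i \<noteq> 0} = 0" using rank_spectral_sum[OF w, of e] rk \<open>\<not> 1 \<le> r\<close> by (simp add: Xw)
  then have "sum e {..<n} = 0" by (intro sum.neutral) auto
  then show False using trace_spectral_sum_orthonormal[OF w, of e] spectrahedronD(3)[OF Xs] by (simp add: Xw)
qed

text \<open>The Lipschitz inequality between two distinct points forces the sign; such points exist
  because \<open>n\<close> is positive.\<close>

lemma beta_nonneg: "0 \<le> \<beta>"
proof -
  have s: "1\<^sub>m n \<in> sym_mats n" "0\<^sub>m n n \<in> sym_mats n" by (auto intro: sym_matsI)
  have "1\<^sub>m n \<noteq> (0\<^sub>m n n :: real mat)"
    using n_pos by (metis index_one_mat(1) index_zero_mat(1) zero_neq_one)
  then have "frob_norm (1\<^sub>m n - 0\<^sub>m n n) \<noteq> 0"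
    using frob_norm_eq_0[of "1\<^sub>m n" n "0\<^sub>m n n"] by auto
  then have "0 < frob_norm (1\<^sub>m n - 0\<^sub>m n n)"
    using frob_norm_nonneg[of "1\<^sub>m n - 0\<^sub>m n n"] by linarith
  moreover have "0 \<le> \<beta> * frob_norm (1\<^sub>m n - 0\<^sub>m n n)"
    using grad_lipschitz[OF s] frob_norm_nonneg order_trans by blast
  ultimately show ?thesis by (simp add: zero_le_mult_iff)
qed

lemma kkt: "\<exists>u d I. orthonormal n {..<n} u \<and> grad Xs = spectral_sum n {..<n} u d \<and> I \<subseteq> {..<n} \<and> card I = r \<and>
    (\<forall>i\<in>I. d i = lambda_desc n (grad Xs)) \<and> (\<forall>i\<in>{..<n} - I. lambda_desc n (grad Xs) + \<delta> \<le> d i) \<and>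
    (\<forall>i\<in>{..<n} - I. Xs *\<^sub>v u i = 0\<^sub>v n)"
  using kkt_structure[OF grad_sym[OF spectrahedronD(1)[OF Xs]] Xs
      first_order_optimality[OF gradient[OF spectrahedronD(1)[OF Xs]] opt] rk rn \<delta>] .

text \<open>\<open>X\<close> may have rank below \<open>r\<close>. The indices of its nonzero
  eigenvalues are padded to a set of size exactly \<open>r\<close>, so that it can be compared with
  the bottom eigenspace.\<close>

lemma low_rank_frame:
  assumes X: "X \<in> spectrahedron n" and rX: "vec_space.rank n X \<le> r"
  shows "\<exists>a c K. orthonormal n {..<n} a \<and> X = spectral_sum n {..<n} a c \<and> K \<subseteq> {..<n} \<and> card K = r \<and>
    (\<forall>k\<in>{..<n} - K. c k = 0) \<and> (\<forall>k\<in>{..<n} - K. X *\<^sub>v a k = 0\<^sub>v n)"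
proof -
  obtain a c where a: "orthonormal n {..<n} a" and Xa: "X = spectral_sum n {..<n} a c"
    using spectral_decomposition[OF spectrahedronD(1)[OF X]] by blast
  have "card {i\<in>{..<n}. c i \<noteq> 0} \<le> r" using rX rank_spectral_sum[OF a, of c] by (simp add: Xa)
  then obtain K where K: "{i\<in>{..<n}. c i \<noteq> 0} \<subseteq> K" "K \<subseteq> {..<n}" "card K = r"
    using exists_subset_between[of "{i\<in>{..<n}. c i \<noteq> 0}" r "{..<n}"] rn by auto
  have c0: "c k = 0" if "k \<in> {..<n} - K" for k using K(1) that by auto
  have "X *\<^sub>v a k = 0\<^sub>v n" if k: "k \<in> {..<n} - K" for k
    using spectral_sum_eigvec[OF a, of k c] c0[OF k] orthonormalD(2)[OF a, of k] k by (auto simp: Xa)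
  then show ?thesis using a Xa K c0 by blast
qed

lemma R0_pos: "0 < R0"
  and overlap: "lam\<^sup>2 * E \<le> R0\<^sup>2 \<Longrightarrow> 2 * B * E + 2 * real r * (\<beta> * R0 + \<delta> / 8) + real r * \<delta> * E < real r * \<delta>"
proof -
  obtain u d I where u: "orthonormal n {..<n} u" and N: "grad Xs = spectral_sum n {..<n} u d" and I: "I \<subseteq> {..<n}" "card I = r"
    and dI: "\<And>i. i \<in> I \<Longrightarrow> d i = lambda_desc n (grad Xs)"
    and dG: "\<And>i. i \<in> {..<n} - I \<Longrightarrow> lambda_desc n (grad Xs) + \<delta> \<le> d i"
    and z: "\<And>i. i \<in> {..<n} - I \<Longrightarrow> Xs *\<^sub>v u i = 0\<^sub>v n" using kkt by blast
  \<comment> \<open>The overlap bound is instantiated at \<open>X = Xs\<close> in order to read off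
    that \<open>lam\<close> is positive.\<close>
  obtain a c K where a: "orthonormal n {..<n} a" and K: "K \<subseteq> {..<n}" "card K = r"
    and aK: "\<And>k. k \<in> {..<n} - K \<Longrightarrow> Xs *\<^sub>v a k = 0\<^sub>v n" using low_rank_frame[OF Xs] rk by blast
  have lam0: "0 < lam" unfolding lam
    using range_overlap_bound(1)[OF u Xs I(1) z rk r_pos _ a spectrahedronD(2)[OF Xs] K aK] rn by simp
  interpret O: query_law "Or Xs" n "grad Xs" G B by (rule query_law[OF spectrahedronD(1)[OF Xs]])
  have dB: "\<bar>d i\<bar> \<le> B" if "i < n" for i
    using O.mean_quad[OF orthonormalD(2)[OF u, of i]] spectral_sum_eigvec[OF u, of i d] orthonormalD(2,3)[OF u, of i] that by (simp add: N)
  obtain i where i: "i \<in> I" using I r_pos by (metis card.empty equals0I not_one_le_zero)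
  have "I \<noteq> {..<n}" using I(2) rn by auto
  then obtain j where j: "j \<in> {..<n} - I" using I(1) by blast
  \<comment> \<open>The gap separates an eigenvalue indexed in \<open>I\<close> from one outside,
    and both lie between \<open>- B\<close> and \<open>B\<close>.\<close>
  have d2: "\<delta> \<le> 2 * B" using dI[OF i] dG[OF j] dB[of i] dB[of j] i j I(1) by force
  show "0 < R0" using radius_numeric(1)[OF r_pos beta_nonneg B lam0 \<delta>(1) d2, of 0] by (simp add: R0)
  show "lam\<^sup>2 * E \<le> R0\<^sup>2 \<Longrightarrow> 2 * B * E + 2 * real r * (\<beta> * R0 + \<delta> / 8) + real r * \<delta> * E < real r * \<delta>"
    using radius_numeric(2)[OF r_pos beta_nonneg B lam0 \<delta>(1) d2] by (simp add: R0)
qed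

text \<open>Relative to the gradient at \<open>Xs\<close> the error is
  \<open>\<beta> * R0 + \<delta> / 8\<close>: the drift of the gradient over a distance of at most
  \<open>R0\<close>, plus the sampling error. The spread \<open>M\<close> of the eigenvalues of that
  gradient is taken as \<open>2 * B\<close>.\<close>

lemma step_rank:
  assumes X: "X \<in> spectrahedron n" and rX: "vec_space.rank n X \<le> r" and dX: "frob_norm (X - Xs) \<le> R0"
    and g: "g \<in> sym_mats n"
    and err: "\<And>x. x \<in> carrier_vec n \<Longrightarrow> \<bar>x \<bullet> ((g - grad X) *\<^sub>v x)\<bar> \<le> \<delta> / 8 * (x \<bullet> x)" and eta: "0 < \<eta>"
  shows "vec_space.rank n (spectrahedron_proj n (X - \<eta> \<cdot>\<^sub>m g)) \<le> r"
proof -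
  obtain u d I where u: "orthonormal n {..<n} u" and N: "grad Xs = spectral_sum n {..<n} u d" and I: "I \<subseteq> {..<n}" "card I = r"
    and dI: "\<And>i. i \<in> I \<Longrightarrow> d i = lambda_desc n (grad Xs)"
    and dG: "\<And>i. i \<in> {..<n} - I \<Longrightarrow> lambda_desc n (grad Xs) + \<delta> \<le> d i"
    and z: "\<And>i. i \<in> {..<n} - I \<Longrightarrow> Xs *\<^sub>v u i = 0\<^sub>v n" using kkt by blast
  obtain a c K where a: "orthonormal n {..<n} a" and Xa: "X = spectral_sum n {..<n} a c" and K: "K \<subseteq> {..<n}" "card K = r"
    and cK: "\<And>k. k \<in> {..<n} - K \<Longrightarrow> c k = 0"
    and aK: "\<And>k. k \<in> {..<n} - K \<Longrightarrow> X *\<^sub>v a k = 0\<^sub>v n" using low_rank_frame[OF X rX] by blast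
  define E where "E = real r - (\<Sum>k\<in>K. \<Sum>i\<in>I. (u i \<bullet> a k)\<^sup>2)"
  have "lam\<^sup>2 * E \<le> (frob_norm (X - Xs))\<^sup>2" unfolding lam E_def
    using range_overlap_bound(2)[OF u Xs I(1) z rk r_pos _ a spectrahedronD(2)[OF X] K aK] rn by simp
  also have "\<dots> \<le> R0\<^sup>2" using dX by (intro power_mono) auto
  finally have num: "2 * B * E + 2 * real r * (\<beta> * R0 + \<delta> / 8) + real r * \<delta> * E < real r * \<delta>" by (rule overlap)
  interpret O: query_law "Or Xs" n "grad Xs" G B by (rule query_law[OF spectrahedronD(1)[OF Xs]])
  have dB: "\<bar>d i\<bar> \<le> B" if "i < n" for i
    using O.mean_quad[OF orthonormalD(2)[OF u, of i]] spectral_sum_eigvec[OF u, of i d] orthonormalD(2,3)[OF u, of i] that by (simp add: N)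
  obtain i0 where i0: "i0 \<in> I" using I r_pos by (metis card.empty equals0I not_one_le_zero)
  have up: "d i \<le> lambda_desc n (grad Xs) + 2 * B" if "i < n" for i
    using dB[OF that] dB[of i0] dI[OF i0] i0 I(1) by force
  note sX = spectrahedronD(1)[OF X] and sXs = spectrahedronD(1)[OF Xs]
  note c = sym_mats_carrier[OF g] sym_mats_carrier[OF grad_sym[OF sX]] sym_mats_carrier[OF grad_sym[OF sXs]]
  have err': "\<bar>x \<bullet> ((g - grad Xs) *\<^sub>v x)\<bar> \<le> (\<beta> * R0 + \<delta> / 8) * (x \<bullet> x)" if x: "x \<in> carrier_vec n" for x
  proof -
    have "x \<bullet> ((g - grad Xs) *\<^sub>v x) = x \<bullet> ((g - grad X) *\<^sub>v x) + x \<bullet> ((grad X - grad Xs) *\<^sub>v x)"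
      unfolding mult_diff_mat_vec[OF c(1) c(3) x x] mult_diff_mat_vec[OF c(1) c(2) x x] mult_diff_mat_vec[OF c(2) c(3) x x]
      by simp
    moreover have "\<bar>x \<bullet> ((grad X - grad Xs) *\<^sub>v x)\<bar> \<le> \<beta> * R0 * (x \<bullet> x)"
    proof -
      have "\<bar>x \<bullet> ((grad X - grad Xs) *\<^sub>v x)\<bar> \<le> frob_norm (grad X - grad Xs) * (x \<bullet> x)"
        using c x by (intro abs_quad_le) auto
      also have "frob_norm (grad X - grad Xs) \<le> \<beta> * R0"
        using grad_lipschitz[OF sX sXs] mult_left_mono[OF dX beta_nonneg] by linarith
      finally show ?thesis using scalar_prod_self_nonneg[of x] by (simp add: mult_right_mono)
    qed
    ultimately show ?thesis using err[OF x] by (simp add: distrib_right)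
  qed
  show ?thesis
    by (rule rank_proj_step_le[OF N u I dI dG up a Xa X K cK g err' eta n_pos \<delta>(1) E_def num])
qed

end

text \<open>The resolution of \<open>S\<close> belongs to the deviation level
  \<open>e = \<delta> / 16\<close>: off the deviation event the quadratic error is at most
  \<open>2 * e = \<delta> / 8\<close>, which is what \<open>step_rank\<close> tolerates.\<close>

locale psgd_run = low_rank_problem +
  fixes \<eta> :: real and L :: nat and S :: "real vec set" and X1 :: "real mat"
  assumes eta: "0 < \<eta>" and L: "1 \<le> L"
    and S: "finite S" "\<And>v. v \<in> S \<Longrightarrow> v \<in> carrier_vec n \<and> v \<bullet> v \<le> 1"
    and net: "\<And>x. x \<in> carrier_vec n \<Longrightarrow> x \<bullet> x = 1 \<Longrightarrow> \<exists>v\<in>S. (x - v) \<bullet> (x - v) \<le> (\<delta> / 16 / (4 * G))\<^sup>2"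
    and X1: "X1 \<in> spectrahedron n" "vec_space.rank n X1 \<le> r" "frob_norm (X1 - Xs) \<le> R0 / 2"
begin

section \<open>The iterates as a Markov chain\<close>

abbreviation hist :: "nat \<Rightarrow> (nat \<Rightarrow> real mat) measure" where
  "hist k \<equiv> Pi\<^sub>M {1..Suc k} (\<lambda>_. sym_borel n)"

abbreviation law :: "nat \<Rightarrow> (nat \<Rightarrow> real mat) measure" where
  "law k \<equiv> psgd_law n Or (\<lambda>_. \<eta>) L X1 k"

abbreviation batch :: "real mat \<Rightarrow> (nat \<Rightarrow> real mat) measure" where
  "batch X \<equiv> Pi\<^sub>M {1..L} (\<lambda>_. Or X)"

text \<open>Iterates are counted from 1 and \<open>law k\<close> describes \<open>k + 1\<close> of
  them, so the current one sits at \<open>Suc k\<close> and the new one is written to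
  \<open>Suc (Suc k)\<close>.\<close>

definition update :: "nat \<Rightarrow> (nat \<Rightarrow> real mat) \<Rightarrow> (nat \<Rightarrow> real mat) \<Rightarrow> nat \<Rightarrow> real mat" where
  "update k w g = w(Suc (Suc k) := spectrahedron_proj n (w (Suc k) - \<eta> \<cdot>\<^sub>m avg_mat n L g))"

definition kernel :: "nat \<Rightarrow> (nat \<Rightarrow> real mat) \<Rightarrow> (nat \<Rightarrow> real mat) measure" where
  "kernel k w = distr (batch (w (Suc k))) (hist (Suc k)) (update k w)"

lemma law_Suc: "law (Suc k) = law k \<bind> kernel k"
  by (simp add: kernel_def[abs_def] update_def[abs_def] Let_def)

lemma hist_sym: "w \<in> space (hist k) \<Longrightarrow> t \<in> {1..Suc k} \<Longrightarrow> w t \<in> sym_mats n"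
  by (auto simp: space_PiM)

lemma hist_component: "t \<in> {1..Suc k} \<Longrightarrow> (\<lambda>w. w t) \<in> measurable (hist k) (sym_borel n)"
  by (rule measurable_component_singleton)

lemma batch_kernel: "(\<lambda>w. batch (w (Suc k))) \<in> measurable (hist k) (prob_algebra (Pi\<^sub>M {1..L} (\<lambda>_. sym_borel n)))"
  by (rule measurable_compose[OF hist_component measurable_PiM_kernel[OF query_kernel]]) auto

text \<open>Joint measurability in history and batch is what lets the push-forward of the batch law
  be a kernel in the history.\<close>

lemma update_measurable:
  "(\<lambda>(w, g). update k w g) \<in> measurable (hist k \<Otimes>\<^sub>M Pi\<^sub>M {1..L} (\<lambda>_. sym_borel n)) (hist (Suc k))"
proof -
  let ?N = "hist k \<Otimes>\<^sub>M Pi\<^sub>M {1..L} (\<lambda>_. sym_borel n)"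
  have w: "(\<lambda>p. fst p (Suc k)) \<in> measurable ?N (sym_borel n)"
    by (rule measurable_compose[OF measurable_fst hist_component]) auto
  have a: "(\<lambda>p. avg_mat n L (snd p)) \<in> measurable ?N (sym_borel n)"
    by (rule measurable_compose[OF measurable_snd measurable_avg_mat]) auto
  have "(\<lambda>p. fst p (Suc k) - \<eta> \<cdot>\<^sub>m avg_mat n L (snd p)) \<in> measurable ?N (sym_borel n)"
  proof (rule measurable_sym_borelI)
    fix p assume "p \<in> space ?N"
    then have "fst p (Suc k) \<in> sym_mats n" "avg_mat n L (snd p) \<in> sym_mats n"
      using measurable_space[OF w] measurable_space[OF a] by auto
    then show "fst p (Suc k) - \<eta> \<cdot>\<^sub>m avg_mat n L (snd p) \<in> sym_mats n"
      by (intro sym_mats_diff sym_mats_smult)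
  next
    fix i j assume ij: "i < n" "j < n"
    have "(\<lambda>p. fst p (Suc k) $$ (i, j) - \<eta> * avg_mat n L (snd p) $$ (i, j)) \<in> borel_measurable ?N"
      using measurable_compose[OF w measurable_sym_borel_entry[OF ij]]
        measurable_compose[OF a measurable_sym_borel_entry[OF ij]]
      by (intro borel_measurable_diff borel_measurable_times) auto
    then show "(\<lambda>p. (fst p (Suc k) - \<eta> \<cdot>\<^sub>m avg_mat n L (snd p)) $$ (i, j)) \<in> borel_measurable ?N"
      using ij carrier_matD[OF avg_mat_carrier] by simp
  qed
  then have y: "(\<lambda>p. spectrahedron_proj n (fst p (Suc k) - \<eta> \<cdot>\<^sub>m avg_mat n L (snd p))) \<in> measurable ?N (sym_borel n)"
    by (rule measurable_compose[OF _ measurable_spectrahedron_proj[OF n_pos]])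
  have "(\<lambda>p. (fst p)(Suc (Suc k) := spectrahedron_proj n (fst p (Suc k) - \<eta> \<cdot>\<^sub>m avg_mat n L (snd p)))) \<in>
      measurable ?N (Pi\<^sub>M (insert (Suc (Suc k)) {1..Suc k}) (\<lambda>_. sym_borel n))"
    using measurable_compose[OF measurable_Pair[OF measurable_fst y] measurable_add_dim] by simp
  moreover have "insert (Suc (Suc k)) {1..Suc k} = {1..Suc (Suc k)}" by auto
  ultimately show ?thesis by (simp add: update_def case_prod_beta)
qed

lemma kernel_measurable: "kernel k \<in> measurable (hist k) (prob_algebra (hist (Suc k)))"
  unfolding kernel_def[abs_def] by (rule measurable_distr_prob_space2[OF batch_kernel update_measurable])

lemma law_space: "law k \<in> space (prob_algebra (hist k))"
proof (induction k)
  case 0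
  have "restrict (\<lambda>_. X1) {1..1} \<in> space (hist 0)"
    using spectrahedronD(1)[OF X1(1)] by (auto simp: space_PiM)
  then show ?case by (auto simp: space_prob_algebra intro!: prob_space_return)
next
  case (Suc k)
  then show ?case unfolding law_Suc
    using sets_bind'[OF Suc kernel_measurable] prob_space_bind'[OF Suc kernel_measurable]
    by (simp add: space_prob_algebra)
qed

lemma sets_law: "sets (law k) = sets (hist k)" and prob_space_law: "prob_space (law k)"
  using law_space by (auto simp: space_prob_algebra)

lemma sets_batch: "X \<in> sym_mats n \<Longrightarrow> sets (batch X) = sets (Pi\<^sub>M {1..L} (\<lambda>_. sym_borel n))"
  using query_law.sets_M[OF query_law] by (intro sets_PiM_cong) auto

lemma update_measurable_batch:
  assumes w: "w \<in> space (hist k)"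
  shows "update k w \<in> measurable (batch (w (Suc k))) (hist (Suc k))"
proof -
  have "update k w \<in> measurable (Pi\<^sub>M {1..L} (\<lambda>_. sym_borel n)) (hist (Suc k))"
    using measurable_compose[OF measurable_Pair1'[OF w] update_measurable] by simp
  then show ?thesis using measurable_cong_sets[OF sets_batch[OF hist_sym[OF w, of "Suc k"]] refl] by auto
qed

text \<open>The tower property: integrate over the fresh batch given the history, then over the
  history. It reduces the drift estimate to a fixed history.\<close>

lemma nn_integral_law_Suc:
  assumes h: "h \<in> borel_measurable (hist (Suc k))"
  shows "(\<integral>\<^sup>+w. h w \<partial>law (Suc k)) = (\<integral>\<^sup>+w. (\<integral>\<^sup>+g. h (update k w g) \<partial>batch (w (Suc k))) \<partial>law k)"
proof -
  have K: "kernel k \<in> measurable (law k) (subprob_algebra (hist (Suc k)))"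
    using measurable_prob_algebraD[OF kernel_measurable] measurable_cong_sets[OF sets_law refl] by blast
  have "(\<integral>\<^sup>+w. h w \<partial>law (Suc k)) = (\<integral>\<^sup>+w. \<integral>\<^sup>+y. h y \<partial>kernel k w \<partial>law k)"
    unfolding law_Suc by (rule nn_integral_bind[OF h K])
  also have "\<dots> = (\<integral>\<^sup>+w. (\<integral>\<^sup>+g. h (update k w g) \<partial>batch (w (Suc k))) \<partial>law k)"
  proof (rule nn_integral_cong)
    fix w assume "w \<in> space (law k)"
    then have w: "w \<in> space (hist k)" using sets_eq_imp_space_eq[OF sets_law] by simp
    show "(\<integral>\<^sup>+y. h y \<partial>kernel k w) = (\<integral>\<^sup>+g. h (update k w g) \<partial>batch (w (Suc k)))"
      unfolding kernel_def using update_measurable_batch[OF w] h by (intro nn_integral_distr) auto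
  qed
  finally show ?thesis .
qed

section \<open>The stopped potential and its drift\<close>

definition excess :: "real mat \<Rightarrow> real" where "excess X = f X - f Xs"

text \<open>All iterates so far are inspected, not only the last one, so that a failure is never
  forgotten: once false, the predicate stays false along the run.\<close>

definition good :: "nat \<Rightarrow> (nat \<Rightarrow> real mat) \<Rightarrow> bool" where
  "good k w \<longleftrightarrow> (\<forall>t\<in>{1..Suc k}. w t \<in> spectrahedron n \<and> frob_norm (w t - Xs) \<le> R0 \<and> vec_space.rank n (w t) \<le> r)"

text \<open>
  The potential is frozen at \<open>R0\<^sup>2\<close> once an iterate has left the ball or the rank bound has failed,
  so its expectation controls both the failure probability and the accumulated excess.
\<close>
definition potential :: "nat \<Rightarrow> (nat \<Rightarrow> real mat) \<Rightarrow> real" where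
  "potential k w = (if good k w then (frob_norm (w (Suc k) - Xs))\<^sup>2 + 2 * \<eta> * (\<Sum>t=1..k. excess (w t)) else R0\<^sup>2)"

text \<open>The union bound over the net of the tail estimate at level \<open>\<delta> / 16\<close>,
  that is, the chance that one mini-batch invalidates the rank argument.\<close>

definition fail_prob :: real where
  "fail_prob = card S * (2 * exp (- (L * (\<delta> / 16)\<^sup>2 / (2 * B\<^sup>2))))"

lemma fail_prob_nonneg: "0 \<le> fail_prob" by (simp add: fail_prob_def)

lemma excess_nonneg: "X \<in> spectrahedron n \<Longrightarrow> 0 \<le> excess X"
  using f_min by (simp add: excess_def)

lemma excess_measurable: "excess \<in> borel_measurable (sym_borel n)"
  unfolding excess_def[abs_def] using gradient_measurable[OF gradient] by auto

lemma good_measurable: "Measurable.pred (hist k) (good k)"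
  unfolding good_def
proof (intro pred_intros_finite pred_intros_logic)
  fix t assume t: "t \<in> {1..Suc k}"
  note c = hist_component[OF t]
  show "Measurable.pred (hist k) (\<lambda>w. w t \<in> spectrahedron n)"
    by (rule measurable_compose[OF c]) (use spectrahedron_measurable[OF n_pos] in \<open>auto simp: pred_sets2\<close>)
  have "(\<lambda>w. frob_norm (w t - Xs)) \<in> borel_measurable (hist k)"
    by (rule measurable_compose[OF c measurable_frob_dist[OF spectrahedronD(1)[OF Xs]]])
  then show "Measurable.pred (hist k) (\<lambda>w. frob_norm (w t - Xs) \<le> R0)" by measurable
  show "Measurable.pred (hist k) (\<lambda>w. vec_space.rank n (w t) \<le> r)"
    by (rule measurable_compose[OF c rank_le_measurable])
qed auto

lemma potential_measurable: "potential k \<in> borel_measurable (hist k)"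
proof -
  have "(\<lambda>w. frob_norm (w (Suc k) - Xs)) \<in> borel_measurable (hist k)"
    by (rule measurable_compose[OF hist_component measurable_frob_dist[OF spectrahedronD(1)[OF Xs]]]) auto
  moreover have "(\<lambda>w. \<Sum>t=1..k. excess (w t)) \<in> borel_measurable (hist k)"
    by (intro borel_measurable_sum measurable_compose[OF hist_component excess_measurable]) auto
  ultimately show ?thesis unfolding potential_def[abs_def]
    using good_measurable by (intro measurable_If) auto
qed

lemma potential_nonneg: "0 \<le> potential k w"
  using eta by (auto simp: potential_def good_def intro!: add_nonneg_nonneg mult_nonneg_nonneg sum_nonneg excess_nonneg)

lemma good_update:
  "good (Suc k) (update k w g) \<longleftrightarrow> good k w \<and> update k w g (Suc (Suc k)) \<in> spectrahedron n \<and>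
     frob_norm (update k w g (Suc (Suc k)) - Xs) \<le> R0 \<and> vec_space.rank n (update k w g (Suc (Suc k))) \<le> r"
proof -
  have "{1..Suc (Suc k)} = insert (Suc (Suc k)) {1..Suc k}" by auto
  moreover have "update k w g t = w t" if "t \<in> {1..Suc k}" for t using that by (auto simp: update_def)
  ultimately show ?thesis unfolding good_def by auto
qed

lemma one_step:
  assumes w: "w \<in> space (hist k)"
  shows "(\<integral>\<^sup>+g. ennreal (potential (Suc k) (update k w g)) \<partial>batch (w (Suc k))) \<le>
    ennreal (potential k w + (\<eta>\<^sup>2 * G\<^sup>2 + R0\<^sup>2 * fail_prob))"
proof -
  define X where "X = w (Suc k)"
  have Xsym: "X \<in> sym_mats n" unfolding X_def using hist_sym[OF w] by auto
  interpret Q: query_law "Or X" n "grad X" G B by (rule query_law[OF Xsym])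
  interpret M: minibatch "Or X" n "grad X" G B L by unfold_locales (rule L)
  show ?thesis
  proof (cases "good k w")
    case False
    then have "potential (Suc k) (update k w g) = R0\<^sup>2" for g by (simp add: potential_def good_update)
    moreover have "potential k w = R0\<^sup>2" using False by (simp add: potential_def)
    ultimately have "(\<integral>\<^sup>+g. ennreal (potential (Suc k) (update k w g)) \<partial>batch (w (Suc k))) = ennreal (potential k w)"
      using M.P.emeasure_space_1 by (simp add: X_def)
    also have "\<dots> \<le> ennreal (potential k w + (\<eta>\<^sup>2 * G\<^sup>2 + R0\<^sup>2 * fail_prob))"
      using fail_prob_nonneg by (intro ennreal_leI) simp
    finally show ?thesis .
  next
    case True
    then have X: "X \<in> spectrahedron n" "frob_norm (X - Xs) \<le> R0" "vec_space.rank n X \<le> r"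
      unfolding good_def X_def by auto
    note Xc = spectrahedronD(2)[OF X(1)] and Xsc = spectrahedronD(2)[OF Xs]
    define Dv where "Dv = M.deviating S (\<delta> / 16)"
    have e: "0 < \<delta> / 16" using \<delta> by simp
    have Dv: "Dv \<in> sets (batch X)" "M.P.prob Dv \<le> fail_prob"
      unfolding Dv_def fail_prob_def using M.deviating_prob[OF S less_imp_le[OF e]] by auto
    \<comment> \<open>One term more than in \<open>potential k w\<close>: the excess of the current
      iterate enters now, and the expected decrease of the squared distance compensates it.\<close>
    define S0 where "S0 = 2 * \<eta> * (\<Sum>t=1..Suc k. excess (w t))"
    have S0: "0 \<le> S0" unfolding S0_def using True eta
      by (intro mult_nonneg_nonneg sum_nonneg excess_nonneg) (auto simp: good_def)
    define q where "q = (\<lambda>g. (frob_norm (X - Xs))\<^sup>2 - 2 * \<eta> * frob_inner (avg_mat n L g) (X - Xs) + \<eta>\<^sup>2 * G\<^sup>2)"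
    define b where "b = (\<lambda>g. q g + S0 + R0\<^sup>2 * indicator Dv g)"
    have AEb: "AE g in batch X. potential (Suc k) (update k w g) \<le> b g"
      using M.AE_avg_frob_norm
    proof (rule AE_mp, intro AE_I2 impI)
      fix g assume g: "g \<in> space (batch X)" and gG: "frob_norm (avg_mat n L g) \<le> G"
      define X' where "X' = spectrahedron_proj n (X - \<eta> \<cdot>\<^sub>m avg_mat n L g)"
      have ag: "avg_mat n L g \<in> sym_mats n" using g by (rule M.avg_sym)
      have Ys: "X - \<eta> \<cdot>\<^sub>m avg_mat n L g \<in> sym_mats n" by (intro sym_mats_diff sym_mats_smult Xsym ag)
      have X'S: "X' \<in> spectrahedron n" unfolding X'_def by (rule spectrahedron_proj_props(2)[OF Ys n_pos])
      have up: "update k w g (Suc (Suc k)) = X'" by (simp add: update_def X'_def X_def)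
      have upt: "update k w g t = w t" if "t \<in> {1..Suc k}" for t using that by (auto simp: update_def)
      have "frob_norm (X' - Xs) \<le> frob_norm (X - \<eta> \<cdot>\<^sub>m avg_mat n L g - Xs)"
        unfolding X'_def by (rule spectrahedron_proj_nonexpansive_to[OF Ys n_pos Xs])
      then have "(frob_norm (X' - Xs))\<^sup>2 \<le> (frob_norm (X - \<eta> \<cdot>\<^sub>m avg_mat n L g - Xs))\<^sup>2"
        by (intro power_mono) auto
      also have "X - \<eta> \<cdot>\<^sub>m avg_mat n L g - Xs = (X - Xs) - \<eta> \<cdot>\<^sub>m avg_mat n L g"
        using Xc Xsc carrier_matD[OF avg_mat_carrier] by (intro eq_matI) auto
      also have "(frob_norm \<dots>)\<^sup>2 = (frob_norm (X - Xs))\<^sup>2 - 2 * frob_inner (X - Xs) (\<eta> \<cdot>\<^sub>m avg_mat n L g) +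
          (frob_norm (\<eta> \<cdot>\<^sub>m avg_mat n L g))\<^sup>2"
        using Xsc by (intro frob_norm_diff_square) auto
      also have "frob_inner (X - Xs) (\<eta> \<cdot>\<^sub>m avg_mat n L g) = \<eta> * frob_inner (avg_mat n L g) (X - Xs)"
        using Xsc frob_inner_comm[of "X - Xs" n "avg_mat n L g"] by (subst frob_inner_smult_right[of _ n]) auto
      also have "(frob_norm (\<eta> \<cdot>\<^sub>m avg_mat n L g))\<^sup>2 = \<eta>\<^sup>2 * (frob_norm (avg_mat n L g))\<^sup>2"
        by (subst frob_norm_smult[OF avg_mat_carrier]) (simp add: power_mult_distrib)
      also have "\<eta>\<^sup>2 * (frob_norm (avg_mat n L g))\<^sup>2 \<le> \<eta>\<^sup>2 * G\<^sup>2"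
        using gG by (intro mult_left_mono power_mono) auto
      finally have X'q: "(frob_norm (X' - Xs))\<^sup>2 \<le> q g" by (simp add: q_def)
      then have q0: "0 \<le> q g" using order_trans[OF zero_le_power2] by blast
      show "potential (Suc k) (update k w g) \<le> b g"
      proof (cases "good (Suc k) (update k w g)")
        case True
        have "potential (Suc k) (update k w g) = (frob_norm (X' - Xs))\<^sup>2 + S0"
          using True upt by (simp add: potential_def up S0_def)
        also have "\<dots> \<le> b g" using X'q by (simp add: b_def add_increasing2)
        finally show ?thesis .
      next
        case bad: False
        then have pR: "potential (Suc k) (update k w g) = R0\<^sup>2" by (simp add: potential_def)
        show ?thesis
        proof (cases "frob_norm (X' - Xs) \<le> R0")
          case False
          then have "R0\<^sup>2 \<le> (frob_norm (X' - Xs))\<^sup>2" using R0_pos by (intro power_mono) auto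
          then have "R0\<^sup>2 \<le> q g + S0 + 0" using X'q S0 by simp
          also have "\<dots> \<le> b g" unfolding b_def by (intro add_left_mono) auto
          finally show ?thesis using pR by simp
        next
          case inside: True
          then have rk': "\<not> vec_space.rank n X' \<le> r"
            using bad \<open>good k w\<close> X'S by (simp add: good_update up)
          have "g \<in> Dv"
          proof (rule ccontr)
            assume "g \<notin> Dv"
            then have nd: "g \<notin> M.deviating S (\<delta> / 16)" by (simp only: Dv_def not_False_eq_True)
            have err: "\<bar>x \<bullet> ((avg_mat n L g - grad X) *\<^sub>v x)\<bar> \<le> 2 * (\<delta> / 16) * (x \<bullet> x)" if "x \<in> carrier_vec n" for x
              by (rule M.not_deviating_quad[OF S(2) net e g nd gG that])
            have "vec_space.rank n X' \<le> r" unfolding X'_def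
            proof (rule step_rank[OF X(1,3,2) ag _ eta])
              show "\<bar>x \<bullet> ((avg_mat n L g - grad X) *\<^sub>v x)\<bar> \<le> \<delta> / 8 * (x \<bullet> x)" if "x \<in> carrier_vec n" for x
                using err[OF that] by linarith
            qed
            then show False using rk' by simp
          qed
          then show ?thesis using q0 S0 pR by (simp add: b_def)
        qed
      qed
    qed
    have qi: "integrable (batch X) q" "M.P.expectation q = (frob_norm (X - Xs))\<^sup>2 - 2 * \<eta> * frob_inner (grad X) (X - Xs) + \<eta>\<^sup>2 * G\<^sup>2"
    proof -
      note ai = M.avg_frob_integral[of "X - Xs"]
      have i1: "integrable (batch X) (\<lambda>g. (frob_norm (X - Xs))\<^sup>2)" "integrable (batch X) (\<lambda>g. \<eta>\<^sup>2 * G\<^sup>2)"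
        by (rule M.P.integrable_const)+
      have i2: "integrable (batch X) (\<lambda>g. 2 * \<eta> * frob_inner (avg_mat n L g) (X - Xs))"
        by (rule integrable_mult_right) (rule ai(1))
      note i3 = Bochner_Integration.integrable_diff[OF i1(1) i2]
      show "integrable (batch X) q" unfolding q_def by (rule Bochner_Integration.integrable_add[OF i3 i1(2)])
      have const: "(LINT g|batch X. z) = z" for z :: real using M.P.prob_space by simp
      have "M.P.expectation q = (LINT g|batch X. (frob_norm (X - Xs))\<^sup>2 - 2 * \<eta> * frob_inner (avg_mat n L g) (X - Xs)) + \<eta>\<^sup>2 * G\<^sup>2"
        unfolding q_def Bochner_Integration.integral_add[OF i3 i1(2)] const ..
      also have "(LINT g|batch X. (frob_norm (X - Xs))\<^sup>2 - 2 * \<eta> * frob_inner (avg_mat n L g) (X - Xs)) =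
          (frob_norm (X - Xs))\<^sup>2 - (LINT g|batch X. 2 * \<eta> * frob_inner (avg_mat n L g) (X - Xs))"
        unfolding Bochner_Integration.integral_diff[OF i1(1) i2] const ..
      also have "(LINT g|batch X. 2 * \<eta> * frob_inner (avg_mat n L g) (X - Xs)) = 2 * \<eta> * frob_inner (grad X) (X - Xs)"
        using ai(2) by (simp only: integral_mult_right_zero)
      finally show "M.P.expectation q = (frob_norm (X - Xs))\<^sup>2 - 2 * \<eta> * frob_inner (grad X) (X - Xs) + \<eta>\<^sup>2 * G\<^sup>2" .
    qed
    have iS: "integrable (batch X) (\<lambda>g. S0)" by (rule M.P.integrable_const)
    have iD: "integrable (batch X) (\<lambda>g. R0\<^sup>2 * indicator Dv g)"
      using M.P.emeasure_finite by (intro integrable_mult_right integrable_real_indicator Dv(1)) (auto simp: less_top[symmetric])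
    note iqS = Bochner_Integration.integrable_add[OF qi(1) iS]
    have bi: "integrable (batch X) b" unfolding b_def by (rule Bochner_Integration.integrable_add[OF iqS iD])
    have "M.P.expectation b = M.P.expectation q + (LINT g|batch X. S0) + (LINT g|batch X. R0\<^sup>2 * indicator Dv g)"
      unfolding b_def Bochner_Integration.integral_add[OF iqS iD] Bochner_Integration.integral_add[OF qi(1) iS] ..
    then have bE: "M.P.expectation b = M.P.expectation q + S0 + R0\<^sup>2 * M.P.prob Dv"
      using Dv(1) M.P.prob_space by simp
    have "(\<integral>\<^sup>+g. ennreal (potential (Suc k) (update k w g)) \<partial>batch (w (Suc k))) \<le> (\<integral>\<^sup>+g. ennreal (b g) \<partial>batch X)"
      using AEb unfolding X_def[symmetric] by (intro nn_integral_mono_AE) (auto intro: ennreal_leI)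
    also have "\<dots> = ennreal (M.P.expectation b)"
    proof (rule nn_integral_eq_integral[OF bi])
      show "AE g in batch X. 0 \<le> b g" using AEb by (rule AE_mp) (auto intro: order_trans[OF potential_nonneg])
    qed
    also have "\<dots> \<le> ennreal (potential k w + (\<eta>\<^sup>2 * G\<^sup>2 + R0\<^sup>2 * fail_prob))"
    proof (rule ennreal_leI)
      have "f X + frob_inner (grad X) (Xs - X) \<le> f Xs"
        by (rule convex_gradient_ineq[OF conv gradient[OF Xsym] Xsym spectrahedronD(1)[OF Xs]])
      moreover have "frob_inner (grad X) (Xs - X) = - frob_inner (grad X) (X - Xs)"
        using Xc Xsc sym_mats_carrier[OF grad_sym[OF Xsym]] by (simp add: frob_inner_diff_right[of _ n])
      ultimately have "\<eta> * excess X \<le> \<eta> * frob_inner (grad X) (X - Xs)"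
        using eta by (simp add: excess_def)
      moreover have "S0 = 2 * \<eta> * (\<Sum>t=1..k. excess (w t)) + 2 * (\<eta> * excess X)"
        by (simp add: S0_def X_def algebra_simps)
      moreover have "potential k w = (frob_norm (X - Xs))\<^sup>2 + 2 * \<eta> * (\<Sum>t=1..k. excess (w t))"
        using True by (simp add: potential_def X_def)
      moreover have "R0\<^sup>2 * M.P.prob Dv \<le> R0\<^sup>2 * fail_prob" using Dv(2) by (intro mult_left_mono) auto
      ultimately show "M.P.expectation b \<le> potential k w + (\<eta>\<^sup>2 * G\<^sup>2 + R0\<^sup>2 * fail_prob)"
        unfolding bE qi(2) by simp
    qed
    finally show ?thesis .
  qed
qed

text \<open>The drift is summed over the steps; the initial value is at most
  \<open>(R0 / 2)\<^sup>2\<close> because \<open>X1\<close> starts in the half-radius ball with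
  admissible rank.\<close>

lemma expected_potential:
  "(\<integral>\<^sup>+w. ennreal (potential k w) \<partial>law k) \<le> ennreal ((R0 / 2)\<^sup>2 + k * (\<eta>\<^sup>2 * G\<^sup>2 + R0\<^sup>2 * fail_prob))"
proof (induction k)
  case 0
  let ?w = "restrict (\<lambda>_. X1) {1..1::nat}"
  have w: "?w \<in> space (hist 0)" using spectrahedronD(1)[OF X1(1)] by (auto simp: space_PiM)
  have "potential 0 ?w \<le> (R0 / 2)\<^sup>2"
    using X1 R0_pos by (auto simp: potential_def good_def intro!: power_mono)
  moreover have "(\<integral>\<^sup>+w. ennreal (potential 0 w) \<partial>law 0) = ennreal (potential 0 ?w)"
    using w potential_measurable[of 0] by (simp add: nn_integral_return)
  ultimately show ?case by (simp add: ennreal_leI)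
next
  case (Suc k)
  let ?c = "\<eta>\<^sup>2 * G\<^sup>2 + R0\<^sup>2 * fail_prob"
  have c: "0 \<le> ?c" using fail_prob_nonneg by simp
  interpret law: prob_space "law k" by (rule prob_space_law)
  have "(\<integral>\<^sup>+w. ennreal (potential (Suc k) w) \<partial>law (Suc k)) =
      (\<integral>\<^sup>+w. (\<integral>\<^sup>+g. ennreal (potential (Suc k) (update k w g)) \<partial>batch (w (Suc k))) \<partial>law k)"
    using potential_measurable by (intro nn_integral_law_Suc) auto
  also have "\<dots> \<le> (\<integral>\<^sup>+w. ennreal (potential k w) + ennreal ?c \<partial>law k)"
  proof (rule nn_integral_mono)
    fix w assume "w \<in> space (law k)"
    then have "w \<in> space (hist k)" using sets_eq_imp_space_eq[OF sets_law] by simp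
    from one_step[OF this]
    show "(\<integral>\<^sup>+g. ennreal (potential (Suc k) (update k w g)) \<partial>batch (w (Suc k))) \<le> ennreal (potential k w) + ennreal ?c"
      using potential_nonneg c by (simp add: ennreal_plus)
  qed
  also have "\<dots> = (\<integral>\<^sup>+w. ennreal (potential k w) \<partial>law k) + ennreal ?c"
  proof -
    have "potential k \<in> borel_measurable (law k)"
      using potential_measurable measurable_cong_sets[OF sets_law refl] by blast
    then show ?thesis using law.emeasure_space_1 by (subst nn_integral_add) auto
  qed
  also have "\<dots> \<le> ennreal ((R0 / 2)\<^sup>2 + k * ?c) + ennreal ?c" using Suc by (rule add_right_mono)
  also have "\<dots> = ennreal ((R0 / 2)\<^sup>2 + Suc k * ?c)"
  proof -
    have kc: "0 \<le> (R0 / 2)\<^sup>2 + k * ?c"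
      by (rule add_nonneg_nonneg[OF zero_le_power2 mult_nonneg_nonneg[OF of_nat_0_le_iff c]])
    have e: "(R0 / 2)\<^sup>2 + Suc k * ?c = ((R0 / 2)\<^sup>2 + k * ?c) + ?c" by (simp add: algebra_simps)
    show ?thesis unfolding e by (rule ennreal_plus[OF kc c, symmetric])
  qed
  finally show ?case .
qed

end

text \<open>Jensen's inequality from the gradient inequality at the average, where the linear terms
  sum to zero.\<close>

lemma convex_avg_mat:
  assumes conv: "convex_on_sym n f" and grad: "\<And>X. X \<in> sym_mats n \<Longrightarrow> has_gradient_sym n f (grad X) X"
    and A: "\<And>k. k \<in> {1..m} \<Longrightarrow> A k \<in> sym_mats n" and m: "1 \<le> m"
  shows "f (avg_mat n m A) \<le> (\<Sum>k=1..m. f (A k)) / m"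
proof -
  define X where "X = avg_mat n m A"
  have X: "X \<in> sym_mats n" unfolding X_def using A by (rule avg_mat_sym)
  have g: "grad X \<in> carrier_mat n n" using grad[OF X] sym_mats_carrier by (auto simp: has_gradient_sym_def)
  have "(\<Sum>k=1..m. frob_inner (A k) (grad X)) = m * frob_inner X (grad X)"
    unfolding X_def using frob_inner_avg_mat[of m A n "grad (avg_mat n m A)"] sym_mats_carrier[OF A] m by simp
  then have z: "(\<Sum>k=1..m. frob_inner (grad X) (A k - X)) = 0"
    using sym_mats_carrier[OF A] sym_mats_carrier[OF X] g frob_inner_comm[OF g]
    by (simp add: frob_inner_diff_right[of _ n] sum_subtractf)
  have "(\<Sum>k=1..m. f X + frob_inner (grad X) (A k - X)) \<le> (\<Sum>k=1..m. f (A k))"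
    using A X by (intro sum_mono convex_gradient_ineq[OF conv grad]) auto
  then have "m * f X \<le> (\<Sum>k=1..m. f (A k))" using z by (simp add: sum.distrib)
  then show ?thesis using m by (simp add: X_def pos_le_divide_eq mult.commute)
qed

context psgd_run
begin

text \<open>The potential stops one excess short of the output, which also involves the last
  iterate. This crude bound, gradient norm times radius, covers the missing term.\<close>

lemma excess_last:
  assumes "good k w"
  shows "excess (w (Suc k)) \<le> G * R0"
proof -
  define X where "X = w (Suc k)"
  have X: "X \<in> spectrahedron n" "frob_norm (X - Xs) \<le> R0" using assms by (auto simp: good_def X_def)
  note s = spectrahedronD(1)[OF X(1)]
  note c = sym_mats_carrier[OF s] spectrahedronD(2)[OF Xs] sym_mats_carrier[OF grad_sym[OF s]]
  interpret Q: query_law "Or X" n "grad X" G B by (rule query_law[OF s])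
  have "f X + frob_inner (grad X) (Xs - X) \<le> f Xs"
    by (rule convex_gradient_ineq[OF conv gradient[OF s] s spectrahedronD(1)[OF Xs]])
  then have "excess X \<le> frob_inner (grad X) (X - Xs)"
    using c by (simp add: excess_def frob_inner_diff_right[of _ n])
  also have "\<dots> \<le> frob_norm (grad X) * frob_norm (X - Xs)"
    using frob_cauchy_schwarz[OF c(3), of "X - Xs"] c by (simp add: abs_le_iff)
  also have "\<dots> \<le> G * R0" using Q.mean_frob_norm X(2) G by (intro mult_mono) auto
  finally show ?thesis by (simp add: X_def)
qed

lemma excess_output:
  assumes w: "good k w" and t: "t \<in> {1..Suc k}"
  shows "excess (psgd_output Random_Iterate n (Suc k) (w, t)) = excess (w t)"
    and "excess (psgd_output Average n (Suc k) (w, t)) \<le> (\<Sum>t=1..Suc k. excess (w t)) / Suc k"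
proof -
  have "f (avg_mat n (Suc k) w) \<le> (\<Sum>t=1..Suc k. f (w t)) / Suc k"
    using w spectrahedronD(1) by (intro convex_avg_mat[OF conv gradient]) (auto simp: good_def)
  moreover have "(\<Sum>t=1..Suc k. excess (w t)) / Suc k = (\<Sum>t=1..Suc k. f (w t)) / Suc k - f Xs"
    by (simp add: excess_def sum_subtractf diff_divide_distrib del: sum.cl_ivl_Suc)
  ultimately show "excess (psgd_output Average n (Suc k) (w, t)) \<le> (\<Sum>t=1..Suc k. excess (w t)) / Suc k"
    by (simp add: excess_def)
qed simp

section \<open>The success event for both output rules\<close>

lemma space_law: "space (law k) = space (hist k)"
  using sets_eq_imp_space_eq[OF sets_law] .

abbreviation run :: "nat \<Rightarrow> ((nat \<Rightarrow> real mat) \<times> nat) measure" where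
  "run k \<equiv> psgd_space n Or (\<lambda>_. \<eta>) L X1 (Suc k)"

lemma sets_run: "sets (run k) = sets (hist k \<Otimes>\<^sub>M count_space {1..Suc k})"
  unfolding psgd_space_def
  by (intro sets_pair_measure_cong) (auto simp: sets_law sets_uniform_count_measure)

lemma output_measurable: "psgd_output rule n (Suc k) \<in> measurable (run k) (sym_borel n)"
proof -
  let ?N = "hist k \<Otimes>\<^sub>M count_space {1..Suc k}"
  have "psgd_output rule n (Suc k) \<in> measurable ?N (sym_borel n)"
  proof (cases rule)
    case Random_Iterate
    have "(\<lambda>p. fst p (snd p)) \<in> measurable ?N (sym_borel n)"
    \<comment> \<open>The random index takes finitely many values, so each coordinate can be treated
      separately.\<close>
    proof (rule measurable_compose_countable'[where g = snd and I = "{1..Suc k}"])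
      fix t assume "t \<in> {1..Suc k}"
      then show "(\<lambda>p. fst p t) \<in> measurable ?N (sym_borel n)"
        by (rule measurable_compose[OF measurable_fst hist_component])
    qed auto
    moreover have "psgd_output rule n (Suc k) = (\<lambda>p. fst p (snd p))"
      using Random_Iterate by (intro ext) (auto simp: split_paired_all)
    ultimately show ?thesis by simp
  next
    case Average
    have "(\<lambda>p. avg_mat n (Suc k) (fst p)) \<in> measurable ?N (sym_borel n)"
      by (rule measurable_compose[OF measurable_fst measurable_avg_mat]) simp
    moreover have "psgd_output rule n (Suc k) = (\<lambda>p. avg_mat n (Suc k) (fst p))"
      using Average by (intro ext) (auto simp: split_paired_all)
    ultimately show ?thesis by simp
  qed
  then show ?thesis using measurable_cong_sets[OF sets_run refl] by blast
qed

definition success :: "output_rule \<Rightarrow> nat \<Rightarrow> real \<Rightarrow> ((nat \<Rightarrow> real mat) \<times> nat) set" where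
  "success rule k \<theta> = {\<omega> \<in> space (run k).
     f (psgd_output rule n (Suc k) \<omega>) - opt_value n f \<le> \<theta> \<and>
     (\<forall>t \<in> {1..k}. vec_space.rank n (fst \<omega> (t + 1)) \<le> r) \<and>
     (rule = Random_Iterate \<longrightarrow> vec_space.rank n (psgd_output rule n (Suc k) \<omega>) \<le> r)}"

lemma success_sets: "success rule k \<theta> \<in> sets (run k)"
proof -
  have 1: "(\<lambda>\<omega>. f (psgd_output rule n (Suc k) \<omega>)) \<in> borel_measurable (run k)"
    using measurable_compose[OF output_measurable gradient_measurable[OF gradient]] by auto
  have "Measurable.pred (run k) (\<lambda>\<omega>. f (psgd_output rule n (Suc k) \<omega>) - opt_value n f \<le> \<theta>)"
    using 1 by measurable
  moreover have "Measurable.pred (run k) (\<lambda>\<omega>. \<forall>t \<in> {1..k}. vec_space.rank n (fst \<omega> (t + 1)) \<le> r)"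
  proof (rule pred_intros_finite)
    fix t assume t: "t \<in> {1..k}"
    have "(\<lambda>\<omega>. fst \<omega> (t + 1)) \<in> measurable (hist k \<Otimes>\<^sub>M count_space {1..Suc k}) (sym_borel n)"
      by (rule measurable_compose[OF measurable_fst hist_component]) (use t in auto)
    then have "(\<lambda>\<omega>. fst \<omega> (t + 1)) \<in> measurable (run k) (sym_borel n)"
      using measurable_cong_sets[OF sets_run refl] by blast
    then show "Measurable.pred (run k) (\<lambda>\<omega>. vec_space.rank n (fst \<omega> (t + 1)) \<le> r)"
      by (rule measurable_compose[OF _ rank_le_measurable])
  qed auto
  moreover have "Measurable.pred (run k) (\<lambda>\<omega>. rule = Random_Iterate \<longrightarrow> vec_space.rank n (psgd_output rule n (Suc k) \<omega>) \<le> r)"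
    using measurable_compose[OF output_measurable rank_le_measurable]
    by (intro pred_intros_logic) auto
  ultimately have "Measurable.pred (run k) (\<lambda>\<omega>. f (psgd_output rule n (Suc k) \<omega>) - opt_value n f \<le> \<theta> \<and>
     (\<forall>t \<in> {1..k}. vec_space.rank n (fst \<omega> (t + 1)) \<le> r) \<and>
     (rule = Random_Iterate \<longrightarrow> vec_space.rank n (psgd_output rule n (Suc k) \<omega>) \<le> r))"
    unfolding pred_def by (intro sets.sets_Collect_conj)
  then show ?thesis unfolding success_def pred_def .
qed

text \<open>Markov's inequality for a fixed history. A history that is not good has
  \<open>potential k w / R0\<^sup>2 = 1\<close>, which covers even certain failure. On a good one
  all ranks are right, so only the accuracy can fail, and averaging over the index bounds this by
  the mean excess divided by \<open>\<theta>\<close>. The hypothesis \<open>big\<close> turns that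
  mean into the same multiple of the potential, with the last iterate charged separately.\<close>

lemma failure_given_history:
  fixes \<theta> :: real
  assumes w: "w \<in> space (hist k)" and \<theta>: "0 < \<theta>" and big: "R0\<^sup>2 \<le> 2 * \<eta> * (Suc k * \<theta>)"
  shows "(\<integral>\<^sup>+t. indicator (space (run k) - success rule k \<theta>) (w, t) \<partial>uniform_count_measure {1..Suc k})
    \<le> ennreal (potential k w / R0\<^sup>2 + G * R0 / (Suc k * \<theta>))"
proof (cases "good k w")
  case False
  interpret U: prob_space "uniform_count_measure {1..Suc k}"
    by (rule prob_space_uniform_count_measure) auto
  have "(\<integral>\<^sup>+t. indicator (space (run k) - success rule k \<theta>) (w, t) \<partial>uniform_count_measure {1..Suc k})
      \<le> (\<integral>\<^sup>+t. 1 \<partial>uniform_count_measure {1..Suc k})"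
    by (intro nn_integral_mono) (auto split: split_indicator)
  also have "\<dots> = 1" using U.emeasure_space_1 by simp
  also have "\<dots> \<le> ennreal (potential k w / R0\<^sup>2 + G * R0 / (Suc k * \<theta>))"
    using False R0_pos G \<theta> by (simp add: potential_def ennreal_1[symmetric] ennreal_leI del: ennreal_1)
  finally show ?thesis .
next
  case True
  define A where "A = (\<Sum>t=1..Suc k. excess (w t))"
  have e0: "0 \<le> excess (w t)" if "t \<in> {1..Suc k}" for t
    using True that by (intro excess_nonneg) (auto simp: good_def)
  have A0: "0 \<le> A" unfolding A_def by (intro sum_nonneg e0)
  have "(\<integral>\<^sup>+t. indicator (space (run k) - success rule k \<theta>) (w, t) \<partial>uniform_count_measure {1..Suc k})
      = (\<Sum>t=1..Suc k. indicator (space (run k) - success rule k \<theta>) (w, t) * ennreal (1 / Suc k))"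
    unfolding uniform_count_measure_def
    by (subst nn_integral_point_measure_finite) (auto simp: mult.commute simp del: sum.cl_ivl_Suc)
  also have "\<dots> \<le> (\<Sum>t=1..Suc k. ennreal (excess (psgd_output rule n (Suc k) (w, t)) / \<theta>) * ennreal (1 / Suc k))"
  proof (intro sum_mono mult_right_mono)
    fix t assume t: "t \<in> {1..Suc k}"
    show "indicator (space (run k) - success rule k \<theta>) (w, t) \<le> ennreal (excess (psgd_output rule n (Suc k) (w, t)) / \<theta>)"
    proof (cases "(w, t) \<in> space (run k) - success rule k \<theta>")
      case bad: True
      have "vec_space.rank n (w (t' + 1)) \<le> r" if "t' \<in> {1..k}" for t'
        using True that by (auto simp: good_def)
      \<comment> \<open>\<open>good k w\<close> includes index 1, so the case that the random index
        selects the starting point is covered.\<close>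
      moreover have "rule = Random_Iterate \<longrightarrow> vec_space.rank n (psgd_output rule n (Suc k) (w, t)) \<le> r"
        using True t by (auto simp: good_def)
      ultimately have "\<theta> < excess (psgd_output rule n (Suc k) (w, t))"
        using bad by (auto simp: success_def excess_def opt_value_eq)
      then have "1 \<le> excess (psgd_output rule n (Suc k) (w, t)) / \<theta>" using \<theta> by simp
      then show ?thesis using bad by (simp add: ennreal_1[symmetric] ennreal_leI del: ennreal_1)
    qed simp
  qed simp
  also have "\<dots> \<le> ennreal (A / (Suc k * \<theta>))"
  proof (cases rule)
    case Random_Iterate
    have "(\<Sum>t=1..Suc k. ennreal (excess (psgd_output rule n (Suc k) (w, t)) / \<theta>) * ennreal (1 / Suc k)) =
        (\<Sum>t=1..Suc k. ennreal (excess (w t) / \<theta> * (1 / Suc k)))"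
      using excess_output(1)[OF True] e0 \<theta> Random_Iterate
      by (intro sum.cong refl) (simp add: ennreal_mult[symmetric] del: mult_1_right)
    also have "\<dots> = ennreal (\<Sum>t=1..Suc k. excess (w t) / \<theta> * (1 / Suc k))"
      using e0 \<theta> by (intro sum_ennreal) auto
    also have "(\<Sum>t=1..Suc k. excess (w t) / \<theta> * (1 / Suc k)) = A / (Suc k * \<theta>)"
      by (simp add: A_def sum_divide_distrib mult.commute del: sum.cl_ivl_Suc of_nat_Suc)
    finally show ?thesis by simp
  next
    case Average
    \<comment> \<open>The averaged output does not depend on the index, and convexity has already
      bounded its excess by the mean.\<close>
    have "(\<Sum>t=1..Suc k. ennreal (excess (psgd_output rule n (Suc k) (w, t)) / \<theta>) * ennreal (1 / Suc k)) \<le>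
        (\<Sum>t=1..Suc k. ennreal (A / (Suc k * \<theta>)) * ennreal (1 / Suc k))"
    proof (intro sum_mono mult_right_mono ennreal_leI)
      fix t assume t: "t \<in> {1..Suc k}"
      have "excess (psgd_output rule n (Suc k) (w, t)) \<le> A / Suc k"
        using excess_output(2)[OF True t] Average by (simp add: A_def)
      then have "excess (psgd_output rule n (Suc k) (w, t)) / \<theta> \<le> A / Suc k / \<theta>"
        using \<theta> by (intro divide_right_mono) auto
      then show "excess (psgd_output rule n (Suc k) (w, t)) / \<theta> \<le> A / (Suc k * \<theta>)" by simp
    qed simp
    also have "\<dots> = (\<Sum>t=1..Suc k. ennreal (A / (Suc k * \<theta>) * (1 / Suc k)))"
      using A0 \<theta> by (intro sum.cong refl ennreal_mult[symmetric]) auto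
    also have "\<dots> = ennreal (\<Sum>t=1..Suc k. A / (Suc k * \<theta>) * (1 / Suc k))"
      using A0 \<theta> by (intro sum_ennreal) auto
    also have "(\<Sum>t=1..Suc k. A / (Suc k * \<theta>) * (1 / Suc k)) = A / (Suc k * \<theta>)"
      by (simp del: sum.cl_ivl_Suc of_nat_Suc)
    finally show ?thesis .
  qed
  also have "\<dots> \<le> ennreal (potential k w / R0\<^sup>2 + G * R0 / (Suc k * \<theta>))"
  proof (rule ennreal_leI)
    define A' where "A' = (\<Sum>t=1..k. excess (w t))"
    have kt: "0 < Suc k * \<theta>" using \<theta> by simp
    have A'0: "0 \<le> A'" unfolding A'_def by (intro sum_nonneg e0) auto
    have "A = A' + excess (w (Suc k))" by (simp add: A_def A'_def)
    then have "A / (Suc k * \<theta>) \<le> (A' + G * R0) / (Suc k * \<theta>)"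
      using excess_last[OF True] kt by (intro divide_right_mono) auto
    also have "\<dots> = A' / (Suc k * \<theta>) + G * R0 / (Suc k * \<theta>)" by (rule add_divide_distrib)
    \<comment> \<open>Expanding by \<open>2 * \<eta>\<close> exhibits the accumulated excess as it
      occurs in the potential; \<open>big\<close> then permits \<open>R0\<^sup>2\<close> as the
      denominator.\<close>
    also have "A' / (Suc k * \<theta>) \<le> potential k w / R0\<^sup>2"
    proof -
      have "A' / (Suc k * \<theta>) = (2 * \<eta> * A') / (2 * \<eta> * (Suc k * \<theta>))" using eta by simp
      also have "\<dots> \<le> (2 * \<eta> * A') / R0\<^sup>2"
        using big R0_pos eta A'0 kt \<theta> by (intro divide_left_mono mult_pos_pos) auto
      also have "\<dots> \<le> potential k w / R0\<^sup>2"
        using True by (intro divide_right_mono) (auto simp: potential_def A'_def)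
      finally show ?thesis .
    qed
    finally show "A / (Suc k * \<theta>) \<le> potential k w / R0\<^sup>2 + G * R0 / (Suc k * \<theta>)" by simp
  qed
  finally show ?thesis .
qed

text \<open>Integration of the conditional bound over the history replaces the potential by its
  expectation, for either output rule.\<close>

lemma success_prob:
  fixes \<theta> :: real
  assumes \<theta>: "0 < \<theta>" and big: "R0\<^sup>2 \<le> 2 * \<eta> * (Suc k * \<theta>)"
  shows "1 - (((R0 / 2)\<^sup>2 + k * (\<eta>\<^sup>2 * G\<^sup>2 + R0\<^sup>2 * fail_prob)) / R0\<^sup>2 + G * R0 / (Suc k * \<theta>))
    \<le> measure (run k) (success rule k \<theta>)"
proof -
  define c where "c = \<eta>\<^sup>2 * G\<^sup>2 + R0\<^sup>2 * fail_prob"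
  define b where "b = G * R0 / (Suc k * \<theta>)"
  have c: "0 \<le> c" unfolding c_def using fail_prob_nonneg by simp
  have b: "0 \<le> b" unfolding b_def using G R0_pos \<theta> by simp
  interpret law: prob_space "law k" by (rule prob_space_law)
  interpret U: prob_space "uniform_count_measure {1..Suc k}"
    by (rule prob_space_uniform_count_measure) auto
  interpret run: prob_space "run k"
    unfolding psgd_space_def using law.prob_space_axioms U.prob_space_axioms by (simp add: prob_space_pair)
  define F where "F = space (run k) - success rule k \<theta>"
  have F: "F \<in> sets (law k \<Otimes>\<^sub>M uniform_count_measure {1..Suc k})"
    using success_sets unfolding F_def by (auto simp: psgd_space_def)
  have "emeasure (run k) F = (\<integral>\<^sup>+w. \<integral>\<^sup>+t. indicator F (w, t) \<partial>uniform_count_measure {1..Suc k} \<partial>law k)"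
    using U.emeasure_pair_measure[OF F] by (simp add: psgd_space_def)
  also have "\<dots> \<le> (\<integral>\<^sup>+w. ennreal (1 / R0\<^sup>2) * ennreal (potential k w) + ennreal b \<partial>law k)"
  proof (rule nn_integral_mono)
    fix w assume "w \<in> space (law k)"
    then have "(\<integral>\<^sup>+t. indicator F (w, t) \<partial>uniform_count_measure {1..Suc k}) \<le> ennreal (potential k w / R0\<^sup>2 + b)"
      unfolding F_def b_def space_law by (rule failure_given_history[OF _ \<theta> big])
    also have "\<dots> = ennreal (1 / R0\<^sup>2) * ennreal (potential k w) + ennreal b"
      using potential_nonneg b by (simp add: ennreal_plus ennreal_mult[symmetric])
    finally show "(\<integral>\<^sup>+t. indicator F (w, t) \<partial>uniform_count_measure {1..Suc k}) \<le> ennreal (1 / R0\<^sup>2) * ennreal (potential k w) + ennreal b" .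
  qed
  also have "\<dots> = ennreal (1 / R0\<^sup>2) * (\<integral>\<^sup>+w. ennreal (potential k w) \<partial>law k) + ennreal b"
  proof -
    have "potential k \<in> borel_measurable (law k)"
      using potential_measurable measurable_cong_sets[OF sets_law refl] by blast
    then show ?thesis using law.emeasure_space_1 by (simp add: nn_integral_add nn_integral_cmult)
  qed
  also have "\<dots> \<le> ennreal (1 / R0\<^sup>2) * ennreal ((R0 / 2)\<^sup>2 + k * c) + ennreal b"
    unfolding c_def by (intro add_right_mono mult_left_mono expected_potential) auto
  also have "\<dots> = ennreal (((R0 / 2)\<^sup>2 + k * c) / R0\<^sup>2 + b)"
  proof -
    have x: "0 \<le> (R0 / 2)\<^sup>2 + k * c"
      by (rule add_nonneg_nonneg[OF zero_le_power2 mult_nonneg_nonneg[OF of_nat_0_le_iff c]])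
    have "ennreal (1 / R0\<^sup>2) * ennreal ((R0 / 2)\<^sup>2 + k * c) = ennreal (((R0 / 2)\<^sup>2 + k * c) / R0\<^sup>2)"
      by (subst ennreal_mult[OF _ x, symmetric]) auto
    moreover have "0 \<le> ((R0 / 2)\<^sup>2 + k * c) / R0\<^sup>2" using x by simp
    ultimately show ?thesis using b by (simp only: ennreal_plus)
  qed
  finally have le: "ennreal (run.prob F) \<le> ennreal (((R0 / 2)\<^sup>2 + k * c) / R0\<^sup>2 + b)"
    by (simp only: run.emeasure_eq_measure)
  have "0 \<le> ((R0 / 2)\<^sup>2 + k * c) / R0\<^sup>2 + b"
    by (intro add_nonneg_nonneg divide_nonneg_nonneg mult_nonneg_nonneg zero_le_power2 of_nat_0_le_iff b c)
  from le[unfolded ennreal_le_iff[OF this]] have "run.prob F \<le> ((R0 / 2)\<^sup>2 + k * c) / R0\<^sup>2 + b" .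
  moreover have "run.prob F = 1 - run.prob (success rule k \<theta>)"
    unfolding F_def by (rule run.prob_compl[OF success_sets])
  ultimately show ?thesis by (simp add: b_def c_def)
qed

end

text \<open>Step size and accuracy are balanced so that \<open>2 * \<eta> * (T * \<theta>) =
  R0\<^sup>2 * (2 * ln T / ln (8 * T))\<close>. The factor 10 in the step size keeps the accumulated
  noise below \<open>R0\<^sup>2 / 100\<close>; the matching factor 10 in the accuracy is the
  constant of the error bound.\<close>

lemma horizon_estimates:
  fixes T :: nat and G R0 \<eta> \<theta> :: real
  assumes T: "8 \<le> T" and G: "0 < G" and R0: "0 < R0"
  defines "\<eta> \<equiv> R0 / (10 * G * sqrt T * ln (8 * real T))" and "\<theta> \<equiv> 10 * (G * R0 * ln T / sqrt T)"
  shows "0 < \<eta>" "0 < \<theta>" "1 \<le> ln T" "R0\<^sup>2 \<le> 2 * \<eta> * (T * \<theta>)"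
    "T * (\<eta>\<^sup>2 * G\<^sup>2) \<le> R0\<^sup>2 / 100" "G * R0 / (T * \<theta>) \<le> 1 / 10"
proof -
  have exp1: "exp 1 \<le> real T" using exp_le T by simp
  have lnT: "1 \<le> ln T" using ln_le_cancel_iff[of "exp 1" "real T"] exp1 T by simp
  show "1 \<le> ln T" by (rule lnT)
  have "ln T \<le> ln (8 * real T)" using T by simp
  then have ln8: "1 \<le> ln (8 * real T)" using lnT by simp
  have T0: "0 < real T" using T by simp
  have sT: "0 < sqrt T" "sqrt T * sqrt T = T" using T by auto
  show "0 < \<eta>" unfolding \<eta>_def using R0 G sT ln8 by (intro divide_pos_pos mult_pos_pos) auto
  show "0 < \<theta>" unfolding \<theta>_def using R0 G sT lnT T by (intro divide_pos_pos mult_pos_pos) auto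
  have Tt: "T * \<theta> = 10 * G * R0 * ln T * sqrt T"
  proof -
    have "T * \<theta> = sqrt T * sqrt T * (10 * (G * R0 * ln T / sqrt T))" unfolding \<theta>_def sT(2) ..
    also have "\<dots> = 10 * G * R0 * ln T * sqrt T" using sT(1) by (simp add: field_simps)
    finally show ?thesis .
  qed
  \<comment> \<open>From \<open>T \<ge> 8\<close> on, \<open>8 * T\<close> is at most
    \<open>T * T\<close>.\<close>
  have "ln (8 * real T) \<le> 2 * ln T"
  proof -
    have "8 * real T \<le> real T * real T" using T by (intro mult_right_mono) auto
    then have "ln (8 * real T) \<le> ln (real T * real T)" using T by (subst ln_le_cancel_iff) auto
    also have "\<dots> = 2 * ln T" using T by (subst ln_mult) auto
    finally show ?thesis .
  qed
  then have ratio: "1 \<le> 2 * ln T / ln (8 * real T)" using ln8 by simp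
  have "2 * \<eta> * (T * \<theta>) = R0\<^sup>2 * (2 * ln T / ln (8 * real T))"
    unfolding Tt \<eta>_def using G sT(1) ln8 by (simp add: power2_eq_square)
  then show "R0\<^sup>2 \<le> 2 * \<eta> * (T * \<theta>)" using mult_left_mono[OF ratio, of "R0\<^sup>2"] by simp
  have "T * (\<eta>\<^sup>2 * G\<^sup>2) = R0\<^sup>2 / 100 / (ln (8 * real T))\<^sup>2"
    unfolding \<eta>_def using G T0 by (simp add: power_divide power_mult_distrib)
  also have "\<dots> \<le> R0\<^sup>2 / 100"
  proof -
    have "R0\<^sup>2 / 100 / (ln (8 * real T))\<^sup>2 \<le> R0\<^sup>2 / 100 / 1"
      using one_le_power[OF ln8, of 2] by (intro divide_left_mono) auto
    then show ?thesis by simp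
  qed
  finally show "T * (\<eta>\<^sup>2 * G\<^sup>2) \<le> R0\<^sup>2 / 100" .
  have "1 \<le> sqrt T" using T by simp
  then have "1 \<le> ln T * sqrt T" using mult_mono[OF lnT, of 1 "sqrt T"] lnT by simp
  moreover have "G * R0 / (T * \<theta>) = 1 / 10 / (ln T * sqrt T)"
    unfolding Tt using G R0 by simp
  ultimately show "G * R0 / (T * \<theta>) \<le> 1 / 10"
    using divide_left_mono[of 1 "ln T * sqrt T" "1 / 10 :: real"] by simp
qed

text \<open>The constant 1024 is \<open>4 * 16\<^sup>2\<close>: it raises the exponent at level
  \<open>\<delta> / 16\<close> to at least \<open>2 * ln T\<close>. Each net point then contributes
  at most \<open>2 / T\<^sup>2\<close> per step, so \<open>T\<close> steps give at most
  \<open>2 * card S / T\<close>, and \<open>20 * card S \<le> T\<close> brings this down to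
  1/10.\<close>

lemma (in psgd_run) fail_prob_le:
  assumes T: "8 \<le> T" "20 * card S \<le> T"
    and batch: "1024 * (B\<^sup>2 * (real r)\<^sup>2 / \<delta>\<^sup>2 * ln (real n * real T)) \<le> L"
  shows "T * fail_prob \<le> 1 / 10"
proof -
  have nT: "real T \<le> real n * real T" using n_pos T by simp
  have lnT: "0 \<le> ln T" "ln T \<le> ln (real n * real T)"
    using T nT by (auto simp del: of_nat_mult simp flip: of_nat_mult)
  have "1 * ln T \<le> (real r)\<^sup>2 * ln (real n * real T)"
    using lnT r_pos by (intro mult_mono) auto
  also have "\<dots> = (1024 * (B\<^sup>2 * (real r)\<^sup>2 / \<delta>\<^sup>2 * ln (real n * real T))) * (\<delta>\<^sup>2 / (1024 * B\<^sup>2))"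
    using B \<delta> by simp
  also have "\<dots> \<le> L * (\<delta>\<^sup>2 / (1024 * B\<^sup>2))"
    using batch by (intro mult_right_mono) auto
  finally have "2 * ln T \<le> L * (\<delta> / 16)\<^sup>2 / (2 * B\<^sup>2)"
    using B by (simp add: power_divide)
  then have "exp (- (L * (\<delta> / 16)\<^sup>2 / (2 * B\<^sup>2))) \<le> exp (- (2 * ln T))" by simp
  also have "exp (- (2 * ln T)) = 1 / (real T * real T)"
  proof -
    have "exp (2 * ln (real T)) = exp (ln (real T)) * exp (ln (real T))"
      by (simp only: mult_2 exp_add)
    also have "exp (ln (real T)) = real T" using T by simp
    finally show ?thesis by (simp only: exp_minus inverse_eq_divide)
  qed
  finally have "T * fail_prob \<le> T * (card S * (2 * (1 / (real T * real T))))"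
    unfolding fail_prob_def by (intro mult_left_mono) auto
  also have "\<dots> = 2 * card S / T" using T by (simp add: field_simps)
  also have "\<dots> \<le> 1 / 10" using T by (simp add: field_simps flip: of_nat_mult)
  finally show ?thesis .
qed

theorem theorem1:
  shows "\<exists>C1::real > 0. \<exists>C2::real > 0.
    \<forall>(n::nat) (r::nat) (\<beta>::real) (G::real) (B::real) (\<sigma>::real) (\<delta>::real) (lam::real).
    \<exists>T0::nat.
    \<forall>(f::real mat \<Rightarrow> real) (grad::real mat \<Rightarrow> real mat) (Or::real mat \<Rightarrow> real mat measure)
     (Xs::real mat) (X1::real mat) (R0::real) (T::nat) (\<eta>::real) (L::nat) (rule::output_rule).
      convex_on_sym n f \<and> smooth_with_gradient n \<beta> f grad \<and>
      0 < G \<and> 0 < B \<and> 0 < \<sigma> \<and> stochastic_oracle n grad G B \<sigma> Or \<and>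
      is_arg_min f (\<lambda>X. X \<in> spectrahedron n) Xs \<and>
      vec_space.rank n Xs = r \<and> r < n \<and> lam = lambda_desc r Xs \<and>
      0 < lambda_desc (n - r) (grad Xs) - lambda_desc n (grad Xs) \<and>
      0 < \<delta> \<and> \<delta> \<le> lambda_desc (n - r) (grad Xs) - lambda_desc n (grad Xs) \<and>
      R0 = R0_radius r \<beta> B lam \<delta> \<and>
      X1 \<in> spectrahedron n \<and> vec_space.rank n X1 \<le> r \<and> frob_norm (X1 - Xs) \<le> R0 / 2 \<and>
      T \<ge> T0 \<and>
      \<eta> = R0 / (10 * G * sqrt (real T) * ln (8 * real T)) \<and>
      real L \<ge> C1 * max ((\<sigma> / (G * R0))\<^sup>2) (B\<^sup>2 * (real r)\<^sup>2 / \<delta>\<^sup>2 * ln (real n * real T))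
      \<longrightarrow>
      measure (psgd_space n Or (\<lambda>_. \<eta>) L X1 T)
        {\<omega> \<in> space (psgd_space n Or (\<lambda>_. \<eta>) L X1 T).
           f (psgd_output rule n T \<omega>) - opt_value n f \<le> C2 * (G * R0 * ln (real T) / sqrt (real T)) \<and>
           (\<forall>t \<in> {1..T - 1}. vec_space.rank n (fst \<omega> (t + 1)) \<le> r) \<and>
           (rule = Random_Iterate \<longrightarrow> vec_space.rank n (psgd_output rule n T \<omega>) \<le> r)}
      \<ge> 1 / 2"
proof (rule exI[of _ 1024], rule conjI[OF _ exI[of _ 10]], simp, rule conjI, simp, intro allI)
  fix n r :: nat and \<beta> G B \<sigma> \<delta> lam :: real
  \<comment> \<open>The net must be fixed before \<open>f\<close> and the oracle, and thus before
    the signs of \<open>\<delta>\<close> and \<open>G\<close> are known; the implication lets it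
    exist in every case.\<close>
  have "\<exists>S. 0 < \<delta> \<and> 0 < G \<longrightarrow> finite S \<and> (\<forall>v\<in>S. v \<in> carrier_vec n \<and> v \<bullet> v \<le> 1) \<and>
     (\<forall>x\<in>carrier_vec n. x \<bullet> x = 1 \<longrightarrow> (\<exists>v\<in>S. (x - v) \<bullet> (x - v) \<le> (\<delta> / 16 / (4 * G))\<^sup>2))"
    using finite_net[of "\<delta> / 16 / (4 * G)" n] by (cases "0 < \<delta> \<and> 0 < G") auto
  then obtain S where S: "0 < \<delta> \<and> 0 < G \<Longrightarrow> finite S \<and> (\<forall>v\<in>S. v \<in> carrier_vec n \<and> v \<bullet> v \<le> 1) \<and>
     (\<forall>x\<in>carrier_vec n. x \<bullet> x = 1 \<longrightarrow> (\<exists>v\<in>S. (x - v) \<bullet> (x - v) \<le> (\<delta> / 16 / (4 * G))\<^sup>2))"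
    by blast
  show "\<exists>T0. \<forall>f grad Or Xs X1 R0 T \<eta> L rule.
      convex_on_sym n f \<and> smooth_with_gradient n \<beta> f grad \<and>
      0 < G \<and> 0 < B \<and> 0 < \<sigma> \<and> stochastic_oracle n grad G B \<sigma> Or \<and>
      is_arg_min f (\<lambda>X. X \<in> spectrahedron n) Xs \<and>
      vec_space.rank n Xs = r \<and> r < n \<and> lam = lambda_desc r Xs \<and>
      0 < lambda_desc (n - r) (grad Xs) - lambda_desc n (grad Xs) \<and>
      0 < \<delta> \<and> \<delta> \<le> lambda_desc (n - r) (grad Xs) - lambda_desc n (grad Xs) \<and>
      R0 = R0_radius r \<beta> B lam \<delta> \<and>
      X1 \<in> spectrahedron n \<and> vec_space.rank n X1 \<le> r \<and> frob_norm (X1 - Xs) \<le> R0 / 2 \<and>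
      T0 \<le> T \<and>
      \<eta> = R0 / (10 * G * sqrt (real T) * ln (8 * real T)) \<and>
      1024 * max ((\<sigma> / (G * R0))\<^sup>2) (B\<^sup>2 * (real r)\<^sup>2 / \<delta>\<^sup>2 * ln (real n * real T)) \<le> real L
      \<longrightarrow>
      1 / 2 \<le> measure (psgd_space n Or (\<lambda>_. \<eta>) L X1 T)
        {\<omega> \<in> space (psgd_space n Or (\<lambda>_. \<eta>) L X1 T).
           f (psgd_output rule n T \<omega>) - opt_value n f \<le> 10 * (G * R0 * ln (real T) / sqrt (real T)) \<and>
           (\<forall>t \<in> {1..T - 1}. vec_space.rank n (fst \<omega> (t + 1)) \<le> r) \<and>
           (rule = Random_Iterate \<longrightarrow> vec_space.rank n (psgd_output rule n T \<omega>) \<le> r)}"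
  \<comment> \<open>8 serves the logarithmic estimates, and \<open>20 * card S\<close> the union
    bound over the net.\<close>
  proof (rule exI[of _ "max 8 (20 * card S)"], intro allI impI, elim conjE)
    fix f grad Or Xs X1 R0 T \<eta> L rule
    assume conv: "convex_on_sym n f" "smooth_with_gradient n \<beta> f grad" and pos: "0 < G" "0 < B"
      and answers: "stochastic_oracle n grad G B \<sigma> Or" and opt: "is_arg_min f (\<lambda>X. X \<in> spectrahedron n) Xs"
      and rk: "vec_space.rank n Xs = r" "r < n" and lam: "lam = lambda_desc r Xs"
      and \<delta>: "0 < \<delta>" "\<delta> \<le> lambda_desc (n - r) (grad Xs) - lambda_desc n (grad Xs)"
      and R0: "R0 = R0_radius r \<beta> B lam \<delta>"
      and X1: "X1 \<in> spectrahedron n" "vec_space.rank n X1 \<le> r" "frob_norm (X1 - Xs) \<le> R0 / 2"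
      and T: "max 8 (20 * card S) \<le> T" and \<eta>: "\<eta> = R0 / (10 * G * sqrt (real T) * ln (8 * real T))"
      and L: "1024 * max ((\<sigma> / (G * R0))\<^sup>2) (B\<^sup>2 * (real r)\<^sup>2 / \<delta>\<^sup>2 * ln (real n * real T)) \<le> real L"
    interpret low_rank_problem n r \<beta> G B \<sigma> \<delta> lam f grad Or Xs R0
      by unfold_locales (use conv pos answers opt rk lam \<delta> R0 in auto)
    define \<theta> where "\<theta> = 10 * (G * R0 * ln (real T) / sqrt (real T))"
    have T8: "8 \<le> T" "20 * card S \<le> T" using T by auto
    note est = horizon_estimates[OF T8(1) pos(1) R0_pos, folded \<eta> \<theta>_def]
    have batch: "1024 * (B\<^sup>2 * (real r)\<^sup>2 / \<delta>\<^sup>2 * ln (real n * real T)) \<le> L" using L by simp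
    \<comment> \<open>A product above 1 makes \<open>ln (n * T)\<close> positive, so the required
      batch size is positive and \<open>L\<close> is at least 1.\<close>
    have "1 * 1 < real n * real T" using n_pos T8 by (intro mult_le_less_imp_less) auto
    then have "0 < 1024 * (B\<^sup>2 * (real r)\<^sup>2 / \<delta>\<^sup>2 * ln (real n * real T))"
      using pos \<delta>(1) r_pos by (intro mult_pos_pos divide_pos_pos) auto
    then have "1 \<le> L" using batch by linarith
    then interpret psgd_run n r \<beta> G B \<sigma> \<delta> lam f grad Or Xs R0 \<eta> L S X1
      using S \<delta>(1) pos(1) est(1) X1 by unfold_locales auto
    define k where "k = T - 1"
    have Tk: "T = Suc k" using T8 by (simp add: k_def)
    \<comment> \<open>The failure budget: 1/4 from the initial distance, 1/100 from the gradient
      noise, 1/10 from deviating batches and 1/10 from the last iterate, in total 46/100.\<close>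
    have "((R0 / 2)\<^sup>2 + k * (\<eta>\<^sup>2 * G\<^sup>2 + R0\<^sup>2 * fail_prob)) / R0\<^sup>2 + G * R0 / (Suc k * \<theta>) \<le> 1 / 2"
    proof -
      have "k * (\<eta>\<^sup>2 * G\<^sup>2) \<le> T * (\<eta>\<^sup>2 * G\<^sup>2)" "k * fail_prob \<le> T * fail_prob"
        using fail_prob_nonneg Tk by (auto intro!: mult_right_mono)
      then have "k * (\<eta>\<^sup>2 * G\<^sup>2) \<le> R0\<^sup>2 / 100" "k * fail_prob \<le> 1 / 10"
        using est(5) fail_prob_le[OF T8 batch] by linarith+
      then have "(R0 / 2)\<^sup>2 + k * (\<eta>\<^sup>2 * G\<^sup>2) + R0\<^sup>2 * (k * fail_prob) \<le> R0\<^sup>2 / 4 + R0\<^sup>2 / 100 + R0\<^sup>2 * (1 / 10)"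
        by (intro add_mono mult_left_mono) (auto simp: power_divide)
      also have "\<dots> = 36 / 100 * R0\<^sup>2" by simp
      finally have "((R0 / 2)\<^sup>2 + k * (\<eta>\<^sup>2 * G\<^sup>2 + R0\<^sup>2 * fail_prob)) / R0\<^sup>2 \<le> 36 / 100"
        using R0_pos by (simp add: pos_divide_le_eq algebra_simps)
      then show ?thesis using est(6) unfolding Tk by linarith
    qed
    then have "1 / 2 \<le> measure (run k) (success rule k \<theta>)"
      using success_prob[OF est(2) est(4)[unfolded Tk], of rule] by linarith
    then show "1 / 2 \<le> measure (psgd_space n Or (\<lambda>_. \<eta>) L X1 T)
        {\<omega> \<in> space (psgd_space n Or (\<lambda>_. \<eta>) L X1 T).
           f (psgd_output rule n T \<omega>) - opt_value n f \<le> 10 * (G * R0 * ln (real T) / sqrt (real T)) \<and>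
           (\<forall>t \<in> {1..T - 1}. vec_space.rank n (fst \<omega> (t + 1)) \<le> r) \<and>
           (rule = Random_Iterate \<longrightarrow> vec_space.rank n (psgd_output rule n T \<omega>) \<le> r)}"
      unfolding success_def \<theta>_def Tk by simp
  qed
qed

end
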